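(* Let $\gamma>0$ and consider the plant, the graph, the sampling times and the Round-Robin observer network described in the context. Suppose there exist, for $i=1,\ldots,N$, matrices $Y_i=Y_i'>0$, $X_i\in\mathbf{R}^{n\times n}$ with $\det X_i\neq 0$, $F_i\in\mathbf{R}^{n\times h_i}$, $U_i\in\mathbf{R}^{n\times r_i}$, $S_i=S_i'\ge 0$, $R_i=R_i'\ge 0$, $W_i=W_i'\ge 0$, $G_i\in\mathbf{R}^{n\times n}$ (with $Y_i,S_i,R_i,W_i\in\mathbf{R}^{n\times n}$), and constants $\alpha_i>0$, $0\le \pi_i<2\alpha_i q_i^{-1}$, $\epsilon_i>0$, $\bar\epsilon_i>0$, such that for every $i=1,\ldots,N$ $$\begin{bmatrix}R_i & G_i\\ G_i' & R_i\end{bmatrix}\ge 0 \qquad\text{and}\qquad \bar\Xi_i<0,$$ where $\bar\Xi_i$ is the symmetric block matrix ($\star$ denotes blocks determined by symmetry) $$\bar\Xi_i=\begin{bmatrix} \bar\Xi_{aa} & \bar\Xi_{ab} & \bar\Xi_{ac} & 0 & 0 & \bar\Xi_{af} & \bar\Xi_{ag}\\ \star & \bar\Xi_{bb} & \bar\Xi_{bc} & -\tilde\Psi_{i,13} & \bar\Xi_{be} & \bar\Xi_{bf} & \bar\Xi_{bg}\\ \star & \star & -\tilde\Psi_{i,22} & -\tilde\Psi_{i,23} & 0 & \bar\Xi_{cf} & 0 \\ \star & \star & \star & -\tilde\Psi_{i,33} & 0 & 0 & 0 \\ \star & \star & \star & \star & -\bar\Phi_{i,11} & -\bar\Phi_{i,12}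 & 0 \\ \star & \star & \star & \star & \star & \bar\Xi_{ff} & \bar\Xi_{fg}\\ \star & \star & \star & \star & \star & \star & -I \end{bmatrix}$$ with $\bar\Xi_{aa}=\tau_i^2R_i+\big(\sum_{j:\,i\in\mathcal{V}_j}\tau_j^2\big)W_i-\epsilon_iX_i-\epsilon_iX_i'$, $\bar\Xi_{ab}=Y_i^{-1}-X_i+\epsilon_i(X_i'A-U_iC_i)$, $\bar\Xi_{ac}=-\epsilon_i(\mathbf{1}_{p_i}'\otimes F_iH_i)$, $\bar\Xi_{af}=\mathbf{1}_{p_i}'\otimes(-\bar\epsilon_iX_i+\epsilon_iF_iH_i)$, $\bar\Xi_{ag}=\epsilon_i(X_i'B-U_iD_i)$, $\bar\Xi_{bb}=\frac{p_i+q_i}{\gamma^2}I-\tilde\Psi_{i,11}+X_i'A-U_iC_i+A'X_i-C_i'U_i'$, $\bar\Xi_{bc}=-\tilde\Psi_{i,12}-\mathbf{1}_{p_i}'\otimes(F_iH_i)$, $\bar\Xi_{be}=-\frac{1}{\gamma^2}(\mathbf{1}_{p_i}'\otimes I)$, $\bar\Xi_{bf}=\mathbf{1}_{p_i}'\otimes(F_iH_i+\bar\epsilon_iA'X_i-\bar\epsilon_iC_i'U_i')$, $\bar\Xi_{bg}=X_i'B-U_iD_i$, $\bar\Xi_{cf}=-\mathbf{1}_{p_i}\mathbf{1}_{p_i}'\otimes(\bar\epsilon_iH_i'F_i')$, $\bar\Xi_{ff}=\bar\epsilon_i\mathbf{1}_{p_i}\mathbf{1}_{p_i}'\otimes(F_iH_i+H_i'F_i')-\bar\Phi_{i,22}$,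 $\bar\Xi_{fg}=\bar\epsilon_i\mathbf{1}_{p_i}\otimes(X_i'B-U_iD_i)$, and $\tilde\Psi_i$, $\bar\Phi_i$ are as defined in the context. Then the network of observers with gains $$K_i=(X_i')^{-1}F_i,\qquad L_i=(X_i')^{-1}U_i,\qquad i=1,\ldots,N,$$ solves the distributed estimation problem, i.e. conditions (i) and (ii) of the context hold, and (ii) holds with $$P=\frac1N\sum_{i=1}^N\Big(Y_i^{-1}+\frac{1-e^{-2\alpha_i\tau_i}}{2\alpha_i}S_i\Big).$$
   Context: **Notation.** $'$ denotes transpose, $\otimes$ the Kronecker product, $\mathbf{1}_p\in\mathbf{R}^p$ the column of ones, $\|\cdot\|$ the Euclidean norm, $\|z\|_2=(\int_0^\infty\|z(t)\|^2dt)^{1/2}$. **Graph.** $\mathcal{G}=(\mathcal{V},\mathcal{E})$ is a weakly connected directed graph without self-loops, $\mathcal{V}=\{1,\ldots,N\}$; $(j,i)$ is the edge from $j$ to $i$. $\mathcal{V}_i=\{j:(j,i)\in\mathcal{E}\}$ is the neighbourhood of $i$, ordered in ascending order; $p_i$ is its cardinality (in-degree) and $q_i$ is the out-degree of $i$ (if $q_i=0$, $q_i^{-1}$ is read as $+\infty$). The shift permutation is $\Pi\{j_1,\ldots,j_{p_i-1},j_{p_i}\}=\{j_{p_i},j_1,\ldots,j_{p_i-1}\}$; $\Pi^k(\mathcal{V}_i)$ is the ordered set obtained after $k$ shifts, and for $j\in\mathcal{V}_i$, $\nu_j=\nu_j^{k,i}\in\{1,\ldots,p_i\}$ is the position of $j$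 in $\Pi^k(\mathcal{V}_i)$. **Plant and measurements.** $\dot x=Ax+B_2w$ for $t\ge0$, $x(t)=x_0$ for $t\le 0$, $x\in\mathbf{R}^n$, $w\in\mathbf{R}^{m_w}$; node $i$ measures $y_i=C_ix+D_{2i}w+\bar D_{2i}v_i\in\mathbf{R}^{r_i}$, $v_i\in\mathbf{R}^{m_v}$. The disturbances $w,v_i$ are in $L_2[0,\infty)$. Put $\xi_i=[w'\ v_i']'$, $\xi=[\xi_1'\ \ldots\ \xi_N']'$, $B=[B_2\ 0]$, $D_i=[D_{2i}\ \bar D_{2i}]$. **Sampling and observers.** $0=t_0<t_1<t_2<\cdots$, $t_k\to\infty$, are the sampling times. Given matrices $H_i\in\mathbf{R}^{h_i\times n}$, and gains $L_i\in\mathbf{R}^{n\times r_i}$, $K_i\in\mathbf{R}^{n\times h_i}$, the observers are, for $t\in[t_k,t_{k+1})$, $k=0,1,\ldots$, $$\dot{\hat x}_i=A\hat x_i+L_i(y_i-C_i\hat x_i)+K_i\sum_{j\in\Pi^k(\mathcal{V}_i)}H_i\big(\hat x_j(t_{k-\nu_j+1})-\hat x_i(t_{k-\nu_j+1})\big),$$ with $\hat x_i(t)=0$ for $t\le0$; samples with negative index ($k-\nu_j+1<0$) are taken at nonpositive times, so the corresponding differences are zero. The errors $e_i=x-\hat x_i$ satisfy, for $t\in[t_k,t_{k+1})$, $$\dot e_i=(A-L_iC_i)e_i+(B-L_iD_i)\xi_i+K_iH_i\sum_{j\in\Pi^k(\mathcal{V}_i)}\big(e_j(t_{k-\nu_j+1})-e_i(t_{k-\nu_j+1})\big),\qquad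 e_i(t)=x_0\ \ \forall t\le 0.$$ Communication delays: $\tau_i=\max_k(t_{k+1}-t_{k-p_i+1})$, the maximum (assumed finite) over $k\ge 0$ with $k-p_i+1\ge0$. **Distributed estimation problem.** With $$J(\xi)=\frac1N\int_0^\infty\sum_{i=1}^N\sum_{j\in\mathcal{V}_i}\|\hat x_j(t)-\hat x_i(t)\|^2dt,$$ find gains $L_i,K_i$ such that: (i) with $\xi\equiv0$, the interconnection of error systems is exponentially stable: there are $M,\beta>0$ such that $\|e_i(t)\|\le Me^{-\beta t}\|x_0\|$ for all $t\ge0$, all $i$ and all $x_0\in\mathbf{R}^n$; (ii) $\displaystyle\sup_{x_0,\ \xi\ne0}\frac{J(\xi)}{x_0'Px_0+\frac1N\|\xi\|_2^2}\le\gamma^2$, for some matrix $P=P'>0$. **Matrices.** $\Psi_i$ is the $(p_i+1)\times(p_i+1)$ block matrix of $n\times n$ blocks with diagonal blocks $R_i$ and all off-diagonal blocks $\frac12(G_i+G_i')$. $T_i$ is the $(p_i+1)\times(p_i+2)$ block matrix of $n\times n$ blocks with $I$ in positions $(\mu,\mu)$, $-I$ in positions $(\mu,\mu+1)$, $\mu=1,\ldots,p_i+1$, and zeros elsewhere. Let $\bar\Psi_i=e^{-2\alpha_i\tau_i}T_i'\Psi_iT_i$, partitioned into $3\times3$ blocks $\bar\Psi_{i,\mu\nu}$ with row and column sizes $n$, $p_in$, $n$. $\tilde\Psi_i$ is partitioned in the same way, with $\tilde\Psi_{i,11}=\bar\Psi_{i,11}-2\alpha_iY_i^{-1}-S_i$,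 $\tilde\Psi_{i,33}=\bar\Psi_{i,33}+e^{-2\alpha_i\tau_i}S_i$, and $\tilde\Psi_{i,\mu\nu}=\bar\Psi_{i,\mu\nu}$ otherwise. Writing $\mathcal{V}_i=\{j_1,\ldots,j_{p_i}\}$, $\bar\Phi_{i,11}=\mathrm{diag}\big(\pi_{j_1}Y_{j_1}^{-1}+\tfrac{\pi^2}{4}W_{j_1},\ldots,\pi_{j_{p_i}}Y_{j_{p_i}}^{-1}+\tfrac{\pi^2}{4}W_{j_{p_i}}\big)$, $\bar\Phi_{i,22}=\mathrm{diag}\big(\tfrac{\pi^2}{4}W_{j_1},\ldots,\tfrac{\pi^2}{4}W_{j_{p_i}}\big)$, $\bar\Phi_{i,12}=\bar\Phi_{i,21}=-\bar\Phi_{i,22}$ (block diagonal; $\pi$ without subscript is the number $3.14\ldots$). *)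

theory Defs
  imports
    "HOL-Analysis.Analysis"
    "Jordan_Normal_Form.Determinant"
    "Jordan_Normal_Form.Gauss_Jordan_Elimination"
    "Graph_Theory.Digraph_Component"
begin

text \<open>
  All dimensions are natural numbers (the output dimensions and in-degrees vary from node to
  node), so vectors and matrices are those of \<^theory>\<open>Jordan_Normal_Form.Matrix\<close>; the
  competing type-indexed names and notations of HOL-Analysis are switched off.
\<close>

hide_const (open)
  Finite_Cartesian_Product.vec Finite_Cartesian_Product.mat Finite_Cartesian_Product.row
  Finite_Cartesian_Product.transpose Determinants.det

no_notation vec_nth (infixl \<open>$\<close> 90)
no_notation inner (infix \<open>\<bullet>\<close> 70)

definition vnorm :: "real vec \<Rightarrow> real" where
  "vnorm v = sqrt (v \<bullet> v)"

definition pos_semidef :: "real mat \<Rightarrow> bool" where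
  "pos_semidef M \<longleftrightarrow> M\<^sup>T = M \<and> (\<forall>v \<in> carrier_vec (dim_row M). 0 \<le> v \<bullet> (M *\<^sub>v v))"

definition pos_def :: "real mat \<Rightarrow> bool" where
  "pos_def M \<longleftrightarrow> M\<^sup>T = M \<and>
     (\<forall>v \<in> carrier_vec (dim_row M). v \<noteq> 0\<^sub>v (dim_row M) \<longrightarrow> 0 < v \<bullet> (M *\<^sub>v v))"

definition neg_def :: "real mat \<Rightarrow> bool" where
  "neg_def M \<longleftrightarrow> pos_def (- M)"

text \<open>Only meaningful for nonsingular square matrices.\<close>

definition minv :: "real mat \<Rightarrow> real mat" where
  "minv M = the (mat_inverse M)"

definition kron :: "real mat \<Rightarrow> real mat \<Rightarrow> real mat" where
  "kron M Q = mat (dim_row M * dim_row Q) (dim_col M * dim_col Q)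
     (\<lambda>(a, b). M $$ (a div dim_row Q, b div dim_col Q) * Q $$ (a mod dim_row Q, b mod dim_col Q))"

definition ones :: "nat \<Rightarrow> real mat" where
  "ones p = mat p 1 (\<lambda>_. 1)"

definition hcat :: "real mat \<Rightarrow> real mat \<Rightarrow> real mat" where
  "hcat M Q = four_block_mat M Q (0\<^sub>m 0 (dim_col M)) (0\<^sub>m 0 (dim_col Q))"

definition hcats :: "nat \<Rightarrow> real mat list \<Rightarrow> real mat" where
  "hcats r Ms = foldr hcat Ms (0\<^sub>m r 0)"

text \<open>
  The symmetric block matrix given by the rows of its upper block triangle, each row starting
  with its diagonal block; the blocks below the diagonal are the transposed ones.
\<close>

fun sym_block_mat :: "real mat list list \<Rightarrow> real mat" where
  "sym_block_mat ((M # Ms) # rs) =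
     (let Q = hcats (dim_row M) Ms in four_block_mat M Q Q\<^sup>T (sym_block_mat rs))"
| "sym_block_mat _ = 0\<^sub>m 0 0"

text \<open>The block matrix of \<open>k\<close> by \<open>l\<close> blocks \<open>f \<mu> \<nu>\<close> (\<open>\<mu> < k\<close>, \<open>\<nu> < l\<close>), each of size \<open>n\<close> by \<open>n\<close>.\<close>

definition blocks :: "nat \<Rightarrow> nat \<Rightarrow> nat \<Rightarrow> (nat \<Rightarrow> nat \<Rightarrow> real mat) \<Rightarrow> real mat" where
  "blocks n k l f = mat (k * n) (l * n) (\<lambda>(a, b). f (a div n) (b div n) $$ (a mod n, b mod n))"

text \<open>Block \<open>(\<mu>, \<nu>)\<close>, counted from 1, of \<open>M\<close> when rows and columns are split into groups of sizes \<open>ds\<close>.\<close>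

definition part_block :: "nat list \<Rightarrow> real mat \<Rightarrow> nat \<Rightarrow> nat \<Rightarrow> real mat" where
  "part_block ds M \<mu> \<nu> = mat (ds ! (\<mu> - 1)) (ds ! (\<nu> - 1))
     (\<lambda>(a, b). M $$ (sum_list (take (\<mu> - 1) ds) + a, sum_list (take (\<nu> - 1) ds) + b))"

definition L2_signal :: "nat \<Rightarrow> (real \<Rightarrow> real vec) \<Rightarrow> bool" where
  "L2_signal m z \<longleftrightarrow>
     (\<forall>t\<ge>0. z t \<in> carrier_vec m) \<and>
     (\<forall>a<m. set_borel_measurable lebesgue {0..} (\<lambda>t. z t $ a)) \<and>
     set_integrable lebesgue {0..} (\<lambda>t. (vnorm (z t))\<^sup>2)"

definition signal_norm :: "(real \<Rightarrow> real vec) \<Rightarrow> real" where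
  "signal_norm z = sqrt (LINT t:{0..}|lebesgue. (vnorm (z t))\<^sup>2)"

text \<open>
  Disturbances are merely square integrable, so the differential equations are read in
  Caratheodory's sense, \<open>z t = z a + integral of f over [a, t]\<close>, componentwise.
\<close>

definition ode_on :: "nat \<Rightarrow> (real \<Rightarrow> real vec) \<Rightarrow> (real \<Rightarrow> real vec) \<Rightarrow> real \<Rightarrow> real \<Rightarrow> bool" where
  "ode_on n f z a t \<longleftrightarrow> (\<forall>c<n. ((\<lambda>s. f s $ c) has_integral (z t $ c - z a $ c)) {a..t})"

record rr_network =
  graph :: "nat pair_pre_digraph"
  dim_x :: nat
  dim_w :: nat
  dim_v :: nat
  dim_y :: "nat \<Rightarrow> nat"
  dim_h :: "nat \<Rightarrow> nat"
  plantA :: "real mat"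
  plantB2 :: "real mat"
  outC :: "nat \<Rightarrow> real mat"
  outD2 :: "nat \<Rightarrow> real mat"
  outDbar :: "nat \<Rightarrow> real mat"
  obsH :: "nat \<Rightarrow> real mat"
  samp :: "nat \<Rightarrow> real"

definition num_nodes :: "rr_network \<Rightarrow> nat" where
  "num_nodes net = card (pverts (graph net))"

definition nbrs :: "rr_network \<Rightarrow> nat \<Rightarrow> nat set" where
  "nbrs net i = {j. (j, i) \<in> parcs (graph net)}"

definition in_deg :: "rr_network \<Rightarrow> nat \<Rightarrow> nat" where
  "in_deg net i = card (nbrs net i)"

definition out_deg :: "rr_network \<Rightarrow> nat \<Rightarrow> nat" where
  "out_deg net i = out_degree (with_proj (graph net)) i"

definition nbr_list :: "rr_network \<Rightarrow> nat \<Rightarrow> nat list" where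
  "nbr_list net i = sorted_list_of_set (nbrs net i)"

definition shift_perm :: "nat list \<Rightarrow> nat list" where
  "shift_perm js = (if js = [] then [] else last js # butlast js)"

definition rr_order :: "rr_network \<Rightarrow> nat \<Rightarrow> nat \<Rightarrow> nat list" where
  "rr_order net k i = (shift_perm ^^ k) (nbr_list net i)"

text \<open>The position, counted from 1, of \<open>j\<close> in the list \<open>rr_order net k i\<close>.\<close>

definition rr_pos :: "rr_network \<Rightarrow> nat \<Rightarrow> nat \<Rightarrow> nat \<Rightarrow> nat" where
  "rr_pos net k i j = Suc (length (takeWhile (\<lambda>j'. j' \<noteq> j) (rr_order net k i)))"

text \<open>
  The lags \<open>samp (k + 1) - samp (k - p + 1)\<close> over the \<open>k\<close> for which \<open>k - p + 1\<close> is nonnegative;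
  for \<open>p = 0\<close> they all vanish.
\<close>

definition delay_set :: "rr_network \<Rightarrow> nat \<Rightarrow> real set" where
  "delay_set net i =
     {samp net (k + 1) - samp net (k + 1 - in_deg net i) | k. in_deg net i \<le> k + 1}"

definition delay :: "rr_network \<Rightarrow> nat \<Rightarrow> real" where
  "delay net i = Sup (delay_set net i)"

definition rr_network_wf :: "rr_network \<Rightarrow> bool" where
  "rr_network_wf net \<longleftrightarrow>
     pair_loopfree_digraph (graph net) \<and>
     Digraph_Component.connected (with_proj (graph net)) \<and>
     pverts (graph net) = {1..num_nodes net} \<and>
     0 < dim_x net \<and>
     plantA net \<in> carrier_mat (dim_x net) (dim_x net) \<and>
     plantB2 net \<in> carrier_mat (dim_x net) (dim_w net) \<and>
     (\<forall>i \<in> {1..num_nodes net}.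
        outC net i \<in> carrier_mat (dim_y net i) (dim_x net) \<and>
        outD2 net i \<in> carrier_mat (dim_y net i) (dim_w net) \<and>
        outDbar net i \<in> carrier_mat (dim_y net i) (dim_v net) \<and>
        obsH net i \<in> carrier_mat (dim_h net i) (dim_x net)) \<and>
     samp net 0 = 0 \<and> strict_mono (samp net) \<and> filterlim (samp net) at_top sequentially \<and>
     (\<forall>i \<in> {1..num_nodes net}. bdd_above (delay_set net i))"

definition distB :: "rr_network \<Rightarrow> real mat" where
  "distB net = hcat (plantB2 net) (0\<^sub>m (dim_x net) (dim_v net))"

definition distD :: "rr_network \<Rightarrow> nat \<Rightarrow> real mat" where
  "distD net i = hcat (outD2 net i) (outDbar net i)"

definition node_dist :: "(real \<Rightarrow> real vec) \<Rightarrow> (nat \<Rightarrow> real \<Rightarrow> real vec) \<Rightarrow> nat \<Rightarrow> real \<Rightarrow> real vec" where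
  "node_dist w v i t = w t @\<^sub>v v i t"

definition stacked_dist ::
  "rr_network \<Rightarrow> (real \<Rightarrow> real vec) \<Rightarrow> (nat \<Rightarrow> real \<Rightarrow> real vec) \<Rightarrow> real \<Rightarrow> real vec" where
  "stacked_dist net w v t =
     foldr (\<lambda>i u. node_dist w v i t @\<^sub>v u) [1..<Suc (num_nodes net)] vNil"

text \<open>
  The difference \<open>z j - z i\<close> at the sampling time with index \<open>k - \<nu> + 1\<close>, where \<open>\<nu>\<close> is the
  position of \<open>j\<close> at step \<open>k\<close>. It is zero when this index is negative, since all \<open>z i\<close>
  coincide at nonpositive times.
\<close>

definition sampled_diff ::
  "rr_network \<Rightarrow> nat \<Rightarrow> nat \<Rightarrow> (nat \<Rightarrow> real \<Rightarrow> real vec) \<Rightarrow> nat \<Rightarrow> real vec" where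
  "sampled_diff net k i z j =
     (let \<nu> = rr_pos net k i j in
      if \<nu> \<le> k + 1 then z j (samp net (k + 1 - \<nu>)) - z i (samp net (k + 1 - \<nu>))
      else 0\<^sub>v (dim_x net))"

definition plant_solution ::
  "rr_network \<Rightarrow> real vec \<Rightarrow> (real \<Rightarrow> real vec) \<Rightarrow> (real \<Rightarrow> real vec) \<Rightarrow> bool" where
  "plant_solution net x0 w x \<longleftrightarrow>
     (\<forall>t. x t \<in> carrier_vec (dim_x net)) \<and> (\<forall>t\<le>0. x t = x0) \<and>
     (\<forall>t\<ge>0. ode_on (dim_x net) (\<lambda>s. plantA net *\<^sub>v x s + plantB2 net *\<^sub>v w s) x 0 t)"

definition measurement ::
  "rr_network \<Rightarrow> (real \<Rightarrow> real vec) \<Rightarrow> (nat \<Rightarrow> real \<Rightarrow> real vec) \<Rightarrow> (real \<Rightarrow> real vec) \<Rightarrow>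
   nat \<Rightarrow> real \<Rightarrow> real vec" where
  "measurement net w v x i t =
     outC net i *\<^sub>v x t + outD2 net i *\<^sub>v w t + outDbar net i *\<^sub>v v i t"

text \<open>
  On each closed interval between consecutive sampling times the right-hand side is the one with
  index \<open>k\<close>; closing the interval on the right expresses continuity of the observer states.
\<close>

definition observer_solution ::
  "rr_network \<Rightarrow> (nat \<Rightarrow> real mat) \<Rightarrow> (nat \<Rightarrow> real mat) \<Rightarrow> (nat \<Rightarrow> real \<Rightarrow> real vec) \<Rightarrow>
   (nat \<Rightarrow> real \<Rightarrow> real vec) \<Rightarrow> bool" where
  "observer_solution net L K y xh \<longleftrightarrow>
     (\<forall>i \<in> {1..num_nodes net}.
        (\<forall>t. xh i t \<in> carrier_vec (dim_x net)) \<and> (\<forall>t\<le>0. xh i t = 0\<^sub>v (dim_x net)) \<and>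
        (\<forall>k. \<forall>t \<in> {samp net k..samp net (k + 1)}.
           ode_on (dim_x net)
             (\<lambda>s. plantA net *\<^sub>v xh i s + L i *\<^sub>v (y i s - outC net i *\<^sub>v xh i s)
                + K i *\<^sub>v finsum_vec TYPE(real) (dim_h net i)
                    (\<lambda>j. obsH net i *\<^sub>v sampled_diff net k i xh j) (set (rr_order net k i)))
             (xh i) (samp net k) t))"

definition error_solution ::
  "rr_network \<Rightarrow> (nat \<Rightarrow> real mat) \<Rightarrow> (nat \<Rightarrow> real mat) \<Rightarrow> real vec \<Rightarrow> (nat \<Rightarrow> real \<Rightarrow> real vec) \<Rightarrow>
   (nat \<Rightarrow> real \<Rightarrow> real vec) \<Rightarrow> bool" where
  "error_solution net L K x0 \<xi> e \<longleftrightarrow>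
     (\<forall>i \<in> {1..num_nodes net}.
        (\<forall>t. e i t \<in> carrier_vec (dim_x net)) \<and> (\<forall>t\<le>0. e i t = x0) \<and>
        (\<forall>k. \<forall>t \<in> {samp net k..samp net (k + 1)}.
           ode_on (dim_x net)
             (\<lambda>s. (plantA net - L i * outC net i) *\<^sub>v e i s
                + (distB net - L i * distD net i) *\<^sub>v \<xi> i s
                + (K i * obsH net i) *\<^sub>v finsum_vec TYPE(real) (dim_x net)
                    (sampled_diff net k i e) (set (rr_order net k i)))
             (e i) (samp net k) t))"

definition errors_exp_stable :: "rr_network \<Rightarrow> (nat \<Rightarrow> real mat) \<Rightarrow> (nat \<Rightarrow> real mat) \<Rightarrow> bool" where
  "errors_exp_stable net L K \<longleftrightarrow>
     (\<exists>M>0. \<exists>\<beta>>0. \<forall>x0 \<in> carrier_vec (dim_x net). \<forall>e.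
        error_solution net L K x0 (\<lambda>i t. 0\<^sub>v (dim_w net + dim_v net)) e \<longrightarrow>
        (\<forall>i \<in> {1..num_nodes net}. \<forall>t\<ge>0. vnorm (e i t) \<le> M * exp (- \<beta> * t) * vnorm x0))"

text \<open>The cost is extended-valued: its finiteness is part of the performance bound.\<close>

definition cost :: "rr_network \<Rightarrow> (nat \<Rightarrow> real \<Rightarrow> real vec) \<Rightarrow> ennreal" where
  "cost net xh = ennreal (1 / real (num_nodes net)) *
     (\<integral>\<^sup>+t\<in>{0..}. ennreal (\<Sum>i\<in>{1..num_nodes net}. \<Sum>j\<in>nbrs net i. (vnorm (xh j t - xh i t))\<^sup>2) \<partial>lebesgue)"

definition performance_bound ::
  "rr_network \<Rightarrow> (nat \<Rightarrow> real mat) \<Rightarrow> (nat \<Rightarrow> real mat) \<Rightarrow> real \<Rightarrow> real mat \<Rightarrow> bool" where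
  "performance_bound net L K \<gamma> P \<longleftrightarrow>
     Sup {cost net xh / ennreal (x0 \<bullet> (P *\<^sub>v x0)
            + 1 / real (num_nodes net) * (signal_norm (stacked_dist net w v))\<^sup>2) | x0 w v x xh.
          x0 \<in> carrier_vec (dim_x net) \<and> L2_signal (dim_w net) w \<and>
          (\<forall>i \<in> {1..num_nodes net}. L2_signal (dim_v net) (v i)) \<and>
          (x0 \<noteq> 0\<^sub>v (dim_x net) \<or> signal_norm (stacked_dist net w v) \<noteq> 0) \<and>
          plant_solution net x0 w x \<and>
          observer_solution net L K (measurement net w v x) xh}
     \<le> ennreal (\<gamma>\<^sup>2)"

definition solves_estimation_problem ::
  "rr_network \<Rightarrow> (nat \<Rightarrow> real mat) \<Rightarrow> (nat \<Rightarrow> real mat) \<Rightarrow> real \<Rightarrow> bool" where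
  "solves_estimation_problem net L K \<gamma> \<longleftrightarrow>
     errors_exp_stable net L K \<and>
     (\<exists>P \<in> carrier_mat (dim_x net) (dim_x net). pos_def P \<and> performance_bound net L K \<gamma> P)"

definition Psi_mat :: "nat \<Rightarrow> nat \<Rightarrow> real mat \<Rightarrow> real mat \<Rightarrow> real mat" where
  "Psi_mat n p R G = blocks n (p + 1) (p + 1) (\<lambda>\<mu> \<nu>. if \<mu> = \<nu> then R else (1 / 2) \<cdot>\<^sub>m (G + G\<^sup>T))"

definition T_mat :: "nat \<Rightarrow> nat \<Rightarrow> real mat" where
  "T_mat n p = blocks n (p + 1) (p + 2)
     (\<lambda>\<mu> \<nu>. if \<nu> = \<mu> then 1\<^sub>m n else if \<nu> = \<mu> + 1 then - 1\<^sub>m n else 0\<^sub>m n n)"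

definition Psi_bar :: "nat \<Rightarrow> nat \<Rightarrow> real \<Rightarrow> real \<Rightarrow> real mat \<Rightarrow> real mat \<Rightarrow> nat \<Rightarrow> nat \<Rightarrow> real mat" where
  "Psi_bar n p \<tau> \<alpha> R G =
     part_block [n, p * n, n]
       (exp (- 2 * \<alpha> * \<tau>) \<cdot>\<^sub>m ((T_mat n p)\<^sup>T * Psi_mat n p R G * T_mat n p))"

definition Psi_tilde ::
  "nat \<Rightarrow> nat \<Rightarrow> real \<Rightarrow> real \<Rightarrow> real mat \<Rightarrow> real mat \<Rightarrow> real mat \<Rightarrow> real mat \<Rightarrow> nat \<Rightarrow> nat \<Rightarrow> real mat" where
  "Psi_tilde n p \<tau> \<alpha> Y S R G \<mu> \<nu> =
     (if \<mu> = 1 \<and> \<nu> = 1 then Psi_bar n p \<tau> \<alpha> R G 1 1 - (2 * \<alpha>) \<cdot>\<^sub>m minv Y - S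
      else if \<mu> = 3 \<and> \<nu> = 3 then Psi_bar n p \<tau> \<alpha> R G 3 3 + exp (- 2 * \<alpha> * \<tau>) \<cdot>\<^sub>m S
      else Psi_bar n p \<tau> \<alpha> R G \<mu> \<nu>)"

definition block_diag :: "nat \<Rightarrow> nat list \<Rightarrow> (nat \<Rightarrow> real mat) \<Rightarrow> real mat" where
  "block_diag n js f =
     blocks n (length js) (length js) (\<lambda>\<mu> \<nu>. if \<mu> = \<nu> then f (js ! \<mu>) else 0\<^sub>m n n)"

text \<open>Here \<open>\<pi> j\<close> is a design constant, while \<open>pi\<close> is the number.\<close>

definition Phi_11 :: "nat \<Rightarrow> nat list \<Rightarrow> (nat \<Rightarrow> real) \<Rightarrow> (nat \<Rightarrow> real mat) \<Rightarrow> (nat \<Rightarrow> real mat) \<Rightarrow> real mat" where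
  "Phi_11 n js \<pi> Y W = block_diag n js (\<lambda>j. \<pi> j \<cdot>\<^sub>m minv (Y j) + (pi\<^sup>2 / 4) \<cdot>\<^sub>m W j)"

definition Phi_22 :: "nat \<Rightarrow> nat list \<Rightarrow> (nat \<Rightarrow> real mat) \<Rightarrow> real mat" where
  "Phi_22 n js W = block_diag n js (\<lambda>j. (pi\<^sup>2 / 4) \<cdot>\<^sub>m W j)"

definition Phi_12 :: "nat \<Rightarrow> nat list \<Rightarrow> (nat \<Rightarrow> real mat) \<Rightarrow> real mat" where
  "Phi_12 n js W = - Phi_22 n js W"

definition Xi_bar ::
  "rr_network \<Rightarrow> real \<Rightarrow> (nat \<Rightarrow> real) \<Rightarrow> (nat \<Rightarrow> real) \<Rightarrow> (nat \<Rightarrow> real) \<Rightarrow> (nat \<Rightarrow> real) \<Rightarrow>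
   (nat \<Rightarrow> real mat) \<Rightarrow> (nat \<Rightarrow> real mat) \<Rightarrow> (nat \<Rightarrow> real mat) \<Rightarrow> (nat \<Rightarrow> real mat) \<Rightarrow>
   (nat \<Rightarrow> real mat) \<Rightarrow> (nat \<Rightarrow> real mat) \<Rightarrow> (nat \<Rightarrow> real mat) \<Rightarrow> (nat \<Rightarrow> real mat) \<Rightarrow> nat \<Rightarrow> real mat" where
  "Xi_bar net \<gamma> \<alpha> \<pi> \<epsilon> \<epsilon>' Y X F U S R W G i =
    (let n = dim_x net; m = dim_w net + dim_v net; p = in_deg net i; q = out_deg net i;
         js = nbr_list net i; \<tau> = delay net i;
         A = plantA net; C = outC net i; B = distB net; D = distD net i; H = obsH net i;
         Xi = X i; Yinv = minv (Y i); FH = F i * H; UC = U i * C; XBUD = Xi\<^sup>T * B - U i * D;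
         row1 = (ones p)\<^sup>T; J = ones p * (ones p)\<^sup>T;
         \<Psi> = Psi_tilde n p \<tau> (\<alpha> i) (Y i) (S i) (R i) (G i);
         \<Phi>11 = Phi_11 n js \<pi> Y W; \<Phi>12 = Phi_12 n js W; \<Phi>22 = Phi_22 n js W;
         aa = \<tau>\<^sup>2 \<cdot>\<^sub>m R i + (\<Sum>j | j \<in> {1..num_nodes net} \<and> i \<in> nbrs net j. (delay net j)\<^sup>2) \<cdot>\<^sub>m W i
                - \<epsilon> i \<cdot>\<^sub>m Xi - \<epsilon> i \<cdot>\<^sub>m Xi\<^sup>T;
         ab = Yinv - Xi + \<epsilon> i \<cdot>\<^sub>m (Xi\<^sup>T * A - UC);
         ac = - (\<epsilon> i \<cdot>\<^sub>m kron row1 FH);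
         af = kron row1 (- (\<epsilon>' i \<cdot>\<^sub>m Xi) + \<epsilon> i \<cdot>\<^sub>m FH);
         ag = \<epsilon> i \<cdot>\<^sub>m XBUD;
         bb = (real (p + q) / \<gamma>\<^sup>2) \<cdot>\<^sub>m 1\<^sub>m n - \<Psi> 1 1 + Xi\<^sup>T * A - UC + A\<^sup>T * Xi - C\<^sup>T * (U i)\<^sup>T;
         bc = - \<Psi> 1 2 - kron row1 FH;
         be = - ((1 / \<gamma>\<^sup>2) \<cdot>\<^sub>m kron row1 (1\<^sub>m n));
         bf = kron row1 (FH + \<epsilon>' i \<cdot>\<^sub>m (A\<^sup>T * Xi) - \<epsilon>' i \<cdot>\<^sub>m (C\<^sup>T * (U i)\<^sup>T));
         bg = XBUD;
         cf = - kron J (\<epsilon>' i \<cdot>\<^sub>m (H\<^sup>T * (F i)\<^sup>T));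
         ff = \<epsilon>' i \<cdot>\<^sub>m kron J (FH + H\<^sup>T * (F i)\<^sup>T) - \<Phi>22;
         fg = \<epsilon>' i \<cdot>\<^sub>m kron (ones p) XBUD
     in sym_block_mat
       [[aa, ab,  ac,          0\<^sub>m n n,        0\<^sub>m n (p * n),       af,                 ag],
        [bb, bc,  - \<Psi> 1 3,    be,             bf,                 bg],
        [- \<Psi> 2 2, - \<Psi> 2 3,    0\<^sub>m (p * n) (p * n), cf,            0\<^sub>m (p * n) m],
        [- \<Psi> 3 3, 0\<^sub>m n (p * n), 0\<^sub>m n (p * n), 0\<^sub>m n m],
        [- \<Phi>11, - \<Phi>12, 0\<^sub>m (p * n) m],
        [ff, fg],
        [- 1\<^sub>m m]])"

text \<open>The average over the nodes, written entrywise.\<close>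

definition initial_weight ::
  "rr_network \<Rightarrow> (nat \<Rightarrow> real) \<Rightarrow> (nat \<Rightarrow> real mat) \<Rightarrow> (nat \<Rightarrow> real mat) \<Rightarrow> real mat" where
  "initial_weight net \<alpha> Y S = mat (dim_x net) (dim_x net) (\<lambda>ab.
     1 / real (num_nodes net) * (\<Sum>i\<in>{1..num_nodes net}.
       (minv (Y i) + ((1 - exp (- 2 * \<alpha> i * delay net i)) / (2 * \<alpha> i)) \<cdot>\<^sub>m S i) $$ ab))"

end

(*
  Evaluate the matrix inequality of node i at the vector of the derivative of the error e_i, its
  current, sampled and delayed values, the current and the held values of the neighbours' errors and
  the disturbance. Since the error satisfies the observer equation, the descriptor terms vanish.
  Summing over the nodes, multiplying by exp (2 beta t) and integrating over [0, T], each remaining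
  group of terms has a sign: the Y terms are an exact derivative; the S terms telescope up to the
  contribution of the initial state; the R terms are controlled by Jensen's inequality and the
  reciprocally convex combination bound; the W terms by Wirtinger's inequality on the holding
  intervals of the Round-Robin schedule; the coupling terms pi_j count each out-going edge once and are
  dominated by 2 alpha_j. With beta = 0 this is the performance bound. As the inequality is strict,
  it also leaves room for some beta > 0, and then it gives exponential stability.

  The differential equations hold in Caratheodory's sense with merely square integrable right-hand
  sides, so energies are differentiated by a product rule for indefinite Henstock-Kurzweil integrals.
*)

theory Submission
  imports Defs
begin

section \<open>The product rule for indefinite integrals\<close>

text \<open>No Lyapunov functional is formed: each group of terms is integrated on its own, so
  nothing has to be tracked across the jumps at the sampling times. The history before time 0 enters
  only through its constancy: the derivative is zero there, and a sample with a negative index has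
  the same value as the one with index 0, so natural subtraction may truncate at 0. The matrix
  inequality is used pointwise; therefore the derivative is the right-hand side itself, at every
  time and not just almost everywhere. A positive rate \<beta> costs differently in each group. The
  Y terms use the slack between \<open>q * \<pi>\<close> and \<open>2 * \<alpha>\<close>. The S and
  R terms carry the factor \<open>exp (- 2 * \<alpha> * \<tau>)\<close>, which absorbs a weight
  growing at a rate \<beta> \<le> \<alpha>. Only Wirtinger's inequality loses a factor
  \<open>exp (2 * \<beta> * \<tau>)\<close>, because the weight varies over a holding interval. That
  excess multiplies a form in the derivative, so all that is kept of the strictness of the matrix
  inequality is a margin \<kappa> times the squared norm of the derivative.\<close>

text \<open>The intermediate value theorem cuts the interval into N pieces on which \<mu> grows by
  the same amount m / N. The increments of \<Phi> then add up to at most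
  \<open>N * C * (m / N)\<^sup>2\<close>, which tends to 0.\<close>

lemma const_if_quadratic_increments:
  fixes \<Phi> \<mu> :: "real \<Rightarrow> real"
  assumes "a \<le> b" and cont: "continuous_on {a..b} \<mu>"
    and incr: "\<And>s t. a \<le> s \<Longrightarrow> s \<le> t \<Longrightarrow> t \<le> b \<Longrightarrow> \<mu> s \<le> \<mu> t"
    and quad: "\<And>s t. a \<le> s \<Longrightarrow> s \<le> t \<Longrightarrow> t \<le> b \<Longrightarrow> \<bar>\<Phi> t - \<Phi> s\<bar> \<le> C * (\<mu> t - \<mu> s)\<^sup>2"
  shows "\<Phi> b = \<Phi> a"
proof -
  define m where "m = \<mu> b - \<mu> a"
  have m0: "0 \<le> m" using incr[of a b] assms(1) by (simp add: m_def)
  have bound: "\<bar>\<Phi> b - \<Phi> a\<bar> * real N \<le> C * m\<^sup>2" if N: "0 < N" for N :: nat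
  proof -
    have chain: "\<exists>t. s \<le> t \<and> t \<le> b \<and> \<mu> t = \<mu> a + real k / real N * m \<and> \<bar>\<Phi> t - \<Phi> a\<bar> \<le> real k * (C * (m / N)\<^sup>2)"
      if "s = a" "k \<le> N" for s k
      using that
    proof (induction k)
      case 0
      then show ?case using assms(1) by (intro exI[of _ a]) auto
    next
      case (Suc k)
      then obtain s' where s': "a \<le> s'" "s' \<le> b" "\<mu> s' = \<mu> a + real k / real N * m"
        "\<bar>\<Phi> s' - \<Phi> a\<bar> \<le> real k * (C * (m / N)\<^sup>2)" by auto
      have le1: "\<mu> s' \<le> \<mu> a + real (Suc k) / real N * m"
        using m0 N by (simp add: s'(3) divide_right_mono mult_right_mono)
      have "real (Suc k) / real N * m \<le> 1 * m"
        using m0 N Suc.prems by (intro mult_right_mono) auto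
      then have le2: "\<mu> a + real (Suc k) / real N * m \<le> \<mu> b" by (simp add: m_def)
      have "continuous_on {s'..b} \<mu>" using cont by (rule continuous_on_subset) (use s' in auto)
      then obtain t where t: "s' \<le> t" "t \<le> b" "\<mu> t = \<mu> a + real (Suc k) / real N * m"
        using IVT'[OF le1 le2 s'(2)] by auto
      have "\<mu> t - \<mu> s' = m / N" using N by (simp add: t s' field_simps)
      then have "\<bar>\<Phi> t - \<Phi> s'\<bar> \<le> C * (m / N)\<^sup>2" using quad[of s' t] s' t by auto
      then have "\<bar>\<Phi> t - \<Phi> a\<bar> \<le> real (Suc k) * (C * (m / N)\<^sup>2)"
        using s'(4) by (simp add: algebra_simps)
      then show ?case using t s' Suc.prems by (intro exI[of _ t]) auto
    qed
    from chain[of a N] obtain t where t: "a \<le> t" "t \<le> b" "\<mu> t = \<mu> b"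
      "\<bar>\<Phi> t - \<Phi> a\<bar> \<le> real N * (C * (m / N)\<^sup>2)" using N by (auto simp: m_def)
    \<comment> \<open>The chain may stop before b, at a point where \<mu> already has its final
      value; there the quadratic bound is 0.\<close>
    have "\<Phi> b = \<Phi> t" using quad[of t b] t by auto
    then have "\<bar>\<Phi> b - \<Phi> a\<bar> \<le> real N * (C * (m / N)\<^sup>2)" using t by simp
    also have "\<dots> = C * m\<^sup>2 / N" using N by (simp add: power2_eq_square field_simps)
    finally show ?thesis using N by (simp add: field_simps)
  qed
  show ?thesis
  proof (rule ccontr)
    assume "\<Phi> b \<noteq> \<Phi> a"
    then have "0 < \<bar>\<Phi> b - \<Phi> a\<bar>" by simp
    then obtain N :: nat where N: "C * m\<^sup>2 < real N * \<bar>\<Phi> b - \<Phi> a\<bar>"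
      using reals_Archimedean3 by blast
    have "C * m\<^sup>2 < real (Suc N) * \<bar>\<Phi> b - \<Phi> a\<bar>"
      using N by (simp add: algebra_simps)
    with bound[of "Suc N"] show False by (simp add: mult.commute)
  qed
qed

lemma has_integral_diff_interval:
  fixes f F :: "real \<Rightarrow> real"
  assumes "(f has_integral F s - F a) {a..s}" "(f has_integral F t - F a) {a..t}" "a \<le> s" "s \<le> t"
  shows "(f has_integral F t - F s) {s..t}"
proof -
  have "f integrable_on {s..t}"
    using has_integral_integrable[OF assms(2)] by (rule integrable_on_subinterval) (use assms in auto)
  then obtain I where I: "(f has_integral I) {s..t}" by blast
  have "(f has_integral (F s - F a) + I) {a..t}" using has_integral_combine[OF assms(3,4,1) I] .
  with assms(2) have "F t - F a = (F s - F a) + I" by (rule has_integral_unique)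
  with I show ?thesis by simp
qed

lemma has_integral_continuous:
  fixes f F :: "real \<Rightarrow> real"
  assumes "\<And>t. t \<in> {a..b} \<Longrightarrow> (f has_integral F t - F a) {a..t}"
  shows "continuous_on {a..b} F"
proof (cases "a \<le> b")
  case True
  then have "f integrable_on {a..b}" using assms[of b] by auto
  then have "continuous_on {a..b} (\<lambda>t. F a + integral {a..t} f)"
    by (intro continuous_intros indefinite_integral_continuous_1)
  then show ?thesis by (rule continuous_on_eq) (use integral_unique[OF assms] in auto)
qed simp

text \<open>Absolute continuity with a chosen derivative, expressed by the indefinite integral, so
  that pointwise differentiability never enters. The absolute integrability makes the integral of
  the modulus of \<open>f'\<close> available as a gauge for the increments of
  \<open>f\<close>.\<close>

definition ac_on :: "real \<Rightarrow> real \<Rightarrow> (real \<Rightarrow> real) \<Rightarrow> (real \<Rightarrow> real) \<Rightarrow> bool" where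
  "ac_on a b f f' \<longleftrightarrow> f' absolutely_integrable_on {a..b} \<and>
     (\<forall>t\<in>{a..b}. (f' has_integral f t - f a) {a..t})"

lemma ac_on_has_integral:
  assumes "ac_on a b f f'" "a \<le> s" "s \<le> t" "t \<le> b"
  shows "(f' has_integral f t - f s) {s..t}"
  using assms by (intro has_integral_diff_interval[of f' f s a t]) (auto simp: ac_on_def)

lemma ac_on_continuous: "ac_on a b f f' \<Longrightarrow> continuous_on {a..b} f"
  by (rule has_integral_continuous) (auto simp: ac_on_def)

lemma absolutely_integrable_mult_continuous:
  fixes f g :: "real \<Rightarrow> real"
  assumes "f absolutely_integrable_on {a..b}" "continuous_on {a..b} g"
  shows "(\<lambda>t. f t * g t) absolutely_integrable_on {a..b}"
proof -
  have "(\<lambda>t. g t * f t) absolutely_integrable_on {a..b}"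
    using assms
    by (intro absolutely_integrable_bounded_measurable_product_real)
       (auto intro: continuous_imp_measurable_on_sets_lebesgue compact_imp_bounded compact_continuous_image)
  then show ?thesis by (simp add: mult.commute)
qed

text \<open>
  On an interval the defect of the product rule is of second order in the integral of
  \<open>\<bar>f'\<bar> + \<bar>g'\<bar>\<close>, an additive continuous function of the interval; hence it vanishes.
\<close>

lemma ac_on_mult:
  assumes f: "ac_on a b f f'" and g: "ac_on a b g g'"
  shows "ac_on a b (\<lambda>t. f t * g t) (\<lambda>t. f' t * g t + f t * g' t)"
proof -
  let ?p = "\<lambda>t. f' t * g t + f t * g' t" and ?m = "\<lambda>t. \<bar>f' t\<bar> + \<bar>g' t\<bar>"
  have f': "f' absolutely_integrable_on {a..b}" and g': "g' absolutely_integrable_on {a..b}"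
    using f g by (auto simp: ac_on_def)
  note cont = ac_on_continuous[OF f] ac_on_continuous[OF g]
  have p: "?p absolutely_integrable_on {a..b}"
    using set_integral_add(1)[OF absolutely_integrable_mult_continuous[OF f' cont(2)]
      absolutely_integrable_mult_continuous[OF g' cont(1)]]
    by (simp add: mult.commute)
  have m: "?m integrable_on {a..b}"
    using f' g' by (auto simp: absolutely_integrable_on_def intro!: integrable_add)
  have sub: "h integrable_on {s..t}" if "h integrable_on {a..b}" "a \<le> s" "t \<le> b"
    for h :: "real \<Rightarrow> real" and s t
    using that by (auto intro: integrable_on_subinterval)
  have p': "?p integrable_on {a..b}" using p by (auto simp: absolutely_integrable_on_def)
  show ?thesis
    unfolding ac_on_def
  proof (intro conjI ballI p)
    fix T assume T: "T \<in> {a..b}"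
    define \<mu> where "\<mu> = (\<lambda>t. integral {a..t} ?m)"
    define \<Phi> where "\<Phi> = (\<lambda>t. f t * g t - integral {a..t} ?p)"
    have add: "integral {a..t} h - integral {a..s} h = integral {s..t} h"
      if "h integrable_on {a..b}" "a \<le> s" "s \<le> t" "t \<le> T" for h :: "real \<Rightarrow> real" and s t
      using Henstock_Kurzweil_Integration.integral_combine[of a s t h] sub[of h a t] that T by auto
    have "\<Phi> T = \<Phi> a"
    proof (rule const_if_quadratic_increments[where \<Phi> = \<Phi> and \<mu> = \<mu> and C = 2])
      show "a \<le> T" using T by simp
      show "continuous_on {a..T} \<mu>"
        unfolding \<mu>_def using sub[OF m, of a T] T by (intro indefinite_integral_continuous_1) auto
      show "\<mu> s \<le> \<mu> t" if "a \<le> s" "s \<le> t" "t \<le> T" for s t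
        using add[OF m that] integral_nonneg[of ?m "{s..t}"] sub[OF m] that T
        by (auto simp: \<mu>_def)
      fix s t assume st: "a \<le> s" "s \<le> t" "t \<le> T"
      then have tb: "t \<le> b" using T by auto
      define I where "I = \<mu> t - \<mu> s"
      have I: "I = integral {s..t} ?m" using add[OF m st] by (simp add: I_def \<mu>_def)
      have mst: "?m integrable_on {s..t}" using sub[OF m] st tb by auto
      have I0: "0 \<le> I" unfolding I using mst by (intro integral_nonneg) auto
      have incr: "\<bar>h u - h s\<bar> \<le> I" if h: "ac_on a b h h'" "\<And>t. \<bar>h' t\<bar> \<le> ?m t" and u: "u \<in> {s..t}" for h h' u
      proof -
        have hu: "(h' has_integral h u - h s) {s..u}"
          using ac_on_has_integral[OF h(1)] st tb u by auto
        have msu: "?m integrable_on {s..u}" using sub[OF m] st tb u by auto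
        have "\<bar>h u - h s\<bar> \<le> integral {s..u} ?m"
          using integral_norm_bound_integral[of h' "{s..u}" ?m] hu msu h(2)
          by (auto simp: integral_unique has_integral_integrable)
        also have "\<dots> \<le> I" unfolding I
          using msu mst u by (intro integral_subset_le) auto
        finally show ?thesis .
      qed
      \<comment> \<open>With the undifferentiated factors frozen at s, the product rule can be
        integrated exactly (fact \<open>c\<close> below). The remainder \<open>?q\<close> contains
        only increments from s, each bounded by \<open>I\<close>, times a derivative.\<close>
      let ?q = "\<lambda>u. f' u * (g u - g s) + (f u - f s) * g' u"
      have "(f' has_integral f t - f s) {s..t}" "(g' has_integral g t - g s) {s..t}"
        using ac_on_has_integral[OF f] ac_on_has_integral[OF g] st tb by auto
      then have c: "((\<lambda>u. f' u * g s + f s * g' u) has_integral (f t - f s) * g s + f s * (g t - g s)) {s..t}"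
        by (intro has_integral_add has_integral_mult_left has_integral_mult_right)
      have "(?p has_integral integral {s..t} ?p) {s..t}"
        using sub[OF p'] st tb by (auto simp: has_integral_integral)
      from has_integral_diff[OF this c]
      have q: "(?q has_integral integral {s..t} ?p - ((f t - f s) * g s + f s * (g t - g s))) {s..t}"
        by (rule has_integral_eq[rotated]) (simp add: algebra_simps)
      have qb: "\<bar>?q u\<bar> \<le> I * ?m u" if u: "u \<in> {s..t}" for u
      proof -
        have "\<bar>f' u * (g u - g s)\<bar> \<le> \<bar>f' u\<bar> * I"
          unfolding abs_mult by (intro mult_left_mono incr[OF g _ u]) auto
        moreover have "\<bar>(f u - f s) * g' u\<bar> \<le> I * \<bar>g' u\<bar>"
          unfolding abs_mult by (intro mult_right_mono incr[OF f _ u]) auto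
        ultimately show ?thesis by (auto simp: algebra_simps)
      qed
      have "\<bar>integral {s..t} ?q\<bar> \<le> integral {s..t} (\<lambda>u. I * ?m u)"
        using integral_norm_bound_integral[OF has_integral_integrable[OF q]
            integrable_on_cmult_left[OF mst, of I]] qb by auto
      also have "\<dots> = I\<^sup>2" by (simp add: I power2_eq_square)
      finally have qI: "\<bar>integral {s..t} ?p - ((f t - f s) * g s + f s * (g t - g s))\<bar> \<le> I\<^sup>2"
        using q by (simp add: integral_unique)
      \<comment> \<open>The product of the two increments and the integral of \<open>?q\<close> each
        contribute \<open>I\<^sup>2\<close>, hence the constant C = 2.\<close>
      have fg: "\<bar>(f t - f s) * (g t - g s)\<bar> \<le> I * I"
        unfolding abs_mult using st I0 by (intro mult_mono incr[OF f] incr[OF g]) auto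
      have "\<Phi> t - \<Phi> s = (f t - f s) * (g t - g s)
          - (integral {s..t} ?p - ((f t - f s) * g s + f s * (g t - g s)))"
        using add[OF p' st] by (simp add: \<Phi>_def algebra_simps)
      with qI fg show "\<bar>\<Phi> t - \<Phi> s\<bar> \<le> 2 * (\<mu> t - \<mu> s)\<^sup>2"
        unfolding I_def[symmetric] by (simp add: power2_eq_square)
    qed
    then have "integral {a..T} ?p = f T * g T - f a * g a" by (simp add: \<Phi>_def)
    then show "(?p has_integral f T * g T - f a * g a) {a..T}"
      using sub[OF p', of a T] T by (metis atLeastAtMost_iff has_integral_iff order_refl)
  qed
qed

text \<open>Integrability of the square says nothing about measurability of \<open>f\<close>; the
  first conjunct supplies it, as needed for products.\<close>

definition sq_int :: "real \<Rightarrow> real \<Rightarrow> (real \<Rightarrow> real) \<Rightarrow> bool" where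
  "sq_int a b f \<longleftrightarrow> f absolutely_integrable_on {a..b} \<and> (\<lambda>t. (f t)\<^sup>2) integrable_on {a..b}"

text \<open>A Henstock-Kurzweil integrable function is measurable, and on a bounded interval it is
  dominated by the integrable function \<open>1 + f\<^sup>2\<close>. So plain integrability, which
  is all the differential equation offers, upgrades to absolute integrability.\<close>

lemma sq_intI:
  assumes f: "f integrable_on {a..b}" and sq: "(\<lambda>t. (f t)\<^sup>2) integrable_on {a..b}"
  shows "sq_int a b f"
proof -
  have "f \<in> borel_measurable (lebesgue_on {a..b})" using integrable_imp_measurable[OF f] .
  moreover have "(\<lambda>t. 1 + (f t)\<^sup>2) integrable_on {a..b}"
    using sq by (intro integrable_add) auto
  moreover have "\<bar>x\<bar> \<le> 1 + x\<^sup>2" for x :: real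
    using zero_le_power2[of "\<bar>x\<bar> - 1"] zero_le_power2[of x]
    by (simp add: power2_eq_square algebra_simps)
  ultimately have "f absolutely_integrable_on {a..b}"
    by (intro measurable_bounded_by_integrable_imp_absolutely_integrable[of f _ "\<lambda>t. 1 + (f t)\<^sup>2"]) auto
  with sq show ?thesis by (simp add: sq_int_def)
qed

lemma sq_int_measurable: "sq_int a b f \<Longrightarrow> f \<in> borel_measurable (lebesgue_on {a..b})"
  by (auto simp: sq_int_def absolutely_integrable_on_def intro: integrable_imp_measurable)

lemma sq_int_mult:
  assumes "sq_int a b f" "sq_int a b g"
  shows "(\<lambda>t. f t * g t) absolutely_integrable_on {a..b}"
proof (rule measurable_bounded_by_integrable_imp_absolutely_integrable)
  show "(\<lambda>t. f t * g t) \<in> borel_measurable (lebesgue_on {a..b})"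
    using assms by (intro borel_measurable_times sq_int_measurable)
  show "(\<lambda>t. (f t)\<^sup>2 + (g t)\<^sup>2) integrable_on {a..b}"
    using assms by (auto simp: sq_int_def intro: integrable_add)
  show "norm (f t * g t) \<le> (f t)\<^sup>2 + (g t)\<^sup>2" for t
    using zero_le_power2[of "\<bar>f t\<bar> - \<bar>g t\<bar>"] abs_ge_zero[of "f t * g t"]
    unfolding power2_diff power2_abs real_norm_def abs_mult by linarith
qed auto

lemma sq_int_continuous:
  assumes "continuous_on {a..b} f" shows "sq_int a b f"
  using assms by (auto simp: sq_int_def absolutely_integrable_continuous_real
      intro!: integrable_continuous_real continuous_intros)

lemma sq_int_add:
  assumes "sq_int a b f" "sq_int a b g" shows "sq_int a b (\<lambda>t. f t + g t)"
proof (rule sq_intI)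
  show "(\<lambda>t. f t + g t) integrable_on {a..b}"
    using assms by (auto simp: sq_int_def absolutely_integrable_on_def intro: integrable_add)
  have "(\<lambda>t. (f t)\<^sup>2 + 2 * (f t * g t) + (g t)\<^sup>2) integrable_on {a..b}"
    using assms sq_int_mult[OF assms]
    by (intro integrable_add integrable_on_cmult_left) (auto simp: sq_int_def absolutely_integrable_on_def)
  then show "(\<lambda>t. (f t + g t)\<^sup>2) integrable_on {a..b}"
    by (simp add: power2_eq_square algebra_simps)
qed

lemma sq_int_cmult:
  assumes "sq_int a b f" shows "sq_int a b (\<lambda>t. c * f t)"
  using assms by (auto simp: sq_int_def power_mult_distrib set_integrable_mult_right
      intro: integrable_on_mult_right)

lemma sq_int_sum:
  assumes "\<And>k. k \<in> I \<Longrightarrow> sq_int a b (f k)" shows "sq_int a b (\<lambda>t. \<Sum>k\<in>I. f k t)"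
  using assms
  by (induction I rule: infinite_finite_induct) (auto intro: sq_int_add sq_int_continuous)

lemma sq_int_subset:
  assumes "sq_int a b f" "a \<le> s" "t \<le> b" shows "sq_int s t f"
  using assms unfolding sq_int_def
  by (auto intro: absolutely_integrable_on_subinterval integrable_on_subinterval)

section \<open>Quadratic forms along weakly differentiable signals\<close>

text \<open>The coordinate sum lets continuity, integrability and the product rule be transferred
  entry by entry, and it makes sense for all vectors without dimension conditions.\<close>

definition bform :: "real mat \<Rightarrow> real vec \<Rightarrow> real vec \<Rightarrow> real" where
  "bform M u v = (\<Sum>a<dim_row M. \<Sum>b<dim_col M. M $$ (a, b) * u $ a * v $ b)"

lemma scalar_mult_mat_vec:
  assumes "u \<in> carrier_vec (dim_row M)" "v \<in> carrier_vec (dim_col M)"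
  shows "u \<bullet> (M *\<^sub>v v) = bform M u v"
  using assms
  by (auto simp: bform_def scalar_prod_def row_def sum_distrib_left mult_ac lessThan_atLeast0 intro!: sum.cong)

text \<open>Locally square integrable derivatives on the whole real line, negative times included,
  since delayed states reach back before time 0. \<open>d\<close> is one definite function, because
  the dynamics will be used at single points of time.\<close>

definition weak_deriv :: "nat \<Rightarrow> (real \<Rightarrow> real vec) \<Rightarrow> (real \<Rightarrow> real vec) \<Rightarrow> bool" where
  "weak_deriv n z d \<longleftrightarrow> (\<forall>t. z t \<in> carrier_vec n) \<and> (\<forall>t. d t \<in> carrier_vec n) \<and>
     (\<forall>c<n. \<forall>a b. a \<le> b \<longrightarrow> sq_int a b (\<lambda>t. d t $ c) \<and> ac_on a b (\<lambda>t. z t $ c) (\<lambda>t. d t $ c))"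

lemma ac_on_const: "a \<le> b \<Longrightarrow> ac_on a b (\<lambda>_. c) (\<lambda>_. 0)"
  by (auto simp: ac_on_def)

lemma ac_on_add:
  assumes "ac_on a b f f'" "ac_on a b g g'"
  shows "ac_on a b (\<lambda>t. f t + g t) (\<lambda>t. f' t + g' t)"
  unfolding ac_on_def
proof (intro conjI ballI)
  show "(\<lambda>t. f' t + g' t) absolutely_integrable_on {a..b}"
    using assms by (auto simp: ac_on_def intro: set_integral_add)
  fix t assume "t \<in> {a..b}"
  then have "((\<lambda>t. f' t + g' t) has_integral (f t - f a) + (g t - g a)) {a..t}"
    using assms by (intro has_integral_add) (auto simp: ac_on_def)
  then show "((\<lambda>t. f' t + g' t) has_integral f t + g t - (f a + g a)) {a..t}"
    by (simp add: algebra_simps)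
qed

lemma ac_on_cmult:
  assumes "ac_on a b f f'" shows "ac_on a b (\<lambda>t. c * f t) (\<lambda>t. c * f' t)"
  unfolding ac_on_def
proof (intro conjI ballI)
  show "(\<lambda>t. c * f' t) absolutely_integrable_on {a..b}"
    using assms by (auto simp: ac_on_def intro: set_integrable_mult_right)
  fix t assume "t \<in> {a..b}"
  then have "((\<lambda>t. c * f' t) has_integral c * (f t - f a)) {a..t}"
    using assms by (intro has_integral_mult_right) (auto simp: ac_on_def)
  then show "((\<lambda>t. c * f' t) has_integral c * f t - c * f a) {a..t}"
    by (simp add: algebra_simps)
qed

lemma ac_on_sum:
  assumes "a \<le> b" "\<And>k. k \<in> I \<Longrightarrow> ac_on a b (f k) (f' k)"
  shows "ac_on a b (\<lambda>t. \<Sum>k\<in>I. f k t) (\<lambda>t. \<Sum>k\<in>I. f' k t)"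
  using assms(2)
  by (induction I rule: infinite_finite_induct) (auto intro!: ac_on_add ac_on_const assms(1))

lemma ac_on_C1:
  assumes "a \<le> b" and deriv: "\<And>t. t \<in> {a..b} \<Longrightarrow> (f has_real_derivative f' t) (at t)"
    and cont: "continuous_on {a..b} f'"
  shows "ac_on a b f f'"
  unfolding ac_on_def
proof (intro conjI ballI absolutely_integrable_continuous_real cont)
  fix t assume "t \<in> {a..b}"
  then show "(f' has_integral f t - f a) {a..t}"
    using deriv by (intro fundamental_theorem_of_calculus)
      (auto simp: has_real_derivative_iff_has_vector_derivative[symmetric] intro: has_field_derivative_at_within)
qed

lemma weak_deriv_continuous:
  assumes "weak_deriv n z d" "c < n" shows "continuous_on S (\<lambda>t. z t $ c)"
proof (rule continuous_at_imp_continuous_on, rule ballI)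
  fix x :: real
  have "ac_on (x - 1) (x + 1) (\<lambda>t. z t $ c) (\<lambda>t. d t $ c)"
    using assms by (auto simp: weak_deriv_def)
  then have "continuous_on {x - 1..x + 1} (\<lambda>t. z t $ c)" by (rule ac_on_continuous)
  then show "isCont (\<lambda>t. z t $ c) x" by (rule continuous_on_interior) simp
qed

lemma weak_deriv_sq_int:
  assumes "weak_deriv n z d" "c < n" shows "sq_int a b (\<lambda>t. d t $ c)"
proof (cases "a \<le> b")
  case True
  then show ?thesis using assms by (auto simp: weak_deriv_def)
qed (auto intro: sq_int_continuous)

lemma bform_continuous:
  assumes "M \<in> carrier_mat n n" "weak_deriv n z d" "weak_deriv n y e"
  shows "continuous_on S (\<lambda>t. bform M (z t) (y t))"
  using assms weak_deriv_continuous unfolding bform_def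
  by (intro continuous_intros) auto

lemma bform_sq_int:
  assumes "M \<in> carrier_mat n n"
    and "\<And>c. c < n \<Longrightarrow> sq_int a b (\<lambda>t. u t $ c)" "\<And>c. c < n \<Longrightarrow> sq_int a b (\<lambda>t. v t $ c)"
  shows "(\<lambda>t. bform M (u t) (v t)) absolutely_integrable_on {a..b}"
proof -
  have "(\<lambda>t. M $$ (i, j) * (u t $ i * v t $ j)) absolutely_integrable_on {a..b}"
    if "i < n" "j < n" for i j
    using that assms by (intro set_integrable_mult_right sq_int_mult) auto
  then show ?thesis
    using assms(1) unfolding bform_def
    by (auto simp: mult.assoc intro!: absolutely_integrable_sum)
qed

lemma ac_on_bform:
  assumes M: "M \<in> carrier_mat n n" and z: "weak_deriv n z d" and "a \<le> b"
  shows "ac_on a b (\<lambda>t. bform M (z t) (z t)) (\<lambda>t. bform M (d t) (z t) + bform M (z t) (d t))"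
proof -
  have "ac_on a b (\<lambda>t. M $$ (i, j) * (z t $ i * z t $ j))
     (\<lambda>t. M $$ (i, j) * (d t $ i * z t $ j + z t $ i * d t $ j))" if "i < n" "j < n" for i j
    using that z assms(3) by (intro ac_on_cmult ac_on_mult) (auto simp: weak_deriv_def)
  then have "ac_on a b (\<lambda>t. \<Sum>i<n. \<Sum>j<n. M $$ (i, j) * (z t $ i * z t $ j))
     (\<lambda>t. \<Sum>i<n. \<Sum>j<n. M $$ (i, j) * (d t $ i * z t $ j + z t $ i * d t $ j))"
    using assms(3) by (intro ac_on_sum) auto
  then show ?thesis using M by (simp add: bform_def sum.distrib algebra_simps)
qed

lemma scalar_prod_self_nonneg: "0 \<le> u \<bullet> (u :: real vec)"
  by (simp add: scalar_prod_def sum_nonneg)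

lemma bform_diff_left:
  assumes "M \<in> carrier_mat n k" "u \<in> carrier_vec n" "u' \<in> carrier_vec n"
  shows "bform M (u - u') v = bform M u v - bform M u' v"
  using assms by (simp add: bform_def sum_subtractf algebra_simps)

lemma bform_diff_right:
  assumes "M \<in> carrier_mat n k" "v \<in> carrier_vec k" "v' \<in> carrier_vec k"
  shows "bform M u (v - v') = bform M u v - bform M u v'"
  using assms by (simp add: bform_def sum_subtractf algebra_simps)

lemma bform_smult_left:
  assumes "M \<in> carrier_mat n k" "u \<in> carrier_vec n"
  shows "bform M (c \<cdot>\<^sub>v u) v = c * bform M u v"
  using assms by (simp add: bform_def sum_distrib_left algebra_simps)

lemma bform_smult_right:
  assumes "M \<in> carrier_mat n k" "v \<in> carrier_vec k"
  shows "bform M u (c \<cdot>\<^sub>v v) = c * bform M u v"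
  using assms by (simp add: bform_def sum_distrib_left algebra_simps)

lemma bform_transpose: "bform M\<^sup>T u v = bform M v u"
proof -
  have "bform M\<^sup>T u v = (\<Sum>a<dim_col M. \<Sum>b<dim_row M. M $$ (b, a) * v $ b * u $ a)"
    by (simp add: bform_def mult_ac)
  also have "\<dots> = bform M v u" unfolding bform_def by (rule sum.swap)
  finally show ?thesis .
qed

lemma bform_add_mat:
  assumes "M \<in> carrier_mat n k" "M' \<in> carrier_mat n k"
  shows "bform (M + M') u v = bform M u v + bform M' u v"
  using assms by (simp add: bform_def sum.distrib algebra_simps)

lemma bform_diff_mat:
  assumes "M \<in> carrier_mat n k" "M' \<in> carrier_mat n k"
  shows "bform (M - M') u v = bform M u v - bform M' u v"
  using assms by (simp add: bform_def sum_subtractf algebra_simps)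

lemma bform_smult_mat: "bform (c \<cdot>\<^sub>m M) u v = c * bform M u v"
  by (simp add: bform_def sum_distrib_left algebra_simps)

lemma bform_uminus_mat: "bform (- M) u v = - bform M u v"
  by (simp add: bform_def sum_negf)

lemma bform_symmetric: "M\<^sup>T = M \<Longrightarrow> bform M u v = bform M v u"
  by (metis bform_transpose)

lemma bform_pos_semidef:
  assumes "pos_semidef M" "M \<in> carrier_mat n n" "u \<in> carrier_vec n"
  shows "0 \<le> bform M u u"
  using assms scalar_mult_mat_vec[of u M u] by (auto simp: pos_semidef_def)

lemma bform_pos_def:
  assumes "pos_def M" "M \<in> carrier_mat n n" "u \<in> carrier_vec n" "u \<noteq> 0\<^sub>v n"
  shows "0 < bform M u u"
  using assms scalar_mult_mat_vec[of u M u] by (auto simp: pos_def_def)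

lemma pos_def_imp_pos_semidef: "pos_def M \<Longrightarrow> M \<in> carrier_mat n n \<Longrightarrow> pos_semidef M"
  unfolding pos_def_def pos_semidef_def by force

lemma bform_zero_left: "M \<in> carrier_mat n k \<Longrightarrow> bform M (0\<^sub>v n) u = 0"
  by (simp add: bform_def)

lemma bform_diff_smult_square:
  assumes "M \<in> carrier_mat n n" "M\<^sup>T = M" "u \<in> carrier_vec n" "v \<in> carrier_vec n"
  shows "bform M (u - c \<cdot>\<^sub>v v) (u - c \<cdot>\<^sub>v v) = bform M u u - 2 * c * bform M u v + c\<^sup>2 * bform M v v"
  using assms bform_symmetric[of M v u]
  by (simp add: bform_diff_left[of _ n n] bform_diff_right[of _ n n] bform_smult_left[of _ n n]
      bform_smult_right[of _ n n] power2_eq_square algebra_simps)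

lemma weak_deriv_carrier:
  assumes "weak_deriv n z d" shows "z t \<in> carrier_vec n" "d t \<in> carrier_vec n"
  using assms by (auto simp: weak_deriv_def)

lemma weak_deriv_diff_const:
  assumes "weak_deriv n z d" "x \<in> carrier_vec n"
  shows "weak_deriv n (\<lambda>t. z t - x) d"
proof -
  have "ac_on a b (\<lambda>t. z t $ c - x $ c) (\<lambda>t. d t $ c)" if "c < n" "a \<le> b" for a b c
    using assms that ac_on_add[OF _ ac_on_const, of a b "\<lambda>t. z t $ c" "\<lambda>t. d t $ c" "- x $ c"]
    by (auto simp: weak_deriv_def)
  then show ?thesis using assms by (simp add: weak_deriv_def)
qed

section \<open>Wirtinger's and Jensen's inequalities for quadratic forms\<close>

lemma bform_deriv_integrable:
  assumes "M \<in> carrier_mat n n" "weak_deriv n z d"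
  shows "(\<lambda>t. bform M (d t) (d t)) integrable_on {a..b}"
  using bform_sq_int[OF assms(1), of a b d d] weak_deriv_sq_int[OF assms(2)]
  by (auto simp: absolutely_integrable_on_def)

lemma bform_continuous_integrable:
  assumes "M \<in> carrier_mat n n" "weak_deriv n z d"
  shows "(\<lambda>t. bform M (z t) (z t)) integrable_on {a..b}"
  using bform_continuous[OF assms assms(2)] by (rule integrable_continuous_real)

text \<open>
  The function \<open>g t = \<omega> tan (\<omega> (b - t))\<close> solves \<open>g' = - (g\<^sup>2 + \<omega>\<^sup>2)\<close>, so for \<open>y t = z t - z a\<close> the form at
  \<open>d - g y\<close> is the integrand of the inequality with constant \<open>\<omega>\<^sup>2\<close> minus the derivative of
  \<open>g\<close> times the form at \<open>y\<close>, which contributes nothing at the end points.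
\<close>

lemma wirtinger:
  assumes M: "M \<in> carrier_mat n n" "pos_semidef M" and z: "weak_deriv n z d" and ab: "a \<le> b"
  shows "pi\<^sup>2 / 4 * integral {a..b} (\<lambda>t. bform M (z t - z a) (z t - z a))
    \<le> (b - a)\<^sup>2 * integral {a..b} (\<lambda>t. bform M (d t) (d t))"
proof (cases "a = b")
  case False
  define y where "y = (\<lambda>t. z t - z a)"
  note zc = weak_deriv_carrier[OF z]
  have y: "weak_deriv n y d"
    unfolding y_def using z zc by (intro weak_deriv_diff_const) auto
  note yc = weak_deriv_carrier[OF y]
  have sym: "M\<^sup>T = M" using M(2) by (simp add: pos_semidef_def)
  let ?A = "integral {a..b} (\<lambda>t. bform M (y t) (y t))"
  let ?B = "integral {a..b} (\<lambda>t. bform M (d t) (d t))"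
  \<comment> \<open>At the optimal value \<open>pi / 2 / (b - a)\<close> the tangent in
    \<open>g\<close> would have its pole at the left end point. Every smaller \<omega> keeps
    \<open>\<omega> * (b - t)\<close> below \<open>pi / 2\<close>; the optimal constant follows by
    letting \<omega> increase to it.\<close>
  have key: "\<omega>\<^sup>2 * ?A \<le> ?B" if \<omega>: "0 \<le> \<omega>" "\<omega> < pi / 2 / (b - a)" for \<omega>
  proof -
    define g where "g = (\<lambda>t. \<omega> * tan (\<omega> * (b - t)))"
    define g' where "g' = (\<lambda>t. - ((g t)\<^sup>2 + \<omega>\<^sup>2))"
    have cos: "cos (\<omega> * (b - t)) \<noteq> 0" if t: "t \<in> {a..b}" for t
    proof -
      have "\<omega> * (b - t) \<le> \<omega> * (b - a)" using t \<omega> by (intro mult_left_mono) auto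
      also have "\<dots> < pi / 2" using \<omega>(2) False ab by (simp add: field_simps)
      finally have "\<omega> * (b - t) < pi / 2" .
      moreover have "0 \<le> \<omega> * (b - t)" using t \<omega>(1) by auto
      ultimately have "0 < cos (\<omega> * (b - t))" using pi_gt_zero by (intro cos_gt_zero_pi) linarith+
      then show ?thesis by simp
    qed
    have g_ac: "ac_on a b g g'"
    proof (rule ac_on_C1[OF ab])
      fix t assume t: "t \<in> {a..b}"
      show "(g has_real_derivative g' t) (at t)"
      proof -
        have "(g has_real_derivative \<omega> * (inverse ((cos (\<omega> * (b - t)))\<^sup>2) * (\<omega> * (0 - 1)))) (at t)"
          unfolding g_def using cos[OF t] by (auto intro!: derivative_eq_intros)
        moreover have "\<omega> * (inverse ((cos (\<omega> * (b - t)))\<^sup>2) * (\<omega> * (0 - 1))) = g' t"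
        proof -
          have "inverse ((cos (\<omega> * (b - t)))\<^sup>2) = 1 + (tan (\<omega> * (b - t)))\<^sup>2"
            using tan_sec[OF cos[OF t]] by (simp add: power_inverse)
          then show ?thesis unfolding g'_def g_def by (simp add: power2_eq_square algebra_simps)
        qed
        ultimately show ?thesis by simp
      qed
      next
      show "continuous_on {a..b} g'"
        unfolding g_def g'_def using cos by (intro continuous_intros) auto
    qed
    have "ac_on a b (\<lambda>t. g t * bform M (y t) (y t))
       (\<lambda>t. g' t * bform M (y t) (y t) + g t * (bform M (d t) (y t) + bform M (y t) (d t)))"
      using ac_on_mult[OF g_ac ac_on_bform[OF M(1) y ab]] .
    from ac_on_has_integral[OF this order_refl ab order_refl]
    have int0: "((\<lambda>t. g' t * bform M (y t) (y t) + g t * (bform M (d t) (y t) + bform M (y t) (d t)))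
       has_integral 0) {a..b}"
      using bform_zero_left[OF M(1)] zc[of a] by (simp add: g_def y_def)
    have intB: "((\<lambda>t. bform M (d t) (d t)) has_integral ?B) {a..b}"
      using bform_deriv_integrable[OF M(1) z] by (rule integrable_integral)
    have intA: "((\<lambda>t. \<omega>\<^sup>2 * bform M (y t) (y t)) has_integral \<omega>\<^sup>2 * ?A) {a..b}"
      using bform_continuous_integrable[OF M(1) y] by (intro has_integral_mult_right integrable_integral)
    have "0 \<le> ?B - \<omega>\<^sup>2 * ?A - 0"
    proof (rule has_integral_nonneg[OF has_integral_diff[OF has_integral_diff[OF intB intA] int0]])
      fix t
      have "0 \<le> bform M (d t - g t \<cdot>\<^sub>v y t) (d t - g t \<cdot>\<^sub>v y t)"
        using yc by (intro bform_pos_semidef[OF M(2,1)]) auto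
      also have "\<dots> = bform M (d t) (d t) - \<omega>\<^sup>2 * bform M (y t) (y t) -
          (g' t * bform M (y t) (y t) + g t * (bform M (d t) (y t) + bform M (y t) (d t)))"
        using yc bform_symmetric[OF sym, of "y t" "d t"]
        by (simp add: bform_diff_smult_square[OF M(1) sym] g'_def algebra_simps)
      finally show "0 \<le> \<dots>" .
    qed
    then show ?thesis by simp
  qed
  have "(pi / 2 / (b - a))\<^sup>2 * ?A \<le> ?B"
  proof (rule tendsto_upperbound)
    show "((\<lambda>\<omega>. \<omega>\<^sup>2 * ?A) \<longlongrightarrow> (pi / 2 / (b - a))\<^sup>2 * ?A) (at_left (pi / 2 / (b - a)))"
      by (intro tendsto_intros)
    have "0 < pi / 2 / (b - a)" using ab False by simp
    then show "\<forall>\<^sub>F \<omega> in at_left (pi / 2 / (b - a)). \<omega>\<^sup>2 * ?A \<le> ?B"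
      by (rule eventually_mono[OF eventually_at_left_real]) (use key in auto)
  qed simp
  then have "(b - a)\<^sup>2 * ((pi / 2 / (b - a))\<^sup>2 * ?A) \<le> (b - a)\<^sup>2 * ?B"
    by (rule mult_left_mono) simp
  moreover have "(b - a)\<^sup>2 * ((pi / 2 / (b - a))\<^sup>2 * ?A) = pi\<^sup>2 / 4 * ?A"
  proof -
    have "h\<^sup>2 * ((pi / 2 / h)\<^sup>2 * x) = pi\<^sup>2 / 4 * x" if "h \<noteq> 0" for h x :: real
      using that by (simp add: power2_eq_square field_simps)
    from this[of "b - a" ?A] show ?thesis using False by (simp only: right_minus_eq simp_thms)
  qed
  ultimately show ?thesis unfolding y_def by linarith
qed simp

lemma bform_deriv_has_integral:
  assumes "M \<in> carrier_mat n n" "weak_deriv n z d" "a \<le> b"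
  shows "((\<lambda>t. bform M x (d t)) has_integral bform M x (z b - z a)) {a..b}"
proof -
  have "((\<lambda>t. \<Sum>i<n. \<Sum>j<n. M $$ (i, j) * x $ i * d t $ j) has_integral
     (\<Sum>i<n. \<Sum>j<n. M $$ (i, j) * x $ i * (z b $ j - z a $ j))) {a..b}"
    using assms by (intro has_integral_sum has_integral_mult_right) (auto simp: weak_deriv_def ac_on_def)
  moreover have "dim_vec (z t) = n" for t using weak_deriv_carrier(1)[OF assms(2), of t] by simp
  ultimately show ?thesis using assms(1) by (simp add: bform_def)
qed

text \<open>The form at the difference of \<open>d t\<close> and its mean value
  \<open>(z b - z a) / (b - a)\<close> is nonnegative; integrated over [a, b] and multiplied by b -
  a, this is the claim. The bound is stated without a quotient, so it also covers a = b.\<close>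

lemma jensen_increment:
  assumes M: "M \<in> carrier_mat n n" "pos_semidef M" and z: "weak_deriv n z d" and ab: "a \<le> b"
  shows "bform M (z b - z a) (z b - z a) \<le> (b - a) * integral {a..b} (\<lambda>t. bform M (d t) (d t))"
proof (cases "a = b")
  case True
  moreover have "z b - z b = 0\<^sub>v n" using weak_deriv_carrier(1)[OF z, of b] by auto
  ultimately show ?thesis using bform_zero_left[OF M(1)] by simp
next
  case False
  define x where "x = z b - z a"
  note zc = weak_deriv_carrier[OF z]
  have x: "x \<in> carrier_vec n" using zc by (auto simp: x_def)
  have sym: "M\<^sup>T = M" using M(2) by (simp add: pos_semidef_def)
  let ?c = "1 / (b - a)" and ?B = "integral {a..b} (\<lambda>t. bform M (d t) (d t))"
  have "((\<lambda>t. bform M (d t) (d t) - 2 * ?c * bform M x (d t) + ?c\<^sup>2 * bform M x x)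
      has_integral ?B - 2 * ?c * bform M x (z b - z a) + (b - a) * (?c\<^sup>2 * bform M x x)) {a..b}"
    using has_integral_const_real[of "?c\<^sup>2 * bform M x x" a b] ab
    by (intro has_integral_add has_integral_diff has_integral_mult_right
        integrable_integral bform_deriv_integrable[OF M(1) z] bform_deriv_has_integral[OF M(1) z ab]) auto
  then have "0 \<le> ?B - 2 * ?c * bform M x (z b - z a) + (b - a) * (?c\<^sup>2 * bform M x x)"
  proof (rule has_integral_nonneg)
    fix t
    have "0 \<le> bform M (d t - ?c \<cdot>\<^sub>v x) (d t - ?c \<cdot>\<^sub>v x)"
      using zc x by (intro bform_pos_semidef[OF M(2,1)]) auto
    then show "0 \<le> bform M (d t) (d t) - 2 * ?c * bform M x (d t) + ?c\<^sup>2 * bform M x x"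
      using zc x bform_symmetric[OF sym, of "d t" x] by (simp add: bform_diff_smult_square[OF M(1) sym])
  qed
  then have "0 \<le> (b - a) * (?B - 2 * ?c * bform M x x + (b - a) * (?c\<^sup>2 * bform M x x))"
    using ab by (simp add: x_def)
  also have "\<dots> = (b - a) * ?B - 2 * (?c * (b - a)) * bform M x x + (?c * (b - a))\<^sup>2 * bform M x x"
    by (simp only: power2_eq_square algebra_simps)
  also have "\<dots> = (b - a) * ?B - bform M x x" using False by simp
  finally show ?thesis by (simp add: x_def)
qed

section \<open>The reciprocally convex combination bound\<close>

lemma square_le_mult_if_nonneg_quadratic:
  fixes a b c :: real
  assumes a: "0 \<le> a" and quad: "\<And>s. 0 \<le> s\<^sup>2 * a - 2 * s * b + c"
  shows "b\<^sup>2 \<le> a * c"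
proof (cases "a = 0")
  case True
  have "b = 0"
  proof (rule ccontr)
    assume "b \<noteq> 0"
    \<comment> \<open>For a = 0 the quadratic is linear in s, and at this s it has the value
      -1.\<close>
    then show False using quad[of "(c + 1) / (2 * b)"] True by (simp add: field_simps)
  qed
  then show ?thesis using True by simp
next
  case False
  then show ?thesis using a quad[of "b / a"] by (simp add: field_simps power2_eq_square)
qed

lemma sum_lessThan_add:
  fixes h :: "nat \<Rightarrow> 'a :: comm_monoid_add"
  shows "(\<Sum>a<k + l. h a) = (\<Sum>a<k. h a) + (\<Sum>a<l. h (k + a))"
  by (induction l) (auto simp: add.assoc)

lemma bform_four_block:
  assumes "A \<in> carrier_mat r c" "B \<in> carrier_mat r c'" "C \<in> carrier_mat r' c" "D \<in> carrier_mat r' c'"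
    and "u \<in> carrier_vec r" "u' \<in> carrier_vec c" "v \<in> carrier_vec r'" "v' \<in> carrier_vec c'"
  shows "bform (four_block_mat A B C D) (u @\<^sub>v v) (u' @\<^sub>v v')
    = bform A u u' + bform B u v' + bform C v u' + bform D v v'"
  using assms by (simp add: bform_def sum_lessThan_add sum.distrib)

text \<open>At the stacked vector of \<open>s u\<close> and \<open>- r v\<close> the block matrix is
  a quadratic polynomial in s and r with mixed coefficient \<open>- 2 * bform G u v\<close>; its
  nonnegativity forces the discriminant condition. As \<open>G\<close> need not be symmetric, the
  bound is later applied to a pair of vectors in both orders.\<close>

lemma bform_cross_bound:
  assumes R: "R \<in> carrier_mat n n" and G: "G \<in> carrier_mat n n"
    and psd: "pos_semidef (four_block_mat R G G\<^sup>T R)"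
    and uv: "u \<in> carrier_vec n" "v \<in> carrier_vec n"
  shows "(bform G u v)\<^sup>2 \<le> bform R u u * bform R v v"
proof (rule square_le_mult_if_nonneg_quadratic)
  have nonneg: "0 \<le> s\<^sup>2 * bform R u u - 2 * s * r * bform G u v + r\<^sup>2 * bform R v v" for s r
  proof -
    let ?x = "s \<cdot>\<^sub>v u" and ?y = "- r \<cdot>\<^sub>v v"
    have xy: "?x \<in> carrier_vec n" "?y \<in> carrier_vec n" using uv by auto
    have "0 \<le> bform (four_block_mat R G G\<^sup>T R) (?x @\<^sub>v ?y) (?x @\<^sub>v ?y)"
      using R xy by (intro bform_pos_semidef[OF psd, of "n + n"]) auto
    also have "\<dots> = bform R ?x ?x + bform G ?x ?y + bform G\<^sup>T ?y ?x + bform R ?y ?y"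
      using R G xy by (intro bform_four_block) auto
    also have "\<dots> = s\<^sup>2 * bform R u u - 2 * s * r * bform G u v + r\<^sup>2 * bform R v v"
      using R G uv unfolding bform_transpose
      by (simp add: bform_smult_left[of _ n n] bform_smult_right[of _ n n] power2_eq_square)
    finally show ?thesis .
  qed
  show "0 \<le> s\<^sup>2 * bform R u u - 2 * s * bform G u v + bform R v v" for s using nonneg[of s 1] by simp
  show "0 \<le> bform R u u" using nonneg[of 1 0] by simp
qed

lemma two_mult_le_add_if_square_le:
  fixes b x y :: real
  assumes "b\<^sup>2 \<le> x * y" "0 \<le> x" "0 \<le> y"
  shows "2 * b \<le> x + y"
proof (rule power2_le_imp_le)
  have "(2 * b)\<^sup>2 = 4 * b\<^sup>2" by simp
  also have "\<dots> \<le> 4 * (x * y)" using assms(1) by simp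
  also have "\<dots> \<le> (x + y)\<^sup>2" using zero_le_power2[of "x - y"] unfolding power2_diff power2_sum by simp
  finally show "(2 * b)\<^sup>2 \<le> (x + y)\<^sup>2" .
qed (use assms in simp)

text \<open>For m = p + 1 this is the form of T' \<Psi> T at the stacked vectors \<open>h 0\<close>,
  ..., \<open>h m\<close>: the matrix T produces the consecutive differences, and \<Psi> couples all
  of them.\<close>

definition coupled_form :: "real mat \<Rightarrow> real mat \<Rightarrow> nat \<Rightarrow> (nat \<Rightarrow> real vec) \<Rightarrow> real" where
  "coupled_form R G m h = (\<Sum>\<mu><m. \<Sum>\<nu><m. bform (if \<mu> = \<nu> then R else (1 / 2) \<cdot>\<^sub>m (G + G\<^sup>T))
     (h \<mu> - h (Suc \<mu>)) (h \<nu> - h (Suc \<nu>)))"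

text \<open>
  The reciprocally convex combination bound, combined with Jensen's inequality before any division
  by the interval lengths, so that degenerate intervals need no special treatment.
\<close>

lemma reciprocally_convex_bound:
  fixes \<theta> :: "nat \<Rightarrow> real"
  assumes R: "R \<in> carrier_mat n n" "pos_semidef R" and G: "G \<in> carrier_mat n n"
    and psd: "pos_semidef (four_block_mat R G G\<^sup>T R)"
    and z: "weak_deriv n z d" and \<theta>: "\<And>\<mu>. \<mu> < m \<Longrightarrow> \<theta> (Suc \<mu>) \<le> \<theta> \<mu>"
  shows "coupled_form R G m (\<lambda>\<mu>. z (\<theta> \<mu>))
    \<le> (\<theta> 0 - \<theta> m) * integral {\<theta> m..\<theta> 0} (\<lambda>t. bform R (d t) (d t))"
proof -
  define \<delta> where "\<delta> = (\<lambda>\<mu>. z (\<theta> \<mu>) - z (\<theta> (Suc \<mu>)))"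
  define h where "h = (\<lambda>\<mu>. \<theta> \<mu> - \<theta> (Suc \<mu>))"
  define r where "r = (\<lambda>\<mu>. integral {\<theta> (Suc \<mu>)..\<theta> \<mu>} (\<lambda>t. bform R (d t) (d t)))"
  note zc = weak_deriv_carrier[OF z]
  have int: "(\<lambda>t. bform R (d t) (d t)) integrable_on {a..b}" for a b
    by (rule bform_deriv_integrable[OF R(1) z])
  have \<delta>: "\<delta> \<mu> \<in> carrier_vec n" for \<mu> using zc by (auto simp: \<delta>_def)
  have jensen: "bform R (\<delta> \<mu>) (\<delta> \<mu>) \<le> h \<mu> * r \<mu>" if "\<mu> < m" for \<mu>
    unfolding \<delta>_def h_def r_def using jensen_increment[OF R z \<theta>[OF that]] .
  have h0: "0 \<le> h \<mu>" if "\<mu> < m" for \<mu> using \<theta>[OF that] by (simp add: h_def)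
  have r0: "0 \<le> r \<mu>" for \<mu>
    unfolding r_def using zc by (intro integral_nonneg int bform_pos_semidef[OF R(2,1)])
  \<comment> \<open>The four factors are regrouped as
    \<open>(h \<nu> * r \<mu>) * (h \<mu> * r \<nu>)\<close> before the arithmetic-geometric mean
    inequality. Summed over all pairs, the right-hand sides then form the product of the total
    length and the total integral.\<close>
  have cross: "2 * bform G (\<delta> \<mu>) (\<delta> \<nu>) \<le> h \<nu> * r \<mu> + h \<mu> * r \<nu>" if "\<mu> < m" "\<nu> < m" for \<mu> \<nu>
  proof (rule two_mult_le_add_if_square_le)
    have "(bform G (\<delta> \<mu>) (\<delta> \<nu>))\<^sup>2 \<le> bform R (\<delta> \<mu>) (\<delta> \<mu>) * bform R (\<delta> \<nu>) (\<delta> \<nu>)"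
      using bform_cross_bound[OF R(1) G psd \<delta> \<delta>] .
    also have "\<dots> \<le> (h \<mu> * r \<mu>) * (h \<nu> * r \<nu>)"
      using that h0 r0 by (intro mult_mono jensen bform_pos_semidef[OF R(2,1)] \<delta>) auto
    finally show "(bform G (\<delta> \<mu>) (\<delta> \<nu>))\<^sup>2 \<le> (h \<nu> * r \<mu>) * (h \<mu> * r \<nu>)" by (simp add: mult_ac)
  qed (use h0 r0 that in auto)
  have "(\<Sum>\<mu><m. \<Sum>\<nu><m. bform (if \<mu> = \<nu> then R else (1 / 2) \<cdot>\<^sub>m (G + G\<^sup>T)) (\<delta> \<mu>) (\<delta> \<nu>))
    \<le> (\<Sum>\<mu><m. \<Sum>\<nu><m. 1 / 2 * (h \<nu> * r \<mu>) + 1 / 2 * (h \<mu> * r \<nu>))"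
  proof (intro sum_mono)
    fix \<mu> \<nu> assume "\<mu> \<in> {..<m}" "\<nu> \<in> {..<m}"
    then show "bform (if \<mu> = \<nu> then R else (1 / 2) \<cdot>\<^sub>m (G + G\<^sup>T)) (\<delta> \<mu>) (\<delta> \<nu>)
      \<le> 1 / 2 * (h \<nu> * r \<mu>) + 1 / 2 * (h \<mu> * r \<nu>)"
      using jensen cross[of \<mu> \<nu>] cross[of \<nu> \<mu>] G
      by (auto simp: bform_smult_mat bform_add_mat[of _ n n] bform_transpose)
  qed
  also have "\<dots> = (\<Sum>\<mu><m. h \<mu>) * (\<Sum>\<mu><m. r \<mu>)"
    unfolding sum.distrib sum_distrib_left[symmetric] sum_distrib_right[symmetric] by (simp add: mult_ac)
  also have "(\<Sum>\<mu><m. h \<mu>) = \<theta> 0 - \<theta> m"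
    unfolding h_def by (rule sum_lessThan_telescope')
  also have "(\<Sum>\<mu><m. r \<mu>) = integral {\<theta> m..\<theta> 0} (\<lambda>t. bform R (d t) (d t))"
    using \<theta>
  proof (induction m)
    case (Suc m)
    have "\<theta> k \<le> \<theta> 0" if "k \<le> m" for k
      using that
    proof (induction k)
      case (Suc k)
      then show ?case using Suc.prems \<open>\<And>\<mu>. \<mu> < Suc m \<Longrightarrow> \<theta> (Suc \<mu>) \<le> \<theta> \<mu>\<close>[of k] by auto
    qed simp
    then have le: "\<theta> m \<le> \<theta> 0" by simp
    show ?case
      using Henstock_Kurzweil_Integration.integral_combine[OF Suc.prems[of m] le int] Suc by (simp add: r_def add.commute)
  qed simp
  finally show ?thesis unfolding \<delta>_def coupled_form_def .
qed

section \<open>Energies of delayed states and of delayed derivatives\<close>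

lemma integral_delay:
  fixes h :: "real \<Rightarrow> real"
  assumes h: "continuous_on {-\<tau>..T} h" and "0 \<le> \<tau>" "0 \<le> T"
  shows "((\<lambda>t. h (t - \<tau>)) has_integral integral {-\<tau>..0} h + integral {0..T} h - integral {T-\<tau>..T} h) {0..T}"
proof -
  have int: "h integrable_on {a..b}" if "-\<tau> \<le> a" "b \<le> T" for a b
    using h that by (intro integrable_continuous_real) (auto intro: continuous_on_subset)
  have "(h has_integral integral {-\<tau>..T-\<tau>} h) (cbox (-\<tau>) (T-\<tau>))"
    using int assms by (auto intro: integrable_integral)
  from has_integral_affinity[OF this, of 1 "-\<tau>"]
  have "((\<lambda>t. h (t - \<tau>)) has_integral integral {-\<tau>..T-\<tau>} h) {0..T}"
    using assms by (simp add: image_affinity_atLeastAtMost_diff)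
  \<comment> \<open>The shifted integral is kept as three overlapping pieces: subtracted from the
    integral over {0..T} it leaves only two windows of length \<tau>, also when T < \<tau>.\<close>
  moreover have "integral {-\<tau>..T-\<tau>} h = integral {-\<tau>..0} h + integral {0..T} h - integral {T-\<tau>..T} h"
    using Henstock_Kurzweil_Integration.integral_combine[of "-\<tau>" 0 T h]
      Henstock_Kurzweil_Integration.integral_combine[of "-\<tau>" "T-\<tau>" T h] int assms by auto
  ultimately show ?thesis by simp
qed

text \<open>
  For \<open>t < \<tau>\<close> the delayed state is still the initial one; there the decay \<open>exp (- 2 \<alpha> (\<tau> - t))\<close> of its
  weight integrates to the coefficient of \<open>c\<close>.
\<close>

lemma delayed_state_energy:
  fixes \<phi> :: "real \<Rightarrow> real"
  assumes cont: "continuous_on UNIV \<phi>" and nonneg: "\<And>t. 0 \<le> \<phi> t"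
    and init: "\<And>t. t \<le> 0 \<Longrightarrow> \<phi> t = c"
    and "\<beta> \<le> \<alpha>" "0 < \<alpha>" "0 \<le> \<tau>" "0 \<le> T"
  shows "\<exists>I. ((\<lambda>t. exp (2 * \<beta> * t) * (\<phi> t - exp (- 2 * \<alpha> * \<tau>) * \<phi> (t - \<tau>))) has_integral I) {0..T} \<and>
     - ((1 - exp (- 2 * \<alpha> * \<tau>)) / (2 * \<alpha>)) * c \<le> I"
proof -
  \<comment> \<open>Two exponential weights glued continuously at 0. Rate \<beta> after time 0
    reproduces the undelayed term; rate \<alpha> before time 0 makes the window over the constant
    history integrate exactly to the coefficient of c.\<close>
  define h where "h = (\<lambda>s. exp (2 * \<alpha> * min s 0 + 2 * \<beta> * max s 0) * \<phi> s)"
  let ?f = "\<lambda>t. exp (2 * \<beta> * t) * (\<phi> t - exp (- 2 * \<alpha> * \<tau>) * \<phi> (t - \<tau>))"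
  have hc: "continuous_on S h" for S
    unfolding h_def by (intro continuous_intros continuous_on_subset[OF cont]) auto
  have h0: "0 \<le> h s" for s using nonneg by (simp add: h_def)
  have int_f: "?f integrable_on {0..T}"
    by (intro integrable_continuous_real continuous_intros continuous_on_subset[OF cont]
        continuous_on_compose2[OF cont]) auto
  have int_h: "(h has_integral integral {0..T} h) {0..T}"
    by (intro integrable_integral integrable_continuous_real hc)
  have neg: "(h has_integral (1 - exp (- 2 * \<alpha> * \<tau>)) / (2 * \<alpha>) * c) {-\<tau>..0}"
  proof -
    have "((\<lambda>s. exp (2 * \<alpha> * s) * c) has_integral
       exp (2 * \<alpha> * 0) / (2 * \<alpha>) * c - exp (2 * \<alpha> * (-\<tau>)) / (2 * \<alpha>) * c) {-\<tau>..0}"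
      using assms
      by (intro fundamental_theorem_of_calculus)
         (auto simp: has_real_derivative_iff_has_vector_derivative[symmetric]
           intro!: derivative_eq_intros)
    then have "((\<lambda>s. exp (2 * \<alpha> * s) * c) has_integral (1 - exp (- 2 * \<alpha> * \<tau>)) / (2 * \<alpha>) * c) {-\<tau>..0}"
      by (simp add: diff_divide_distrib left_diff_distrib)
    then show ?thesis by (rule has_integral_eq[rotated]) (simp add: h_def init)
  qed
  have delay: "((\<lambda>t. h (t - \<tau>)) has_integral
     integral {-\<tau>..0} h + integral {0..T} h - integral {T-\<tau>..T} h) {0..T}"
    using hc assms by (intro integral_delay) auto
  have "integral {0..T} h - (integral {-\<tau>..0} h + integral {0..T} h - integral {T-\<tau>..T} h) \<le> integral {0..T} ?f"
  proof (rule has_integral_le[OF has_integral_diff[OF int_h delay] integrable_integral[OF int_f]])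
    fix t assume t: "t \<in> {0..T}"
    \<comment> \<open>The exponent that the delayed term actually carries, compared with the one in
      \<open>h (t - \<tau>)\<close>; both cases rest on \<beta> \<le> \<alpha>.\<close>
    have "2 * \<beta> * t - 2 * \<alpha> * \<tau> \<le> 2 * \<alpha> * min (t - \<tau>) 0 + 2 * \<beta> * max (t - \<tau>) 0"
    proof (cases "\<tau> \<le> t")
      case True
      have "\<beta> * \<tau> \<le> \<alpha> * \<tau>" using assms by (intro mult_right_mono) auto
      then show ?thesis using True by (simp add: algebra_simps)
    next
      case False
      have "\<beta> * t \<le> \<alpha> * t" using assms t by (intro mult_right_mono) auto
      then show ?thesis using False by (simp add: algebra_simps)
    qed
    then have "exp (2 * \<beta> * t - 2 * \<alpha> * \<tau>) * \<phi> (t - \<tau>) \<le> h (t - \<tau>)"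
      unfolding h_def using nonneg by (intro mult_right_mono) auto
    then show "h t - h (t - \<tau>) \<le> ?f t"
      using t by (simp add: h_def exp_diff exp_minus field_simps)
  qed
  moreover have "0 \<le> integral {T-\<tau>..T} h"
    using h0 by (intro integral_nonneg integrable_continuous_real hc) auto
  ultimately have "- ((1 - exp (- 2 * \<alpha> * \<tau>)) / (2 * \<alpha>)) * c \<le> integral {0..T} ?f"
    using integral_unique[OF neg] by simp
  then show ?thesis using int_f by (blast intro: integrable_integral)
qed

text \<open>A primitive \<rho> of the weighted integrand replaces an exchange of the order of
  integration. The weighted window integral is at most
  \<open>\<rho> t - \<rho> (t - \<tau>)\<close>. Integrating this difference over {0..T} leaves the
  integral of \<rho> over the last window minus that over the first; since \<rho> is nonnegative and
  increasing, this is at most \<tau> times its final value.\<close>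

lemma delayed_derivative_energy:
  fixes r :: "real \<Rightarrow> real"
  assumes int: "\<And>a b. r integrable_on {a..b}" and nonneg: "\<And>t. 0 \<le> r t"
    and init: "\<And>t. t < 0 \<Longrightarrow> r t = 0"
    and "0 \<le> \<beta>" "\<beta> \<le> \<alpha>" "0 \<le> \<tau>" "0 \<le> T"
  shows "\<exists>I. ((\<lambda>t. exp (2 * \<beta> * t) * (\<tau>\<^sup>2 * r t - exp (- 2 * \<alpha> * \<tau>) * (\<tau> * integral {t-\<tau>..t} r)))
     has_integral I) {0..T} \<and> 0 \<le> I"
proof -
  let ?f = "\<lambda>t. exp (2 * \<beta> * t) * (\<tau>\<^sup>2 * r t - exp (- 2 * \<alpha> * \<tau>) * (\<tau> * integral {t-\<tau>..t} r))"
  let ?w = "\<lambda>t. exp (2 * \<beta> * t)"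
  have int_w: "(\<lambda>t. ?w t * r t) integrable_on {a..b}" for a b
  proof -
    have "r absolutely_integrable_on {a..b}"
      using int nonneg by (auto intro: nonnegative_absolutely_integrable_1)
    then have "(\<lambda>t. r t * ?w t) absolutely_integrable_on {a..b}"
      by (intro absolutely_integrable_mult_continuous continuous_intros)
    then show ?thesis by (simp add: absolutely_integrable_on_def mult.commute)
  qed
  define \<rho> where "\<rho> = (\<lambda>q t. integral {-\<tau>..t} q :: real)"
  have \<rho>_cont: "continuous_on {-\<tau>..T} (\<rho> q)" if "\<And>a b. q integrable_on {a..b}" for q
    unfolding \<rho>_def using that by (rule indefinite_integral_continuous_1)
  have \<rho>_diff: "integral {t-\<tau>..t} q = \<rho> q t - \<rho> q (t - \<tau>)"
    if "\<And>a b. q integrable_on {a..b}" "t \<in> {0..T}" for q :: "real \<Rightarrow> real" and t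
    using Henstock_Kurzweil_Integration.integral_combine[of "-\<tau>" "t-\<tau>" t q] that assms
    by (auto simp: \<rho>_def)
  have window_cont: "continuous_on {0..T} (\<lambda>t. integral {t-\<tau>..t} q)"
    if q: "\<And>a b. q integrable_on {a..b}" for q :: "real \<Rightarrow> real"
  proof -
    have "continuous_on {0..T} (\<lambda>t. \<rho> q t - \<rho> q (t - \<tau>))"
      using assms by (intro continuous_intros continuous_on_subset[OF \<rho>_cont[OF q]]
          continuous_on_compose2[OF \<rho>_cont[OF q]]) auto
    then show ?thesis by (rule continuous_on_eq) (use \<rho>_diff[OF q] in auto)
  qed
  let ?q = "\<lambda>t. ?w t * r t"
  have int_f: "?f integrable_on {0..T}"
  proof -
    have "(\<lambda>t. \<tau>\<^sup>2 * ?q t - exp (- 2 * \<alpha> * \<tau>) * (\<tau> * (?w t * integral {t-\<tau>..t} r))) integrable_on {0..T}"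
      using window_cont[OF int]
      by (intro integrable_diff integrable_on_mult_right int_w integrable_continuous_real continuous_intros)
    then show ?thesis by (simp add: algebra_simps)
  qed
  have mono: "\<rho> ?q s \<le> \<rho> ?q T" if "s \<le> T" for s
    unfolding \<rho>_def using int_w nonneg that by (intro integral_subset_le) auto
  have \<rho>_T: "\<rho> ?q T = integral {0..T} ?q"
  proof -
    \<comment> \<open>The value of \<open>r\<close> at 0 is left open by \<open>init\<close>, so the
      integrands agree only away from this point.\<close>
    have "integral {-\<tau>..0} ?q = integral {-\<tau>..0} (\<lambda>_. 0 :: real)"
      by (rule integral_spike[of "{0}"]) (auto simp: init)
    then show ?thesis
      using Henstock_Kurzweil_Integration.integral_combine[of "-\<tau>" 0 T ?q] int_w assms by (simp add: \<rho>_def)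
  qed
  have delay: "((\<lambda>t. \<rho> ?q (t - \<tau>)) has_integral
     integral {-\<tau>..0} (\<rho> ?q) + integral {0..T} (\<rho> ?q) - integral {T-\<tau>..T} (\<rho> ?q)) {0..T}"
    using assms by (intro integral_delay \<rho>_cont int_w)
  have int_\<rho>: "\<rho> ?q integrable_on {a..b}" if "-\<tau> \<le> a" "b \<le> T" for a b
    using that by (intro integrable_continuous_real continuous_on_subset[OF \<rho>_cont[OF int_w]]) auto
  have lower: "((\<lambda>t. \<tau>\<^sup>2 * ?q t - \<tau> * (\<rho> ?q t - \<rho> ?q (t - \<tau>))) has_integral
      \<tau>\<^sup>2 * integral {0..T} ?q - \<tau> * (integral {0..T} (\<rho> ?q) -
       (integral {-\<tau>..0} (\<rho> ?q) + integral {0..T} (\<rho> ?q) - integral {T-\<tau>..T} (\<rho> ?q)))) {0..T}"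
    using assms
    by (intro has_integral_diff has_integral_mult_right delay integrable_integral int_w int_\<rho>) auto
  have main: "\<tau>\<^sup>2 * integral {0..T} ?q - \<tau> * (integral {0..T} (\<rho> ?q) -
       (integral {-\<tau>..0} (\<rho> ?q) + integral {0..T} (\<rho> ?q) - integral {T-\<tau>..T} (\<rho> ?q)))
     \<le> integral {0..T} ?f"
  proof (rule has_integral_le[OF lower integrable_integral[OF int_f]])
    fix t assume t: "t \<in> {0..T}"
    have "exp (- 2 * \<alpha> * \<tau>) * ?w t * integral {t-\<tau>..t} r = integral {t-\<tau>..t} (\<lambda>s. exp (- 2 * \<alpha> * \<tau>) * ?w t * r s)"
      by simp
    also have "\<dots> \<le> integral {t-\<tau>..t} ?q"
    proof (intro integral_le integrable_on_mult_right int int_w mult_right_mono nonneg)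
      fix s assume s: "s \<in> {t-\<tau>..t}"
      have "2 * \<beta> * (t - \<tau>) \<le> 2 * \<beta> * s" "\<beta> * \<tau> \<le> \<alpha> * \<tau>"
        using s assms by (auto intro: mult_left_mono mult_right_mono)
      then have "- 2 * \<alpha> * \<tau> + 2 * \<beta> * t \<le> 2 * \<beta> * s" by (simp add: algebra_simps)
      then show "exp (- 2 * \<alpha> * \<tau>) * ?w t \<le> ?w s" unfolding exp_add[symmetric] by simp
    qed
    also have "\<dots> = \<rho> ?q t - \<rho> ?q (t - \<tau>)" by (rule \<rho>_diff[OF int_w t])
    finally have "\<tau> * (exp (- 2 * \<alpha> * \<tau>) * ?w t * integral {t-\<tau>..t} r) \<le> \<tau> * (\<rho> ?q t - \<rho> ?q (t - \<tau>))"
      using assms by (intro mult_left_mono)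
    then show "\<tau>\<^sup>2 * ?q t - \<tau> * (\<rho> ?q t - \<rho> ?q (t - \<tau>)) \<le> ?f t" by (simp add: algebra_simps)
  qed
  have "integral {T-\<tau>..T} (\<rho> ?q) \<le> integral {T-\<tau>..T} (\<lambda>_. \<rho> ?q T)"
    using assms by (intro integral_le int_\<rho> mono) auto
  moreover have "0 \<le> integral {-\<tau>..0} (\<rho> ?q)"
    unfolding \<rho>_def using assms(6,7) int_\<rho>[of "-\<tau>" 0] nonneg
    by (intro integral_nonneg) (auto simp: \<rho>_def intro!: integral_nonneg int_w)
  ultimately have "\<tau> * (integral {T-\<tau>..T} (\<rho> ?q) - integral {-\<tau>..0} (\<rho> ?q)) \<le> \<tau> * (\<tau> * \<rho> ?q T)"
    using assms by (intro mult_left_mono) auto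
  with main[folded \<rho>_T] have "0 \<le> integral {0..T} ?f"
    by (simp add: power2_eq_square algebra_simps)
  then show ?thesis using int_f by (blast intro: integrable_integral)
qed

section \<open>Sampling and the Round-Robin order\<close>

definition step_index :: "(nat \<Rightarrow> real) \<Rightarrow> real \<Rightarrow> nat" where
  "step_index s t = (LEAST k. t < s (Suc k))"

locale sampling =
  fixes s :: "nat \<Rightarrow> real"
  assumes s0: "s 0 = 0" and s_mono: "strict_mono s" and s_unbounded: "filterlim s at_top sequentially"
begin

lemma s_le: "k \<le> l \<Longrightarrow> s k \<le> s l"
  using s_mono by (simp add: strict_mono_less_eq)

lemma s_nonneg: "0 \<le> s k"
  using s_le[of 0 k] s0 by simp

lemma ex_sample_greater: "\<exists>k. t < s (Suc k)"
proof -
  have "eventually (\<lambda>k. t < s k) sequentially"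
    using s_unbounded by (auto simp: filterlim_at_top_dense)
  then obtain k where "t < s k" by (auto simp: eventually_sequentially)
  then show ?thesis using s_le[of k "Suc k"] by (intro exI[of _ k]) auto
qed

lemma step_index_bounds:
  assumes "0 \<le> t" shows "s (step_index s t) \<le> t" "t < s (Suc (step_index s t))"
proof -
  show "t < s (Suc (step_index s t))"
    unfolding step_index_def using ex_sample_greater by (rule LeastI_ex)
  show "s (step_index s t) \<le> t"
  proof (cases "step_index s t")
    case (Suc k)
    then have "\<not> t < s (Suc k)" unfolding step_index_def using not_less_Least[of k "\<lambda>k. t < s (Suc k)"] by auto
    then show ?thesis using Suc by simp
  qed (use assms s0 in simp)
qed

lemma step_index_eq:
  assumes "s k \<le> t" "t < s (Suc k)" shows "step_index s t = k"
  unfolding step_index_def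
proof (rule Least_equality)
  fix l assume "t < s (Suc l)"
  then have "s k < s (Suc l)" using assms by simp
  then show "k \<le> l" using s_mono by (simp add: strict_mono_less)
qed (use assms in simp)

lemma integrable_on_if_sampled:
  fixes f :: "real \<Rightarrow> real"
  assumes "\<And>k. f integrable_on {s k..s (Suc k)}" "0 \<le> a"
  shows "f integrable_on {a..b}"
proof -
  have "f integrable_on {0..s k}" for k
  proof (induction k)
    case (Suc k)
    show ?case
      using Henstock_Kurzweil_Integration.integrable_combine[OF s_nonneg s_le[OF le_SucI[OF order_refl]] Suc assms(1)] .
  qed (use has_integral_integrable[OF has_integral_refl(2)] in \<open>simp add: s0\<close>)
  moreover obtain k where "b < s (Suc k)" using ex_sample_greater by blast
  ultimately show ?thesis using assms(2)
    by (auto intro: integrable_on_subinterval[of f "{0..s (Suc k)}"])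
qed

lemma has_integral_if_sampled:
  fixes f F :: "real \<Rightarrow> real"
  assumes "\<And>k t. t \<in> {s k..s (Suc k)} \<Longrightarrow> (f has_integral F t - F (s k)) {s k..t}" "0 \<le> t"
  shows "(f has_integral F t - F 0) {0..t}"
proof -
  have *: "(f has_integral F (s k) - F 0) {0..s k}" for k
  proof (induction k)
    case (Suc k)
    have "(f has_integral (F (s k) - F 0) + (F (s (Suc k)) - F (s k))) {0..s (Suc k)}"
      using s_le[of k "Suc k"] by (intro has_integral_combine[OF s_nonneg _ Suc] assms(1)) auto
    then show ?case by simp
  qed (use has_integral_refl(2) in \<open>simp add: s0\<close>)
  let ?k = "step_index s t"
  have "(f has_integral (F (s ?k) - F 0) + (F t - F (s ?k))) {0..t}"
    using step_index_bounds[OF assms(2)]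
    by (intro has_integral_combine[OF s_nonneg _ *] assms(1)) auto
  then show ?thesis by simp
qed

text \<open>
  A held sample changes at step \<open>k + 1\<close> only by being refreshed, so the time axis splits into holding
  intervals of length at most \<open>\<tau>\<close>, on each of which Wirtinger's inequality applies.
\<close>

lemma held_sample_energy:
  assumes M: "M \<in> carrier_mat n n" "pos_semidef M" and z: "weak_deriv n z d"
    and \<sigma>: "\<sigma> 0 = 0" "\<And>k. \<sigma> (Suc k) = \<sigma> k \<or> \<sigma> (Suc k) = Suc k"
    and \<tau>: "\<And>k. s (Suc k) - s (\<sigma> k) \<le> \<tau>"
    and \<zeta>: "\<And>k t. s k \<le> t \<Longrightarrow> t < s (Suc k) \<Longrightarrow> \<zeta> t = z (s (\<sigma> k))"
    and \<beta>: "0 \<le> \<beta>" and T: "0 \<le> T"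
  shows "\<exists>I. ((\<lambda>t. exp (2 * \<beta> * t) * (exp (2 * \<beta> * \<tau>) * \<tau>\<^sup>2 * bform M (d t) (d t)
            - pi\<^sup>2 / 4 * bform M (z t - \<zeta> t) (z t - \<zeta> t))) has_integral I) {0..T} \<and> 0 \<le> I"
proof -
  let ?f = "\<lambda>x t. exp (2 * \<beta> * t) * (exp (2 * \<beta> * \<tau>) * \<tau>\<^sup>2 * bform M (d t) (d t)
            - pi\<^sup>2 / 4 * bform M (z t - x t) (z t - x t))"
  note zc = weak_deriv_carrier[OF z]
  have \<sigma>_le: "\<sigma> k \<le> k" for k
  proof (induction k)
    case (Suc k) then show ?case using \<sigma>(2)[of k] by auto
  qed (simp add: \<sigma>(1))
  have int_const: "?f (\<lambda>_. z c) integrable_on {a..b}" for a b c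
  proof -
    have y: "weak_deriv n (\<lambda>t. z t - z c) d" using z zc by (intro weak_deriv_diff_const)
    have "(\<lambda>t. bform M (d t) (d t)) absolutely_integrable_on {a..b}"
      using weak_deriv_sq_int[OF z] by (intro bform_sq_int[OF M(1)])
    then have "(\<lambda>t. bform M (d t) (d t) * exp (2 * \<beta> * t)) absolutely_integrable_on {a..b}"
      by (intro absolutely_integrable_mult_continuous continuous_intros)
    then have D: "(\<lambda>t. bform M (d t) (d t) * exp (2 * \<beta> * t)) integrable_on {a..b}"
      by (simp add: absolutely_integrable_on_def)
    have Y: "(\<lambda>t. exp (2 * \<beta> * t) * bform M (z t - z c) (z t - z c)) integrable_on {a..b}"
      by (intro integrable_continuous_real continuous_on_mult bform_continuous[OF M(1) y y] continuous_intros)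
    have "(\<lambda>t. exp (2 * \<beta> * \<tau>) * \<tau>\<^sup>2 * (bform M (d t) (d t) * exp (2 * \<beta> * t))
        - pi\<^sup>2 / 4 * (exp (2 * \<beta> * t) * bform M (z t - z c) (z t - z c))) integrable_on {a..b}"
      by (intro integrable_diff integrable_on_mult_right D Y)
    then show ?thesis by (simp add: algebra_simps)
  qed
  have int: "?f \<zeta> integrable_on {a..b}" if "0 \<le> a" for a b
  proof (rule integrable_on_if_sampled[OF _ that])
    fix k
    show "?f \<zeta> integrable_on {s k..s (Suc k)}"
      by (rule integrable_spike[OF int_const[of "s (\<sigma> k)"], of "{s (Suc k)}"]) (auto simp: \<zeta>)
  qed
  \<comment> \<open>Over a holding interval starting at a, the weight lies between
    \<open>exp (2 * \<beta> * a)\<close> and \<open>?C\<close>. The derivative term, which carries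
    the additional factor \<open>exp (2 * \<beta> * \<tau>)\<close>, is compared by means of the
    lower bound, the sampling error by means of the upper one; Wirtinger's inequality then applies
    with the constant weight \<open>?C\<close>.\<close>
  have window: "0 \<le> integral {a..b} (?f \<zeta>)"
    if ab: "0 \<le> a" "a \<le> b" "b - a \<le> \<tau>" and held: "\<And>t. t \<in> {a..<b} \<Longrightarrow> \<zeta> t = z a" for a b
  proof -
    let ?C = "exp (2 * \<beta> * a) * exp (2 * \<beta> * \<tau>)"
    let ?g = "\<lambda>t. ?C * ((b - a)\<^sup>2 * bform M (d t) (d t) - pi\<^sup>2 / 4 * bform M (z t - z a) (z t - z a))"
    have y: "weak_deriv n (\<lambda>t. z t - z a) d" using z zc by (intro weak_deriv_diff_const)
    have g: "(?g has_integral ?C * ((b - a)\<^sup>2 * integral {a..b} (\<lambda>t. bform M (d t) (d t))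
         - pi\<^sup>2 / 4 * integral {a..b} (\<lambda>t. bform M (z t - z a) (z t - z a)))) {a..b}"
      by (intro has_integral_mult_right has_integral_diff integrable_integral
          bform_deriv_integrable[OF M(1) z] bform_continuous_integrable[OF M(1) y])
    have "0 \<le> ?C * ((b - a)\<^sup>2 * integral {a..b} (\<lambda>t. bform M (d t) (d t))
         - pi\<^sup>2 / 4 * integral {a..b} (\<lambda>t. bform M (z t - z a) (z t - z a)))"
      using wirtinger[OF M z ab(2)] by simp
    also have "\<dots> \<le> integral {a..b} (?f (\<lambda>_. z a))"
    proof (rule has_integral_le[OF g integrable_integral[OF int_const]])
      fix t assume t: "t \<in> {a..b}"
      let ?D = "bform M (d t) (d t)" and ?Y = "bform M (z t - z a) (z t - z a)"
      have D: "0 \<le> ?D" using zc by (intro bform_pos_semidef[OF M(2,1)])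
      have Y: "0 \<le> ?Y" using zc by (intro bform_pos_semidef[OF M(2,1)]) auto
      have "2 * \<beta> * t \<le> 2 * \<beta> * (a + \<tau>)" using t ab \<beta> by (intro mult_left_mono) auto
      then have w1: "exp (2 * \<beta> * t) \<le> ?C" unfolding exp_add[symmetric] by (simp add: algebra_simps)
      have "2 * \<beta> * a \<le> 2 * \<beta> * t" using t \<beta> by (intro mult_left_mono) auto
      then have w2: "exp (2 * \<beta> * a) \<le> exp (2 * \<beta> * t)" by simp
      have "(b - a)\<^sup>2 \<le> \<tau>\<^sup>2" using ab by (intro power_mono) auto
      then have "?C * ((b - a)\<^sup>2 * ?D) \<le> (exp (2 * \<beta> * t) * exp (2 * \<beta> * \<tau>)) * (\<tau>\<^sup>2 * ?D)"
        using D w2 by (intro mult_mono) auto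
      moreover have "exp (2 * \<beta> * t) * (pi\<^sup>2 / 4 * ?Y) \<le> ?C * (pi\<^sup>2 / 4 * ?Y)"
        using Y w1 by (intro mult_right_mono) auto
      ultimately show "?g t \<le> ?f (\<lambda>_. z a) t" unfolding right_diff_distrib mult.assoc by linarith
    qed
    also have "integral {a..b} (?f (\<lambda>_. z a)) = integral {a..b} (?f \<zeta>)"
      by (rule integral_spike[of "{b}"]) (use held in auto)
    finally show ?thesis .
  qed
  \<comment> \<open>The nonnegativity covers completed holding intervals only, up to the last
    refresh. The first conjunct records that the sample has been constant since then, so that the
    current interval can be closed at the next refresh or at T.\<close>
  have inv: "(\<forall>t\<in>{s (\<sigma> k)..<s (Suc k)}. \<zeta> t = z (s (\<sigma> k))) \<and> 0 \<le> integral {0..s (\<sigma> k)} (?f \<zeta>)" for k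
  proof (induction k)
    case 0
    then show ?case using \<zeta>[of 0] by (auto simp: \<sigma>(1) s0)
  next
    case (Suc k)
    show ?case
    proof (cases "\<sigma> (Suc k) = \<sigma> k")
      case True
      have "\<zeta> t = z (s (\<sigma> k))" if "t \<in> {s (\<sigma> k)..<s (Suc (Suc k))}" for t
        using Suc that \<zeta>[of "Suc k" t] True by (cases "t < s (Suc k)") auto
      then show ?thesis using Suc True by simp
    next
      case False
      then have k: "\<sigma> (Suc k) = Suc k" using \<sigma>(2)[of k] by auto
      have le: "s (\<sigma> k) \<le> s (Suc k)" using \<sigma>_le[of k] by (intro s_le) auto
      have "0 \<le> integral {s (\<sigma> k)..s (Suc k)} (?f \<zeta>)"
        using Suc by (intro window s_nonneg le \<tau>) auto
      then have "0 \<le> integral {0..s (Suc k)} (?f \<zeta>)"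
        using Henstock_Kurzweil_Integration.integral_combine[OF s_nonneg le int[OF order_refl]] Suc by simp
      then show ?thesis using \<zeta>[of "Suc k"] k by simp
    qed
  qed
  \<comment> \<open>The last holding interval may be cut off by T; \<open>window\<close> only asks
    for a length of at most \<tau>.\<close>
  define k where "k = step_index s T"
  have k: "s k \<le> T" "T < s (Suc k)" unfolding k_def by (rule step_index_bounds[OF T])+
  have le: "s (\<sigma> k) \<le> T" using s_le[OF \<sigma>_le[of k]] k by simp
  have "0 \<le> integral {s (\<sigma> k)..T} (?f \<zeta>)"
    using inv[of k] \<tau>[of k] k le by (intro window s_nonneg) auto
  then have "0 \<le> integral {0..T} (?f \<zeta>)"
    using Henstock_Kurzweil_Integration.integral_combine[OF s_nonneg le int[OF order_refl]] inv[of k] by simp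
  then show ?thesis using int[of 0 T] by (blast intro: integrable_integral)
qed

end

section \<open>Iterated cyclic shifts of the list of neighbours\<close>

lemma set_shift_perm [simp]: "set (shift_perm xs) = set xs"
  by (cases xs rule: rev_cases) (auto simp: shift_perm_def)

lemma length_shift_perm [simp]: "length (shift_perm xs) = length xs"
  by (cases xs rule: rev_cases) (auto simp: shift_perm_def)

lemma distinct_shift_perm [simp]: "distinct (shift_perm xs) = distinct xs"
  by (cases xs rule: rev_cases) (auto simp: shift_perm_def)

lemma set_shift_perm_funpow [simp]: "set ((shift_perm ^^ k) xs) = set xs"
  by (induction k) auto

lemma length_shift_perm_funpow [simp]: "length ((shift_perm ^^ k) xs) = length xs"
  by (induction k) auto

lemma distinct_shift_perm_funpow [simp]: "distinct ((shift_perm ^^ k) xs) = distinct xs"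
  by (induction k) auto

text \<open>Positions are counted from 0 here, whereas \<open>rr_pos\<close> adds 1.\<close>

lemma position_shift_perm:
  assumes "distinct xs" "x \<in> set xs"
  shows "length (takeWhile (\<lambda>y. y \<noteq> x) (shift_perm xs)) =
    (if Suc (length (takeWhile (\<lambda>y. y \<noteq> x) xs)) = length xs then 0
     else Suc (length (takeWhile (\<lambda>y. y \<noteq> x) xs)))"
  using assms
proof (cases xs rule: rev_cases)
  case (snoc ys y)
  show ?thesis
  proof (cases "x = y")
    case True
    then have "takeWhile (\<lambda>y. y \<noteq> x) xs = ys" using snoc assms by (subst snoc, subst takeWhile_append2) auto
    then show ?thesis using snoc True by (simp add: shift_perm_def)
  next
    case False
    then have x: "x \<in> set ys" using assms snoc by auto
    then have "takeWhile (\<lambda>y. y \<noteq> x) xs = takeWhile (\<lambda>y. y \<noteq> x) ys"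
      using snoc by (subst snoc, subst takeWhile_append1) auto
    moreover have "length (takeWhile (\<lambda>y. y \<noteq> x) ys) < length ys"
      using x by (induction ys) auto
    ultimately show ?thesis using snoc False by (simp add: shift_perm_def)
  qed
qed simp

lemma sum_position:
  assumes "distinct xs"
  shows "(\<Sum>x\<in>set xs. f (length (takeWhile (\<lambda>y. y \<noteq> x) xs))) = (\<Sum>m<length xs. f m)"
proof -
  have *: "length (takeWhile (\<lambda>y. y \<noteq> xs ! m) xs) = m" if "m < length xs" for m
  proof -
    have "takeWhile (\<lambda>y. y \<noteq> xs ! m) xs = take m xs"
      using that assms by (intro takeWhile_eq_take_P_nth) (auto simp: nth_eq_iff_index_eq)
    then show ?thesis using that by simp
  qed
  have "bij_betw (nth xs) {..<length xs} (set xs)"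
    using assms by (intro bij_betw_nth) auto
  then have "(\<Sum>x\<in>set xs. f (length (takeWhile (\<lambda>y. y \<noteq> x) xs)))
      = (\<Sum>m<length xs. f (length (takeWhile (\<lambda>y. y \<noteq> xs ! m) xs)))"
    by (rule sum.reindex_bij_betw[symmetric])
  then show ?thesis using * by simp
qed

section \<open>Quadratic forms of block matrices\<close>

lemma sum_lessThan_mult:
  fixes h :: "nat \<Rightarrow> nat \<Rightarrow> 'a :: comm_monoid_add"
  shows "(\<Sum>a<k * n. h (a div n) (a mod n)) = (\<Sum>\<mu><k. \<Sum>c<n. h \<mu> c)"
proof (induction k)
  case (Suc k)
  have "(\<Sum>a<Suc k * n. h (a div n) (a mod n)) = (\<Sum>a<k * n + n. h (a div n) (a mod n))"
    by (simp add: add.commute)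
  also have "\<dots> = (\<Sum>\<mu><k. \<Sum>c<n. h \<mu> c) + (\<Sum>c<n. h k c)"
    unfolding sum_lessThan_add Suc by (intro arg_cong2[of _ _ _ _ "(+)"] refl sum.cong) auto
  finally show ?case by simp
qed simp

definition stack :: "nat \<Rightarrow> nat \<Rightarrow> (nat \<Rightarrow> real vec) \<Rightarrow> real vec" where
  "stack n p f = vec (p * n) (\<lambda>a. f (a div n) $ (a mod n))"

text \<open>The dimension is an argument because p may be 0, and the empty sum still has to be a
  vector of length n.\<close>

definition vsum :: "nat \<Rightarrow> nat \<Rightarrow> (nat \<Rightarrow> real vec) \<Rightarrow> real vec" where
  "vsum n p f = vec n (\<lambda>c. \<Sum>\<mu><p. f \<mu> $ c)"

lemma stack_carrier [simp]: "stack n p f \<in> carrier_vec (p * n)" "dim_vec (stack n p f) = p * n"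
  by (auto simp: stack_def)

lemma vsum_carrier [simp]: "vsum n p f \<in> carrier_vec n" "dim_vec (vsum n p f) = n"
  by (auto simp: vsum_def)

lemma stack_Suc:
  assumes "f 0 \<in> carrier_vec n"
  shows "stack n (Suc p) f = f 0 @\<^sub>v stack n p (\<lambda>\<mu>. f (Suc \<mu>))"
proof (cases "n = 0")
  case False
  then show ?thesis
    using assms by (intro eq_vecI) (auto simp: stack_def le_div_geq le_mod_geq not_less)
qed (use assms in \<open>auto simp: stack_def\<close>)

lemma stack_snoc:
  assumes "f p \<in> carrier_vec n"
  shows "stack n (Suc p) f = stack n p f @\<^sub>v f p"
proof (intro eq_vecI)
  fix a assume "a < dim_vec (stack n p f @\<^sub>v f p)"
  then have a: "a < p * n + n" using assms by simp
  show "stack n (Suc p) f $ a = (stack n p f @\<^sub>v f p) $ a"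
  proof (cases "a < p * n")
    case False
    define c where "c = a - p * n"
    have "a = c + p * n" "c < n" using False a by (auto simp: c_def)
    then show ?thesis using assms by (simp add: stack_def)
  qed (use assms a in \<open>auto simp: stack_def\<close>)
qed (use assms in auto)

lemma bform_blocks:
  assumes "\<And>\<mu> \<nu>. \<mu> < k \<Longrightarrow> \<nu> < l \<Longrightarrow> f \<mu> \<nu> \<in> carrier_mat n n"
  shows "bform (blocks n k l f) (stack n k u) (stack n l v) = (\<Sum>\<mu><k. \<Sum>\<nu><l. bform (f \<mu> \<nu>) (u \<mu>) (v \<nu>))"
proof -
  have "bform (blocks n k l f) (stack n k u) (stack n l v) =
    (\<Sum>a<k*n. \<Sum>b<l*n. f (a div n) (b div n) $$ (a mod n, b mod n) * u (a div n) $ (a mod n) * v (b div n) $ (b mod n))"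
    by (simp add: bform_def blocks_def stack_def)
  also have "\<dots> = (\<Sum>\<mu><k. \<Sum>c<n. \<Sum>\<nu><l. \<Sum>c'<n. f \<mu> \<nu> $$ (c, c') * u \<mu> $ c * v \<nu> $ c')"
    unfolding sum_lessThan_mult[of "\<lambda>\<nu> c'. f _ \<nu> $$ (_, c') * _ * v \<nu> $ c'"]
    by (rule sum_lessThan_mult)
  also have "\<dots> = (\<Sum>\<mu><k. \<Sum>\<nu><l. \<Sum>c<n. \<Sum>c'<n. f \<mu> \<nu> $$ (c, c') * u \<mu> $ c * v \<nu> $ c')"
    by (intro sum.cong refl sum.swap)
  also have "\<dots> = (\<Sum>\<mu><k. \<Sum>\<nu><l. bform (f \<mu> \<nu>) (u \<mu>) (v \<nu>))"
  proof (intro sum.cong refl)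
    fix \<mu> \<nu> assume "\<mu> \<in> {..<k}" "\<nu> \<in> {..<l}"
    then have "f \<mu> \<nu> \<in> carrier_mat n n" using assms by simp
    then show "(\<Sum>c<n. \<Sum>c'<n. f \<mu> \<nu> $$ (c, c') * u \<mu> $ c * v \<nu> $ c') = bform (f \<mu> \<nu>) (u \<mu>) (v \<nu>)"
      by (simp add: bform_def)
  qed
  finally show ?thesis .
qed

lemma bform_vsum_right:
  assumes "M \<in> carrier_mat k n"
  shows "bform M u (vsum n p f) = (\<Sum>\<mu><p. bform M u (f \<mu>))"
proof -
  have "bform M u (vsum n p f) = (\<Sum>a<k. \<Sum>b<n. \<Sum>\<mu><p. M $$ (a, b) * u $ a * f \<mu> $ b)"
    using assms by (simp add: bform_def vsum_def sum_distrib_left)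
  also have "\<dots> = (\<Sum>a<k. \<Sum>\<mu><p. \<Sum>b<n. M $$ (a, b) * u $ a * f \<mu> $ b)"
    by (intro sum.cong refl sum.swap)
  also have "\<dots> = (\<Sum>\<mu><p. bform M u (f \<mu>))" using assms unfolding bform_def by (subst sum.swap) simp
  finally show ?thesis .
qed

lemma bform_vsum_left:
  assumes "M \<in> carrier_mat n k"
  shows "bform M (vsum n p f) u = (\<Sum>\<mu><p. bform M (f \<mu>) u)"
  using bform_vsum_right[of "M\<^sup>T" k n u p f] assms by (simp add: bform_transpose)

text \<open>A Kronecker product with ones repeats \<open>M\<close> in every block, so only the sum
  of the stacked vectors matters.\<close>

lemma bform_kron_row:
  assumes M: "M \<in> carrier_mat n n" and u: "u \<in> carrier_vec n"
  shows "bform (kron (ones p)\<^sup>T M) u (stack n p v) = bform M u (vsum n p v)"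
proof -
  have "kron (ones p)\<^sup>T M = blocks n 1 p (\<lambda>_ _. M)"
    using M by (intro eq_matI) (auto simp: kron_def ones_def blocks_def less_mult_imp_div_less)
  moreover have "u = stack n 1 (\<lambda>_. u)" using u by (intro eq_vecI) (auto simp: stack_def)
  ultimately have "bform (kron (ones p)\<^sup>T M) u (stack n p v) = (\<Sum>\<mu><1::nat. \<Sum>\<nu><p. bform M u (v \<nu>))"
    using bform_blocks[of 1 p "\<lambda>_ _. M" n "\<lambda>_. u" v] M by simp
  then show ?thesis by (simp add: bform_vsum_right[OF M])
qed

lemma bform_kron_square:
  assumes M: "M \<in> carrier_mat n n"
  shows "bform (kron (ones p * (ones p)\<^sup>T) M) (stack n p u) (stack n p v) = bform M (vsum n p u) (vsum n p v)"
proof -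
  have "kron (ones p * (ones p)\<^sup>T) M = blocks n p p (\<lambda>_ _. M)"
    using M by (intro eq_matI)
      (auto simp: kron_def ones_def blocks_def less_mult_imp_div_less scalar_prod_def)
  then have "bform (kron (ones p * (ones p)\<^sup>T) M) (stack n p u) (stack n p v)
      = (\<Sum>\<mu><p. \<Sum>\<nu><p. bform M (u \<mu>) (v \<nu>))"
    using bform_blocks[of p p "\<lambda>_ _. M" n u v] M by simp
  then show ?thesis by (simp add: bform_vsum_right[OF M] bform_vsum_left[OF M])
      (rule sum.swap)
qed

lemma bform_kron_column:
  assumes M: "M \<in> carrier_mat n m"
  shows "bform (kron (ones p) M) (stack n p u) v = bform M (vsum n p u) v"
proof -
  have "bform (kron (ones p) M) (stack n p u) v
      = (\<Sum>a<p*n. \<Sum>b<m. M $$ (a mod n, b) * u (a div n) $ (a mod n) * v $ b)"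
    using M by (simp add: bform_def kron_def ones_def stack_def less_mult_imp_div_less)
  also have "\<dots> = (\<Sum>\<mu><p. \<Sum>c<n. \<Sum>b<m. M $$ (c, b) * u \<mu> $ c * v $ b)"
    by (rule sum_lessThan_mult)
  also have "\<dots> = (\<Sum>\<mu><p. bform M (u \<mu>) v)" using M by (simp add: bform_def)
  finally show ?thesis by (simp add: bform_vsum_left[OF M])
qed

lemma bform_block_diag:
  assumes "\<And>\<mu>. \<mu> < length js \<Longrightarrow> f (js ! \<mu>) \<in> carrier_mat n n"
  shows "bform (block_diag n js f) (stack n (length js) u) (stack n (length js) v)
    = (\<Sum>\<mu><length js. bform (f (js ! \<mu>)) (u \<mu>) (v \<mu>))"
proof -
  have "bform (block_diag n js f) (stack n (length js) u) (stack n (length js) v)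
    = (\<Sum>\<mu><length js. \<Sum>\<nu><length js. bform (if \<mu> = \<nu> then f (js ! \<mu>) else 0\<^sub>m n n) (u \<mu>) (v \<nu>))"
    unfolding block_diag_def using assms by (intro bform_blocks) auto
  also have "\<dots> = (\<Sum>\<mu><length js. \<Sum>\<nu><length js. if \<mu> = \<nu> then bform (f (js ! \<mu>)) (u \<mu>) (v \<nu>) else 0)"
    by (intro sum.cong refl) (auto simp: bform_def)
  finally show ?thesis by simp
qed

lemma bform_hcats_Cons:
  assumes "M \<in> carrier_mat r c" "hcats r Ms \<in> carrier_mat r c'"
    and "u \<in> carrier_vec r" "v \<in> carrier_vec c" "v' \<in> carrier_vec c'"
  shows "bform (hcats r (M # Ms)) u (v @\<^sub>v v') = bform M u v + bform (hcats r Ms) u v'"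
proof -
  have "u @\<^sub>v vNil = u" by (intro eq_vecI) auto
  then show ?thesis
    using bform_four_block[OF assms(1,2), of "0\<^sub>m 0 c" 0 "0\<^sub>m 0 c'" u v vNil v'] assms
    by (simp add: hcats_def hcat_def bform_def)
qed

lemma hcats_carrier:
  assumes "list_all2 (\<lambda>M c. M \<in> carrier_mat r c) Ms cs"
  shows "hcats r Ms \<in> carrier_mat r (sum_list cs)"
  using assms
proof (induction rule: list_all2_induct)
  case (Cons M Ms c cs)
  then show ?case unfolding hcats_def hcat_def by (intro carrier_matI) auto
qed (simp add: hcats_def)

lemma bform_hcats:
  assumes "list_all2 (\<lambda>M c. M \<in> carrier_mat r c) Ms cs" "list_all2 (\<lambda>v c. v \<in> carrier_vec c) vs cs"
    and u: "u \<in> carrier_vec r"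
  shows "bform (hcats r Ms) u (foldr (@\<^sub>v) vs vNil) = (\<Sum>(M, v)\<leftarrow>zip Ms vs. bform M u v)
    \<and> foldr (@\<^sub>v) vs vNil \<in> carrier_vec (sum_list cs)"
  using assms(1,2)
proof (induction arbitrary: vs rule: list_all2_induct)
  case Nil
  then show ?case by (simp add: hcats_def bform_def)
next
  case (Cons M Ms c cs)
  then obtain v vs' where vs: "vs = v # vs'" "v \<in> carrier_vec c" "list_all2 (\<lambda>v c. v \<in> carrier_vec c) vs' cs"
    by (auto simp: list_all2_Cons2)
  show ?case
    using Cons.IH[OF vs(3)] Cons.hyps hcats_carrier[OF Cons.hyps(2)] vs(1,2) u
    by (auto simp: bform_hcats_Cons[of M r c Ms "sum_list cs"])
qed

text \<open>Only the upper triangle is listed; a block above the diagonal and its transpose below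
  have the same value, hence the factor 2.\<close>

fun sym_form :: "real mat list list \<Rightarrow> real vec list \<Rightarrow> real" where
  "sym_form ((M # Ms) # rs) (u # vs) = bform M u u + 2 * (\<Sum>(Q, v)\<leftarrow>zip Ms vs. bform Q u v) + sym_form rs vs"
| "sym_form _ _ = 0"

fun sym_dims :: "real mat list list \<Rightarrow> nat list \<Rightarrow> bool" where
  "sym_dims ((M # Ms) # rs) (c # cs) \<longleftrightarrow>
     M \<in> carrier_mat c c \<and> list_all2 (\<lambda>Q c'. Q \<in> carrier_mat c c') Ms cs \<and> sym_dims rs cs"
| "sym_dims rs cs \<longleftrightarrow> rs = [] \<and> cs = []"

lemma bform_sym_block_mat:
  assumes "sym_dims rs cs" "list_all2 (\<lambda>v c. v \<in> carrier_vec c) vs cs"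
  shows "sym_block_mat rs \<in> carrier_mat (sum_list cs) (sum_list cs) \<and>
    bform (sym_block_mat rs) (foldr (@\<^sub>v) vs vNil) (foldr (@\<^sub>v) vs vNil) = sym_form rs vs"
  using assms
proof (induction rs cs arbitrary: vs rule: sym_dims.induct)
  case (1 M Ms rs c cs)
  then obtain u vs' where vs: "vs = u # vs'" "u \<in> carrier_vec c" "list_all2 (\<lambda>v c. v \<in> carrier_vec c) vs' cs"
    by (auto simp: list_all2_Cons2)
  have M: "M \<in> carrier_mat c c" and Ms: "list_all2 (\<lambda>Q c'. Q \<in> carrier_mat c c') Ms cs"
    and IH: "sym_block_mat rs \<in> carrier_mat (sum_list cs) (sum_list cs)"
      "bform (sym_block_mat rs) (foldr (@\<^sub>v) vs' vNil) (foldr (@\<^sub>v) vs' vNil) = sym_form rs vs'"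
    using 1 vs(3) by auto
  note row = bform_hcats[OF Ms vs(3,2)]
  have H: "hcats c Ms \<in> carrier_mat c (sum_list cs)" using hcats_carrier[OF Ms] .
  have "bform (four_block_mat M (hcats c Ms) (hcats c Ms)\<^sup>T (sym_block_mat rs))
      (u @\<^sub>v foldr (@\<^sub>v) vs' vNil) (u @\<^sub>v foldr (@\<^sub>v) vs' vNil) = sym_form ((M # Ms) # rs) (u # vs')"
    using row H IH
    by (subst bform_four_block[OF M H _ IH(1) vs(2) vs(2)]) (auto simp: bform_transpose)
  then show ?case using M H IH vs by (auto simp: Let_def)
qed (auto simp: bform_def)

text \<open>Symmetry of \<open>M\<close> turns the lower blocks, which do not occur in the matrix
  inequality, into transposes of the upper ones.\<close>

lemma bform_part_block3:
  assumes M: "M \<in> carrier_mat (n1 + (n2 + n3)) (n1 + (n2 + n3))" and sym: "M\<^sup>T = M"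
    and "x1 \<in> carrier_vec n1" "x2 \<in> carrier_vec n2" "x3 \<in> carrier_vec n3"
  shows "bform M (x1 @\<^sub>v x2 @\<^sub>v x3) (x1 @\<^sub>v x2 @\<^sub>v x3) =
     (let Q = part_block [n1, n2, n3] M in
     bform (Q 1 1) x1 x1 + 2 * bform (Q 1 2) x1 x2 + 2 * bform (Q 1 3) x1 x3
     + bform (Q 2 2) x2 x2 + 2 * bform (Q 2 3) x2 x3 + bform (Q 3 3) x3 x3)"
proof -
  let ?Q = "part_block [n1, n2, n3] M"
  have Q: "?Q 1 1 = mat n1 n1 (\<lambda>(a, b). M $$ (a, b))" "?Q 1 2 = mat n1 n2 (\<lambda>(a, b). M $$ (a, n1 + b))"
    "?Q 1 3 = mat n1 n3 (\<lambda>(a, b). M $$ (a, n1 + (n2 + b)))" "?Q 2 1 = mat n2 n1 (\<lambda>(a, b). M $$ (n1 + a, b))"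
    "?Q 2 2 = mat n2 n2 (\<lambda>(a, b). M $$ (n1 + a, n1 + b))"
    "?Q 2 3 = mat n2 n3 (\<lambda>(a, b). M $$ (n1 + a, n1 + (n2 + b)))"
    "?Q 3 1 = mat n3 n1 (\<lambda>(a, b). M $$ (n1 + (n2 + a), b))"
    "?Q 3 2 = mat n3 n2 (\<lambda>(a, b). M $$ (n1 + (n2 + a), n1 + b))"
    "?Q 3 3 = mat n3 n3 (\<lambda>(a, b). M $$ (n1 + (n2 + a), n1 + (n2 + b)))"
    by (simp_all add: part_block_def numeral_nat add.assoc)
  have symM: "M $$ (a, b) = M $$ (b, a)" if "a < n1 + (n2 + n3)" "b < n1 + (n2 + n3)" for a b
    using sym M that by (metis carrier_matD index_transpose_mat(1))
  have t: "?Q 2 1 = (?Q 1 2)\<^sup>T" "?Q 3 1 = (?Q 1 3)\<^sup>T" "?Q 3 2 = (?Q 2 3)\<^sup>T"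
    unfolding Q by (auto intro!: eq_matI simp: symM)
  have "bform M (x1 @\<^sub>v x2 @\<^sub>v x3) (x1 @\<^sub>v x2 @\<^sub>v x3) =
     bform (?Q 1 1) x1 x1 + (bform (?Q 1 2) x1 x2 + bform (?Q 1 3) x1 x3)
     + (bform (?Q 2 1) x2 x1 + bform (?Q 3 1) x3 x1)
     + (bform (?Q 2 2) x2 x2 + bform (?Q 2 3) x2 x3 + bform (?Q 3 2) x3 x2 + bform (?Q 3 3) x3 x3)"
    unfolding Q bform_def using assms by (simp add: sum_lessThan_add sum.distrib)
  then show ?thesis unfolding t bform_transpose by (simp add: Let_def)
qed

lemma T_mat_mult_stack:
  assumes H: "\<And>\<mu>. \<mu> < p + 2 \<Longrightarrow> H \<mu> \<in> carrier_vec n"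
  shows "T_mat n p *\<^sub>v stack n (p + 2) H = stack n (p + 1) (\<lambda>\<mu>. H \<mu> - H (Suc \<mu>))"
proof (rule eq_vecI)
  fix a assume "a < dim_vec (stack n (p + 1) (\<lambda>\<mu>. H \<mu> - H (Suc \<mu>)))"
  then have a: "a < (p + 1) * n" by simp
  then have n: "0 < n" by (cases n) auto
  have \<mu>: "a div n < p + 1" using a by (simp add: less_mult_imp_div_less)
  have c: "a mod n < n" using n by simp
  let ?f = "\<lambda>\<nu>. if \<nu> = a div n then 1\<^sub>m n else if \<nu> = a div n + 1 then - 1\<^sub>m n else (0\<^sub>m n n :: real mat)"
  have "(T_mat n p *\<^sub>v stack n (p + 2) H) $ a
      = (\<Sum>b<(p + 2) * n. ?f (b div n) $$ (a mod n, b mod n) * H (b div n) $ (b mod n))"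
    using a by (simp add: T_mat_def blocks_def stack_def scalar_prod_def lessThan_atLeast0)
  also have "\<dots> = (\<Sum>\<nu><p + 2. \<Sum>c'<n. ?f \<nu> $$ (a mod n, c') * H \<nu> $ c')"
    by (rule sum_lessThan_mult)
  also have "\<dots> = (\<Sum>\<nu><p + 2. (if \<nu> = a div n then H \<nu> $ (a mod n) else 0) -
      (if \<nu> = a div n + 1 then H \<nu> $ (a mod n) else 0))"
  proof (intro sum.cong refl)
    fix \<nu>
    have "(\<Sum>c'<n. (1\<^sub>m n :: real mat) $$ (a mod n, c') * H \<nu> $ c') = (\<Sum>c'<n. if c' = a mod n then H \<nu> $ c' else 0)"
      using c by (intro sum.cong refl) auto
    then have 1: "(\<Sum>c'<n. (1\<^sub>m n :: real mat) $$ (a mod n, c') * H \<nu> $ c') = H \<nu> $ (a mod n)"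
      using c by simp
    have 2: "(\<Sum>c'<n. (- 1\<^sub>m n :: real mat) $$ (a mod n, c') * H \<nu> $ c') = - H \<nu> $ (a mod n)"
      using c unfolding 1[symmetric] sum_negf[symmetric] by (intro sum.cong refl) auto
    show "(\<Sum>c'<n. ?f \<nu> $$ (a mod n, c') * H \<nu> $ c') = (if \<nu> = a div n then H \<nu> $ (a mod n) else 0) -
      (if \<nu> = a div n + 1 then H \<nu> $ (a mod n) else 0)"
      using 1 2 c by auto
  qed
  also have "\<dots> = H (a div n) $ (a mod n) - H (Suc (a div n)) $ (a mod n)"
    using \<mu> by (simp add: sum_subtractf)
  also have "\<dots> = stack n (p + 1) (\<lambda>\<mu>. H \<mu> - H (Suc \<mu>)) $ a"
    using a \<mu> c H[of "Suc (a div n)"] by (simp add: stack_def)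
  finally show "(T_mat n p *\<^sub>v stack n (p + 2) H) $ a = stack n (p + 1) (\<lambda>\<mu>. H \<mu> - H (Suc \<mu>)) $ a" .
qed (simp add: T_mat_def blocks_def)

lemma bform_congruence:
  assumes T: "T \<in> carrier_mat k l" and M: "M \<in> carrier_mat k k" and x: "x \<in> carrier_vec l"
  shows "bform (T\<^sup>T * M * T) x x = bform M (T *\<^sub>v x) (T *\<^sub>v x)"
proof -
  have Tx: "T *\<^sub>v x \<in> carrier_vec k" using T x by auto
  have "bform (T\<^sup>T * M * T) x x = x \<bullet> (T\<^sup>T * M * T *\<^sub>v x)"
    using T M x by (intro scalar_mult_mat_vec[symmetric]) auto
  also have "T\<^sup>T * M * T *\<^sub>v x = T\<^sup>T *\<^sub>v (M *\<^sub>v (T *\<^sub>v x))"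
    using T M x Tx by (simp add: assoc_mult_mat_vec[of _ l k _ k] assoc_mult_mat_vec[of _ l k _ l]
        assoc_mult_mat_vec[of "T\<^sup>T * M" l k T l])
  also have "x \<bullet> \<dots> = (T\<^sup>T *\<^sub>v (M *\<^sub>v (T *\<^sub>v x))) \<bullet> x"
    using T M x by (intro comm_scalar_prod[of _ l]) auto
  also have "\<dots> = (M *\<^sub>v (T *\<^sub>v x)) \<bullet> (T *\<^sub>v x)"
    using T M x Tx by (intro transpose_vec_mult_scalar) auto
  also have "\<dots> = (T *\<^sub>v x) \<bullet> (M *\<^sub>v (T *\<^sub>v x))"
    using T M x Tx by (intro comm_scalar_prod[of _ k]) auto
  also have "\<dots> = bform M (T *\<^sub>v x) (T *\<^sub>v x)"
    using M Tx by (intro scalar_mult_mat_vec) auto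
  finally show ?thesis .
qed

lemma Psi_mat_carrier: "Psi_mat n p R G \<in> carrier_mat ((p + 1) * n) ((p + 1) * n)"
  by (simp add: Psi_mat_def blocks_def)

lemma T_mat_carrier: "T_mat n p \<in> carrier_mat ((p + 1) * n) ((p + 2) * n)"
  by (simp add: T_mat_def blocks_def)

lemma Psi_mat_symmetric:
  assumes "R \<in> carrier_mat n n" "R\<^sup>T = R" "G \<in> carrier_mat n n"
  shows "(Psi_mat n p R G)\<^sup>T = Psi_mat n p R G"
proof (intro eq_matI)
  fix a b assume "a < dim_row (Psi_mat n p R G)" "b < dim_col (Psi_mat n p R G)"
  then have ab: "a < (p + 1) * n" "b < (p + 1) * n" using Psi_mat_carrier[of n p R G] by auto
  then have n: "0 < n" by (cases n) auto
  have "R $$ (b mod n, a mod n) = R $$ (a mod n, b mod n)"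
    using assms n by (metis carrier_matD index_transpose_mat(1) mod_less_divisor)
  then show "(Psi_mat n p R G)\<^sup>T $$ (a, b) = Psi_mat n p R G $$ (a, b)"
    using ab n assms by (auto simp: Psi_mat_def blocks_def)
qed (simp_all add: Psi_mat_def blocks_def)

text \<open>The partition into n, p n and n matches the roles of the vectors: \<open>H 0\<close> is
  the current state, the next p are its samples, and the last one is the state delayed by
  \<tau>.\<close>

lemma bform_Psi_bar:
  assumes R: "R \<in> carrier_mat n n" "R\<^sup>T = R" and G: "G \<in> carrier_mat n n"
    and H: "\<And>\<mu>. \<mu> < p + 2 \<Longrightarrow> H \<mu> \<in> carrier_vec n"
  shows "(let Q = Psi_bar n p \<tau> \<alpha> R G; x1 = H 0; x2 = stack n p (\<lambda>\<mu>. H (Suc \<mu>)); x3 = H (Suc p) in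
     bform (Q 1 1) x1 x1 + 2 * bform (Q 1 2) x1 x2 + 2 * bform (Q 1 3) x1 x3
     + bform (Q 2 2) x2 x2 + 2 * bform (Q 2 3) x2 x3 + bform (Q 3 3) x3 x3)
    = exp (- 2 * \<alpha> * \<tau>) * coupled_form R G (p + 1) H"
proof -
  let ?T = "T_mat n p" and ?P = "Psi_mat n p R G"
  let ?M = "exp (- 2 * \<alpha> * \<tau>) \<cdot>\<^sub>m (?T\<^sup>T * ?P * ?T)"
  note T = T_mat_carrier[of n p] and P = Psi_mat_carrier[of n p R G]
  have M: "?M \<in> carrier_mat ((p + 2) * n) ((p + 2) * n)" using T P by auto
  have symM: "?M\<^sup>T = ?M"
  proof -
    have "(?T\<^sup>T * ?P * ?T)\<^sup>T = ?T\<^sup>T * (?T\<^sup>T * ?P)\<^sup>T"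
      using T P by (intro transpose_mult) auto
    also have "(?T\<^sup>T * ?P)\<^sup>T = ?P\<^sup>T * ?T" using T P by (subst transpose_mult) auto
    also have "?T\<^sup>T * (?P\<^sup>T * ?T) = ?T\<^sup>T * ?P * ?T"
      unfolding Psi_mat_symmetric[OF R G] using T P by (intro assoc_mult_mat[symmetric]) auto
    finally have eq: "(?T\<^sup>T * ?P * ?T)\<^sup>T = ?T\<^sup>T * ?P * ?T" .
    have "?M\<^sup>T = exp (- 2 * \<alpha> * \<tau>) \<cdot>\<^sub>m (?T\<^sup>T * ?P * ?T)\<^sup>T" by (intro eq_matI) auto
    then show ?thesis unfolding eq .
  qed
  have st: "stack n (p + 2) H = H 0 @\<^sub>v stack n p (\<lambda>\<mu>. H (Suc \<mu>)) @\<^sub>v H (Suc p)"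
    using stack_Suc[of H n "Suc p"] stack_snoc[of "\<lambda>\<mu>. H (Suc \<mu>)" p n] H by simp
  have dim: "(p + 2) * n = n + (p * n + n)" by simp
  have "bform ?M (stack n (p + 2) H) (stack n (p + 2) H) = exp (- 2 * \<alpha> * \<tau>) *
     bform ?P (stack n (p + 1) (\<lambda>\<mu>. H \<mu> - H (Suc \<mu>))) (stack n (p + 1) (\<lambda>\<mu>. H \<mu> - H (Suc \<mu>)))"
    using T_mat_mult_stack[of p H n] H
    by (simp only: bform_smult_mat bform_congruence[OF T P stack_carrier(1)])
  also have "bform ?P (stack n (p + 1) (\<lambda>\<mu>. H \<mu> - H (Suc \<mu>))) (stack n (p + 1) (\<lambda>\<mu>. H \<mu> - H (Suc \<mu>)))
     = coupled_form R G (p + 1) H"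
    unfolding Psi_mat_def coupled_form_def using R G by (intro bform_blocks) auto
  finally show ?thesis
    using bform_part_block3[of ?M n "p * n" n, OF _ symM, of "H 0" "stack n p (\<lambda>\<mu>. H (Suc \<mu>))" "H (Suc p)"]
      M H[of 0] H[of "Suc p"]
    unfolding Psi_bar_def Let_def st dim by simp
qed

section \<open>Inverses and coercivity of positive definite matrices\<close>

lemma minv_inverts:
  assumes "M \<in> carrier_mat n n" "det M \<noteq> 0"
  shows "minv M \<in> carrier_mat n n" "M * minv M = 1\<^sub>m n" "minv M * M = 1\<^sub>m n"
proof -
  have "mat_inverse M \<noteq> None"
    using mat_inverse(1)[OF assms(1), of "()"] det_non_zero_imp_unit[OF assms, of "()"] by blast
  then obtain Q where "mat_inverse M = Some Q" by blast
  then show "minv M \<in> carrier_mat n n" "M * minv M = 1\<^sub>m n" "minv M * M = 1\<^sub>m n"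
    using mat_inverse(2)[OF assms(1)] by (auto simp: minv_def)
qed

lemma pos_def_det:
  assumes "M \<in> carrier_mat n n" "pos_def M" shows "det M \<noteq> 0"
proof
  assume "det M = 0"
  then obtain v where v: "v \<in> carrier_vec n" "v \<noteq> 0\<^sub>v n" "M *\<^sub>v v = 0\<^sub>v n"
    using det_0_iff_vec_prod_zero[OF assms(1)] by auto
  have "v \<bullet> (M *\<^sub>v v) = 0" using v by simp
  moreover have "0 < v \<bullet> (M *\<^sub>v v)" using assms v unfolding pos_def_def by auto
  ultimately show False by simp
qed

text \<open>With \<open>u = minv M *\<^sub>v v\<close>, the form of the inverse at v is the form of
  \<open>M\<close> at u. Transposing \<open>M * minv M = 1\<^sub>m n\<close> shows that the
  transposed inverse is a left inverse, hence the inverse itself.\<close>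

lemma pos_def_minv:
  assumes M: "M \<in> carrier_mat n n" "pos_def M"
  shows "minv M \<in> carrier_mat n n" "pos_def (minv M)"
proof -
  note inv = minv_inverts[OF M(1) pos_def_det[OF M]]
  show c: "minv M \<in> carrier_mat n n" by (fact inv(1))
  have sym: "M\<^sup>T = M" using M(2) by (simp add: pos_def_def)
  have "(M * minv M)\<^sup>T = (minv M)\<^sup>T * M" using transpose_mult[OF M(1) c] sym by simp
  then have "(minv M)\<^sup>T * M = 1\<^sub>m n" using inv(2) by simp
  then have "(minv M)\<^sup>T * M * minv M = minv M" using c by simp
  then have symi: "(minv M)\<^sup>T = minv M"
    using assoc_mult_mat[of "(minv M)\<^sup>T" n n M n "minv M" n] M(1) c inv(2) by simp
  have "0 < v \<bullet> (minv M *\<^sub>v v)" if v: "v \<in> carrier_vec n" "v \<noteq> 0\<^sub>v n" for v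
  proof -
    define u where "u = minv M *\<^sub>v v"
    have u: "u \<in> carrier_vec n" using c v by (auto simp: u_def)
    have Mu: "M *\<^sub>v u = v"
      unfolding u_def using assoc_mult_mat_vec[OF M(1) c v(1)] inv(2) v by simp
    then have "u \<noteq> 0\<^sub>v n" using v M(1) by auto
    then have "0 < u \<bullet> (M *\<^sub>v u)" using M u unfolding pos_def_def by auto
    also have "\<dots> = v \<bullet> u" using Mu comm_scalar_prod[OF u v(1)] by simp
    finally show ?thesis by (simp add: u_def)
  qed
  then show "pos_def (minv M)" using c symi unfolding pos_def_def by auto
qed

lemma bform_cauchy_schwarz:
  assumes "M \<in> carrier_mat n n" "pos_semidef M" "u \<in> carrier_vec n" "v \<in> carrier_vec n"
  shows "(bform M u v)\<^sup>2 \<le> bform M u u * bform M v v"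
proof (rule square_le_mult_if_nonneg_quadratic)
  show "0 \<le> bform M u u" using assms by (intro bform_pos_semidef[of M n]) auto
  fix s :: real
  have "0 \<le> bform M (v - s \<cdot>\<^sub>v u) (v - s \<cdot>\<^sub>v u)"
    using assms by (intro bform_pos_semidef[of M n]) auto
  also have "\<dots> = bform M v v - 2 * s * bform M v u + s\<^sup>2 * bform M u u"
    using assms by (intro bform_diff_smult_square) (auto simp: pos_semidef_def)
  finally show "0 \<le> s\<^sup>2 * bform M u u - 2 * s * bform M u v + bform M v v"
    using assms bform_symmetric[of M u v] by (simp add: pos_semidef_def)
qed

text \<open>
  Each coordinate \<open>v $ a\<close> is the value of the form at \<open>v\<close> and a solution \<open>u\<close> of \<open>M u = unit\<^sub>a\<close>, so
  the Cauchy-Schwarz inequality of the form replaces a compactness argument.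
\<close>

lemma pos_def_coercive:
  assumes M: "M \<in> carrier_mat n n" "pos_def M"
  shows "\<exists>\<kappa>>0. \<forall>v\<in>carrier_vec n. \<kappa> * (v \<bullet> v) \<le> bform M v v"
proof -
  have psd: "pos_semidef M" using pos_def_imp_pos_semidef[OF M(2,1)] .
  note inv = minv_inverts[OF M(1) pos_def_det[OF M]]
  define u where "u = (\<lambda>a. minv M *\<^sub>v unit_vec n a)"
  have u: "u a \<in> carrier_vec n" for a using inv(1) by (auto simp: u_def)
  have Mu: "M *\<^sub>v u a = unit_vec n a" for a
    unfolding u_def using assoc_mult_mat_vec[OF M(1) inv(1), of "unit_vec n a"] inv(2) by simp
  define C where "C = 1 + (\<Sum>a<n. bform M (u a) (u a))"
  have C: "0 < C" unfolding C_def
    using bform_pos_semidef[OF psd M(1) u] by (auto intro!: add_pos_nonneg sum_nonneg)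
  have "1 / C * (v \<bullet> v) \<le> bform M v v" if v: "v \<in> carrier_vec n" for v
  proof -
    have nonneg: "0 \<le> bform M v v" using bform_pos_semidef[OF psd M(1) v] .
    have "(v $ a)\<^sup>2 \<le> bform M (u a) (u a) * bform M v v" if "a < n" for a
    proof -
      have "v $ a = v \<bullet> unit_vec n a" using v that by simp
      also have "\<dots> = bform M v (u a)"
        using scalar_mult_mat_vec[of v M "u a"] M(1) u v by (simp add: Mu)
      finally show ?thesis using bform_cauchy_schwarz[OF M(1) psd v u[of a]] by (simp add: mult.commute)
    qed
    then have "(\<Sum>a<n. (v $ a)\<^sup>2) \<le> (\<Sum>a<n. bform M (u a) (u a) * bform M v v)"
      by (intro sum_mono) auto
    also have "\<dots> \<le> C * bform M v v"
      using nonneg by (simp add: C_def sum_distrib_right[symmetric] distrib_right)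
    finally have "v \<bullet> v \<le> C * bform M v v"
      using v by (simp add: scalar_prod_def power2_eq_square lessThan_atLeast0)
    then show ?thesis using C by (simp add: field_simps)
  qed
  then show ?thesis using C by (intro exI[of _ "1 / C"]) auto
qed

lemma bform_one: "u \<in> carrier_vec n \<Longrightarrow> v \<in> carrier_vec n \<Longrightarrow> bform (1\<^sub>m n) u v = u \<bullet> v"
  using scalar_mult_mat_vec[of u "1\<^sub>m n" v] by simp

lemma bform_zero_mat: "bform (0\<^sub>m k l) u v = 0"
  by (simp add: bform_def)

lemma Psi_bar_carrier:
  "Psi_bar n p \<tau> \<alpha> R G 1 1 \<in> carrier_mat n n" "Psi_bar n p \<tau> \<alpha> R G 1 2 \<in> carrier_mat n (p * n)"
  "Psi_bar n p \<tau> \<alpha> R G 1 3 \<in> carrier_mat n n" "Psi_bar n p \<tau> \<alpha> R G 2 2 \<in> carrier_mat (p * n) (p * n)"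
  "Psi_bar n p \<tau> \<alpha> R G 2 3 \<in> carrier_mat (p * n) n" "Psi_bar n p \<tau> \<alpha> R G 3 3 \<in> carrier_mat n n"
  by (simp_all add: Psi_bar_def part_block_def numeral_nat)

lemma kron_carrier:
  assumes "M \<in> carrier_mat k l" "Q \<in> carrier_mat k' l'"
  shows "kron M Q \<in> carrier_mat (k * k') (l * l')"
  using assms by (auto simp: kron_def)

lemma block_diag_carrier: "block_diag n js f \<in> carrier_mat (length js * n) (length js * n)"
  by (simp add: block_diag_def blocks_def)

text \<open>Block names follow rows and columns a to g of the matrix inequality. The vectors are, in
  this order, the derivative, the current error, its samples, the delayed error, the current errors
  of the neighbours, their held values, and the disturbance; \<open>k\<close> will be p n.\<close>

lemma bform_sym_block_mat7:
  assumes "aa \<in> carrier_mat n n" "ab \<in> carrier_mat n n" "ac \<in> carrier_mat n k"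
    "af \<in> carrier_mat n k" "ag \<in> carrier_mat n m"
    "bb \<in> carrier_mat n n" "bc \<in> carrier_mat n k" "bd \<in> carrier_mat n n" "be \<in> carrier_mat n k"
    "bf \<in> carrier_mat n k" "bg \<in> carrier_mat n m"
    "cc \<in> carrier_mat k k" "cd \<in> carrier_mat k n" "cf \<in> carrier_mat k k" "dd \<in> carrier_mat n n"
    "ee \<in> carrier_mat k k" "ef \<in> carrier_mat k k" "ff \<in> carrier_mat k k" "fg \<in> carrier_mat k m"
    "gg \<in> carrier_mat m m"
    and "d \<in> carrier_vec n" "e \<in> carrier_vec n" "E \<in> carrier_vec k" "t \<in> carrier_vec n"
    "g \<in> carrier_vec k" "Z \<in> carrier_vec k" "x \<in> carrier_vec m"
  defines "M \<equiv> sym_block_mat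
     [[aa, ab, ac, 0\<^sub>m n n, 0\<^sub>m n k, af, ag],
      [bb, bc, bd, be, bf, bg],
      [cc, cd, 0\<^sub>m k k, cf, 0\<^sub>m k m],
      [dd, 0\<^sub>m n k, 0\<^sub>m n k, 0\<^sub>m n m],
      [ee, ef, 0\<^sub>m k m],
      [ff, fg],
      [gg]]"
    and "\<phi> \<equiv> d @\<^sub>v e @\<^sub>v E @\<^sub>v t @\<^sub>v g @\<^sub>v Z @\<^sub>v x @\<^sub>v vNil"
  shows "M \<in> carrier_mat (dim_vec \<phi>) (dim_vec \<phi>) \<and> bform M \<phi> \<phi> =
    bform aa d d + 2 * (bform ab d e + bform ac d E + bform af d Z + bform ag d x)
    + bform bb e e + 2 * (bform bc e E + bform bd e t + bform be e g + bform bf e Z + bform bg e x)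
    + bform cc E E + 2 * (bform cd E t + bform cf E Z) + bform dd t t
    + bform ee g g + 2 * bform ef g Z + bform ff Z Z + 2 * bform fg Z x + bform gg x x"
  using bform_sym_block_mat[of
     "[[aa, ab, ac, 0\<^sub>m n n, 0\<^sub>m n k, af, ag], [bb, bc, bd, be, bf, bg], [cc, cd, 0\<^sub>m k k, cf, 0\<^sub>m k m],
      [dd, 0\<^sub>m n k, 0\<^sub>m n k, 0\<^sub>m n m], [ee, ef, 0\<^sub>m k m], [ff, fg], [gg]]"
     "[n, n, k, n, k, k, m]" "[d, e, E, t, g, Z, x]"] assms(1-27)
  unfolding M_def \<phi>_def
  by (simp add: bform_zero_mat del: sym_block_mat.simps)

lemma hcat_carrier:
  assumes "M \<in> carrier_mat r c" "Q \<in> carrier_mat r c'"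
  shows "hcat M Q \<in> carrier_mat r (c + c')"
  unfolding hcat_def using assms by (intro carrier_matI) auto

section \<open>The matrix inequality along the error dynamics\<close>

locale rr_observers =
  fixes net :: rr_network and \<gamma> :: real
    and Y X F U S R W G :: "nat \<Rightarrow> real mat"
    and \<alpha> \<pi> \<epsilon> \<epsilon>' :: "nat \<Rightarrow> real"
  assumes wf: "rr_network_wf net" and gamma_pos: "0 < \<gamma>"
    and Y: "\<And>i. i \<in> {1..num_nodes net} \<Longrightarrow> Y i \<in> carrier_mat (dim_x net) (dim_x net) \<and> pos_def (Y i)"
    and X: "\<And>i. i \<in> {1..num_nodes net} \<Longrightarrow> X i \<in> carrier_mat (dim_x net) (dim_x net) \<and> det (X i) \<noteq> 0"
    and F: "\<And>i. i \<in> {1..num_nodes net} \<Longrightarrow> F i \<in> carrier_mat (dim_x net) (dim_h net i)"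
    and U: "\<And>i. i \<in> {1..num_nodes net} \<Longrightarrow> U i \<in> carrier_mat (dim_x net) (dim_y net i)"
    and S: "\<And>i. i \<in> {1..num_nodes net} \<Longrightarrow> S i \<in> carrier_mat (dim_x net) (dim_x net) \<and> pos_semidef (S i)"
    and R: "\<And>i. i \<in> {1..num_nodes net} \<Longrightarrow> R i \<in> carrier_mat (dim_x net) (dim_x net) \<and> pos_semidef (R i)"
    and W: "\<And>i. i \<in> {1..num_nodes net} \<Longrightarrow> W i \<in> carrier_mat (dim_x net) (dim_x net) \<and> pos_semidef (W i)"
    and G: "\<And>i. i \<in> {1..num_nodes net} \<Longrightarrow> G i \<in> carrier_mat (dim_x net) (dim_x net)"
    and const_pos: "\<And>i. i \<in> {1..num_nodes net} \<Longrightarrow> 0 < \<alpha> i \<and> 0 < \<epsilon> i \<and> 0 < \<epsilon>' i"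
    and pi_bound: "\<And>i. i \<in> {1..num_nodes net} \<Longrightarrow>
           0 \<le> \<pi> i \<and> ereal (\<pi> i) < ereal (2 * \<alpha> i) * inverse (ereal (real (out_deg net i)))"
    and RG: "\<And>i. i \<in> {1..num_nodes net} \<Longrightarrow> pos_semidef (four_block_mat (R i) (G i) (G i)\<^sup>T (R i))"
    and Xi: "\<And>i. i \<in> {1..num_nodes net} \<Longrightarrow> neg_def (Xi_bar net \<gamma> \<alpha> \<pi> \<epsilon> \<epsilon>' Y X F U S R W G i)"
begin

abbreviation "n \<equiv> dim_x net"
abbreviation "nodes \<equiv> {1..num_nodes net}"
abbreviation "V \<equiv> nbrs net"
abbreviation "p \<equiv> in_deg net"
abbreviation "q \<equiv> out_deg net"
abbreviation "\<tau> \<equiv> delay net"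
abbreviation "FH i \<equiv> F i * obsH net i"
abbreviation "XAUC i \<equiv> (X i)\<^sup>T * plantA net - U i * outC net i"
abbreviation "XBUD i \<equiv> (X i)\<^sup>T * distB net - U i * distD net i"
abbreviation "Yi i \<equiv> minv (Y i)"
abbreviation "m \<equiv> dim_w net + dim_v net"

lemma arcs_nodes: "(j, i) \<in> parcs (graph net) \<Longrightarrow> j \<in> nodes \<and> i \<in> nodes"
proof -
  assume a: "(j, i) \<in> parcs (graph net)"
  interpret pair_loopfree_digraph "graph net" using wf by (simp add: rr_network_wf_def)
  show ?thesis using in_arcsD1[OF a] in_arcsD2[OF a] wf by (simp add: rr_network_wf_def)
qed

lemma nbrs_nodes: "V i \<subseteq> nodes"
  using arcs_nodes by (auto simp: nbrs_def)

lemma nbr_node: "j \<in> V i \<Longrightarrow> j \<in> nodes"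
  using nbrs_nodes by blast

lemma finite_nbrs [simp]: "finite (V i)"
  using nbrs_nodes finite_subset by blast

lemma nbr_list [simp]: "set (nbr_list net i) = V i" "distinct (nbr_list net i)" "length (nbr_list net i) = p i"
  by (auto simp: nbr_list_def in_deg_def)

lemma sum_nbr_list: "(\<Sum>\<mu><p i. f (nbr_list net i ! \<mu>)) = (\<Sum>j\<in>V i. f j)"
  using sum.reindex_bij_betw[OF bij_betw_nth[OF nbr_list(2)[of i] refl refl], of f] by simp

lemma dims:
  "plantA net \<in> carrier_mat n n" "plantB2 net \<in> carrier_mat n (dim_w net)" "distB net \<in> carrier_mat n m"
  using wf by (auto simp: rr_network_wf_def distB_def intro!: hcat_carrier)

lemma dims_i:
  assumes "i \<in> nodes"
  shows "outC net i \<in> carrier_mat (dim_y net i) n" "obsH net i \<in> carrier_mat (dim_h net i) n"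
    "outD2 net i \<in> carrier_mat (dim_y net i) (dim_w net)"
    "outDbar net i \<in> carrier_mat (dim_y net i) (dim_v net)"
    "distD net i \<in> carrier_mat (dim_y net i) m"
  using wf assms by (auto simp: rr_network_wf_def distD_def intro!: hcat_carrier)

lemma Yi: "i \<in> nodes \<Longrightarrow> Yi i \<in> carrier_mat n n" "i \<in> nodes \<Longrightarrow> pos_def (Yi i)"
  using pos_def_minv[of "Y i" n] Y[of i] by auto

lemma Yi_nonneg: "i \<in> nodes \<Longrightarrow> u \<in> carrier_vec n \<Longrightarrow> 0 \<le> bform (Yi i) u u"
  using Yi by (intro bform_pos_semidef[of _ n] pos_def_imp_pos_semidef[of _ n])

definition delay_weight :: "nat \<Rightarrow> real" where
  "delay_weight i = (\<Sum>j | j \<in> nodes \<and> i \<in> V j. (\<tau> j)\<^sup>2)"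

text \<open>What remains of the form of \<open>Xi_bar\<close> when the descriptor terms are removed.
  Here \<open>d\<close> is the derivative; \<open>h 0\<close> is the current error,
  \<open>h 1\<close> to \<open>h (p i)\<close> are its samples and \<open>h (Suc (p i))\<close> the
  delayed error; \<open>g\<close> and \<open>Z\<close> are the current and the held errors of the
  neighbours; \<open>x\<close> is the disturbance.\<close>

definition lmi_form ::
  "nat \<Rightarrow> real vec \<Rightarrow> (nat \<Rightarrow> real vec) \<Rightarrow> (nat \<Rightarrow> real vec) \<Rightarrow> (nat \<Rightarrow> real vec) \<Rightarrow> real vec \<Rightarrow> real" where
  "lmi_form i d h g Z x =
     (\<tau> i)\<^sup>2 * bform (R i) d d + delay_weight i * bform (W i) d d + 2 * bform (Yi i) d (h 0)
     + (real (p i + q i) / \<gamma>\<^sup>2 * (h 0 \<bullet> h 0) - 2 / \<gamma>\<^sup>2 * (\<Sum>j\<in>V i. h 0 \<bullet> g j))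
     + 2 * \<alpha> i * bform (Yi i) (h 0) (h 0) + bform (S i) (h 0) (h 0)
     - exp (- 2 * \<alpha> i * \<tau> i) * bform (S i) (h (Suc (p i))) (h (Suc (p i)))
     - exp (- 2 * \<alpha> i * \<tau> i) * coupled_form (R i) (G i) (p i + 1) h
     - (\<Sum>j\<in>V i. \<pi> j * bform (Yi j) (g j) (g j) + pi\<^sup>2 / 4 * bform (W j) (g j - Z j) (g j - Z j))
     - x \<bullet> x"

definition nsum :: "nat \<Rightarrow> (nat \<Rightarrow> real vec) \<Rightarrow> real vec" where
  "nsum i f = vec n (\<lambda>c. \<Sum>j\<in>V i. f j $ c)"

lemma nsum_carrier [simp]: "nsum i f \<in> carrier_vec n"
  by (simp add: nsum_def)

lemma vsum_nbr_list: "vsum n (p i) (\<lambda>\<mu>. f (nbr_list net i ! \<mu>)) = nsum i f"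
  unfolding vsum_def nsum_def using sum_nbr_list[where f = "\<lambda>j. f j $ _"] by (intro eq_vecI) auto

lemma bform_nsum: "M \<in> carrier_mat k n \<Longrightarrow> bform M u (nsum i f) = (\<Sum>j\<in>V i. bform M u (f j))"
  unfolding vsum_nbr_list[symmetric] bform_vsum_right by (rule sum_nbr_list)

text \<open>
  The terms \<open>\<rho>\<close> come from the descriptor identity: they are the value of
  \<open>2 (e + \<epsilon> e' + \<epsilon>' \<Sum> \<zeta>)\<^sup>T X\<^sup>T (right-hand side - e')\<close>, where \<open>e'\<close> is the derivative of the error \<open>e\<close> and
  \<open>\<zeta>\<close> are the held samples of the neighbours.
\<close>

lemma Xi_bar_form:
  assumes i: "i \<in> nodes" and d: "d \<in> carrier_vec n" and h: "\<And>\<mu>. h \<mu> \<in> carrier_vec n"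
    and g: "\<And>j. g j \<in> carrier_vec n" and Z: "\<And>j. Z j \<in> carrier_vec n" and x: "x \<in> carrier_vec m"
  defines "\<phi> \<equiv> d @\<^sub>v h 0 @\<^sub>v stack n (p i) (\<lambda>\<mu>. h (Suc \<mu>)) @\<^sub>v h (Suc (p i))
      @\<^sub>v stack n (p i) (\<lambda>\<mu>. g (nbr_list net i ! \<mu>)) @\<^sub>v stack n (p i) (\<lambda>\<mu>. Z (nbr_list net i ! \<mu>)) @\<^sub>v x @\<^sub>v vNil"
    and "\<rho> \<equiv> \<lambda>u. bform (XAUC i) u (h 0) + bform (XBUD i) u x + bform (FH i) u (nsum i Z)
      - bform (FH i) u (vsum n (p i) (\<lambda>\<mu>. h (Suc \<mu>))) - bform (X i)\<^sup>T u d"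
    and "\<Xi> \<equiv> Xi_bar net \<gamma> \<alpha> \<pi> \<epsilon> \<epsilon>' Y X F U S R W G i"
  shows "\<Xi> \<in> carrier_mat (dim_vec \<phi>) (dim_vec \<phi>) \<and>
    bform \<Xi> \<phi> \<phi> = lmi_form i d h g Z x + 2 * (\<rho> (h 0) + \<epsilon> i * \<rho> d + \<epsilon>' i * \<rho> (nsum i Z))"
proof -
    let ?T = "Psi_tilde n (p i) (\<tau> i) (\<alpha> i) (Y i) (S i) (R i) (G i)"
  
  let ?P = "Psi_bar n (p i) (\<tau> i) (\<alpha> i) (R i) (G i)" and ?js = "nbr_list net i"
  let ?XA = "(X i)\<^sup>T * plantA net" and ?UC = "U i * outC net i"
  let ?E = "stack n (p i) (\<lambda>\<mu>. h (Suc \<mu>))" and ?g = "stack n (p i) (\<lambda>\<mu>. g (?js ! \<mu>))"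
    and ?Z = "stack n (p i) (\<lambda>\<mu>. Z (?js ! \<mu>))"
  let ?sE = "vsum n (p i) (\<lambda>\<mu>. h (Suc \<mu>))" and ?sZ = "nsum i Z"
  note ci = dims dims_i[OF i] X[OF i, THEN conjunct1] F[OF i] U[OF i] S[OF i, THEN conjunct1]
    R[OF i, THEN conjunct1] W[OF i, THEN conjunct1] G[OF i] Yi(1)[OF i]
  have nb: "?js ! \<mu> \<in> nodes" if "\<mu> < p i" for \<mu>
    using nth_mem[of \<mu> ?js] that nbrs_nodes[of i] by auto
  have XA: "?XA \<in> carrier_mat n n" and UC: "?UC \<in> carrier_mat n n"
    and FH: "FH i \<in> carrier_mat n n" and XB: "XBUD i \<in> carrier_mat n m"
    using ci by auto
  \<comment> \<open>The products with transposed factors in \<open>Xi_bar\<close> are transposes of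
    the untransposed ones, so \<open>bform_transpose\<close> can merge their values.\<close>
  have tr: "(plantA net)\<^sup>T * X i = ?XA\<^sup>T" "(outC net i)\<^sup>T * (U i)\<^sup>T = ?UC\<^sup>T"
    "(obsH net i)\<^sup>T * (F i)\<^sup>T = (FH i)\<^sup>T"
    using ci by (simp_all add: transpose_mult[of _ n n _ n] transpose_mult[of "U i" n "dim_y net i"]
        transpose_mult[of "F i" n "dim_h net i"])
  have row: "(ones (p i))\<^sup>T \<in> carrier_mat 1 (p i)" and col: "ones (p i) \<in> carrier_mat (p i) 1"
    and J: "ones (p i) * (ones (p i))\<^sup>T \<in> carrier_mat (p i) (p i)"
    by (auto simp: ones_def)
  have K1: "kron (ones (p i))\<^sup>T M \<in> carrier_mat n (p i * n)" if "M \<in> carrier_mat n n" for M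
    using kron_carrier[OF row that] by simp
  have K2: "kron (ones (p i) * (ones (p i))\<^sup>T) M \<in> carrier_mat (p i * n) (p i * n)" if "M \<in> carrier_mat n n" for M
    using kron_carrier[OF J that] by simp
  have K3: "kron (ones (p i)) M \<in> carrier_mat (p i * n) m" if "M \<in> carrier_mat n m" for M
    using kron_carrier[OF col that] by simp
  have \<Phi>: "block_diag n ?js f \<in> carrier_mat (p i * n) (p i * n)" for f
    using block_diag_carrier[of n ?js f] by simp
  note cs = ci XA UC FH XB K1 K2 K3 \<Phi> Psi_bar_carrier
  have diag: "bform (block_diag n ?js f) (stack n (p i) u) (stack n (p i) v) = (\<Sum>\<mu><p i. bform (f (?js ! \<mu>)) (u \<mu>) (v \<mu>))"
    if "\<And>j. j \<in> nodes \<Longrightarrow> f j \<in> carrier_mat n n" for f u v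
    using bform_block_diag[of ?js f n u v] that nb by simp
    
  have W22: "bform (Phi_22 n ?js W) (stack n (p i) (\<lambda>\<mu>. u (?js ! \<mu>))) (stack n (p i) (\<lambda>\<mu>. v (?js ! \<mu>)))
      = pi\<^sup>2 / 4 * (\<Sum>j\<in>V i. bform (W j) (u j) (v j))" for u v
  proof -
    have "bform (Phi_22 n ?js W) (stack n (p i) (\<lambda>\<mu>. u (?js ! \<mu>))) (stack n (p i) (\<lambda>\<mu>. v (?js ! \<mu>)))
      = (\<Sum>\<mu><p i. (\<lambda>j. bform ((pi\<^sup>2 / 4) \<cdot>\<^sub>m W j) (u j) (v j)) (?js ! \<mu>))"
      unfolding Phi_22_def using W by (subst diag) auto
    also have "\<dots> = (\<Sum>j\<in>V i. bform ((pi\<^sup>2 / 4) \<cdot>\<^sub>m W j) (u j) (v j))" by (rule sum_nbr_list)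
    finally show ?thesis by (simp add: bform_smult_mat sum_distrib_left)
  qed
  have W11: "bform (Phi_11 n ?js \<pi> Y W) ?g ?g
      = (\<Sum>j\<in>V i. \<pi> j * bform (Yi j) (g j) (g j)) + pi\<^sup>2 / 4 * (\<Sum>j\<in>V i. bform (W j) (g j) (g j))"
  proof -
    have "bform (Phi_11 n ?js \<pi> Y W) ?g ?g = (\<Sum>\<mu><p i. (\<lambda>j. bform (\<pi> j \<cdot>\<^sub>m Yi j + (pi\<^sup>2 / 4) \<cdot>\<^sub>m W j) (g j) (g j)) (?js ! \<mu>))"
      unfolding Phi_11_def using W Yi(1) by (subst diag) auto
    also have "\<dots> = (\<Sum>j\<in>V i. bform (\<pi> j \<cdot>\<^sub>m Yi j + (pi\<^sup>2 / 4) \<cdot>\<^sub>m W j) (g j) (g j))" by (rule sum_nbr_list)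
    also have "\<dots> = (\<Sum>j\<in>V i. \<pi> j * bform (Yi j) (g j) (g j) + pi\<^sup>2 / 4 * bform (W j) (g j) (g j))"
    proof (intro sum.cong refl)
      fix j assume "j \<in> V i"
      then have j: "j \<in> nodes" using nbrs_nodes by blast
      show "bform (\<pi> j \<cdot>\<^sub>m Yi j + (pi\<^sup>2 / 4) \<cdot>\<^sub>m W j) (g j) (g j)
         = \<pi> j * bform (Yi j) (g j) (g j) + pi\<^sup>2 / 4 * bform (W j) (g j) (g j)"
        using W[OF j] Yi(1)[OF j] by (subst bform_add_mat[of _ n n]) (auto simp: bform_smult_mat)
    qed
    finally show ?thesis by (simp add: sum.distrib sum_distrib_left)
  qed
  have Wdiff: "(\<Sum>j\<in>V i. bform (W j) (g j - Z j) (g j - Z j)) = (\<Sum>j\<in>V i. bform (W j) (g j) (g j))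
      - 2 * (\<Sum>j\<in>V i. bform (W j) (g j) (Z j)) + (\<Sum>j\<in>V i. bform (W j) (Z j) (Z j))"
    unfolding sum_distrib_left sum_subtractf[symmetric] sum.distrib[symmetric]
  proof (intro sum.cong refl)
    fix j assume "j \<in> V i"
    then have j: "j \<in> nodes" using nbrs_nodes by blast
    have sym: "(W j)\<^sup>T = W j" using W[OF j] by (simp add: pos_semidef_def)
    show "bform (W j) (g j - Z j) (g j - Z j) = bform (W j) (g j) (g j) - 2 * bform (W j) (g j) (Z j) + bform (W j) (Z j) (Z j)"
      using W[OF j] g Z bform_symmetric[OF sym, of "Z j" "g j"]
      by (simp add: bform_diff_left[of _ n n] bform_diff_right[of _ n n])
  qed
  have Wg: "Phi_11 n ?js \<pi> Y W \<in> carrier_mat (p i * n) (p i * n)" "Phi_22 n ?js W \<in> carrier_mat (p i * n) (p i * n)"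
    using \<Phi> by (simp_all add: Phi_11_def Phi_22_def)
  have kr: "bform (kron (ones (p i))\<^sup>T M) u ?E = bform M u ?sE" "bform (kron (ones (p i))\<^sup>T M) u ?Z = bform M u ?sZ"
    "bform (kron (ones (p i))\<^sup>T M) u ?g = bform M u (nsum i g)"
    if "M \<in> carrier_mat n n" "u \<in> carrier_vec n" for M u
    using bform_kron_row[OF that] by (simp_all add: vsum_nbr_list)
  have kJ: "bform (kron (ones (p i) * (ones (p i))\<^sup>T) M) ?E ?Z = bform M ?sE ?sZ"
    "bform (kron (ones (p i) * (ones (p i))\<^sup>T) M) ?Z ?Z = bform M ?sZ ?sZ"
    if "M \<in> carrier_mat n n" for M
    using bform_kron_square[OF that] by (simp_all add: vsum_nbr_list)
  have kc: "bform (kron (ones (p i)) M) ?Z x = bform M ?sZ x" if "M \<in> carrier_mat n m" for M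
    using bform_kron_column[OF that] by (simp add: vsum_nbr_list)
  have one: "bform (1\<^sub>m n) (h 0) (nsum i g) = (\<Sum>j\<in>V i. h 0 \<bullet> g j)"
    using g h by (simp add: bform_nsum[of _ n] bform_one)
  have sym: "(R i)\<^sup>T = R i" using R[OF i] by (simp add: pos_semidef_def)
  have PSI: "exp (- 2 * \<alpha> i * \<tau> i) * coupled_form (R i) (G i) (p i + 1) h
    = bform (?P 1 1) (h 0) (h 0) + 2 * bform (?P 1 2) (h 0) ?E + 2 * bform (?P 1 3) (h 0) (h (Suc (p i)))
     + bform (?P 2 2) ?E ?E + 2 * bform (?P 2 3) ?E (h (Suc (p i))) + bform (?P 3 3) (h (Suc (p i))) (h (Suc (p i)))"
    using bform_Psi_bar[of "R i" n "G i" "p i" h "\<tau> i" "\<alpha> i"] ci h sym unfolding Let_def by auto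
  have PHI: "(\<Sum>j\<in>V i. \<pi> j * bform (Yi j) (g j) (g j) + pi\<^sup>2 / 4 * bform (W j) (g j - Z j) (g j - Z j))
      = bform (Phi_11 n ?js \<pi> Y W) ?g ?g - 2 * bform (Phi_22 n ?js W) ?g ?Z + bform (Phi_22 n ?js W) ?Z ?Z"
    unfolding W11 W22 sum.distrib sum_distrib_left[symmetric] Wdiff by (simp add: algebra_simps)
  have tilde: "?T 1 1 = ?P 1 1 - (2 * \<alpha> i) \<cdot>\<^sub>m Yi i - S i"
    "?T 1 2 = ?P 1 2"
    "?T 1 3 = ?P 1 3"
    "?T 2 2 = ?P 2 2"
    "?T 2 3 = ?P 2 3"
    "?T 3 3 = ?P 3 3 + exp (- 2 * \<alpha> i * \<tau> i) \<cdot>\<^sub>m S i"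
    by (simp_all add: Psi_tilde_def)
  note carriers = cs Wg d h x stack_carrier(1) minus_carrier_mat
  show ?thesis
    unfolding \<Xi>_def Xi_bar_def Let_def tr tilde Phi_12_def delay_weight_def[symmetric] \<phi>_def
    \<comment> \<open>Dimension and value are split; \<open>carriers\<close> settles all dimension
      conditions. \<open>One_nat_def\<close> is switched off so that the block index 1 keeps the
      form in which it occurs in \<open>Psi_bar_carrier\<close>.\<close>
    apply (rule conjI)
     apply (rule bform_sym_block_mat7[where n = n and m = m and k = "p i * n", THEN conjunct1])
    apply (simp_all add: carriers del: One_nat_def)[27]
    apply (subst bform_sym_block_mat7[where n = n and m = m and k = "p i * n", THEN conjunct2];
        (simp add: carriers del: One_nat_def; fail)?)
    unfolding lmi_form_def PSI PHI
    apply (simp add: carriers bform_uminus_mat bform_smult_mat bform_transpose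
        bform_add_mat[of _ n n] bform_diff_mat[of _ n n] bform_diff_mat[of _ n "p i * n"]
        bform_diff_mat[of _ "p i * n" "p i * n"] kr kJ kc one bform_one \<rho>_def del: One_nat_def)
    apply (simp add: algebra_simps del: One_nat_def)
    done
qed

end

context rr_observers begin

text \<open>
  The matrix inequality of node \<open>i\<close> with margin \<open>\<kappa>\<close>, evaluated along the error dynamics: there the
  descriptor terms of the matrix \<open>\<Xi>\<close> vanish.
\<close>

definition lmi_margin :: "nat \<Rightarrow> real \<Rightarrow> bool" where
  "lmi_margin i \<kappa> \<longleftrightarrow> (\<forall>d h g Z x. d \<in> carrier_vec n \<longrightarrow> (\<forall>\<mu>. h \<mu> \<in> carrier_vec n) \<longrightarrow> (\<forall>j. g j \<in> carrier_vec n) \<longrightarrow>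
    (\<forall>j. Z j \<in> carrier_vec n) \<longrightarrow> x \<in> carrier_vec m \<longrightarrow>
    (X i)\<^sup>T *\<^sub>v d = XAUC i *\<^sub>v h 0 + XBUD i *\<^sub>v x + FH i *\<^sub>v (nsum i Z - vsum n (p i) (\<lambda>\<mu>. h (Suc \<mu>))) \<longrightarrow>
    lmi_form i d h g Z x \<le> - \<kappa> * (d \<bullet> d))"

text \<open>Coercivity of the negated matrix gives a multiple of the squared norm of the full
  stacked vector, of which only the share of \<open>d\<close> is kept. The equation assumed in
  \<open>lmi_margin\<close> is tested against \<open>h 0\<close>, \<open>d\<close> and the sum of
  the held values, which makes each \<rho> vanish.\<close>

lemma ex_lmi_margin:
  assumes i: "i \<in> nodes"
  shows "\<exists>\<kappa>>0. lmi_margin i \<kappa>"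
proof -
  define \<Xi> where "\<Xi> = Xi_bar net \<gamma> \<alpha> \<pi> \<epsilon> \<epsilon>' Y X F U S R W G i"
  define k where "k = dim_row \<Xi>"
  \<comment> \<open>The zero vectors serve only to learn that \<Xi> is square.\<close>
  have \<Xi>: "\<Xi> \<in> carrier_mat k k"
    using Xi_bar_form[OF i, of "0\<^sub>v n" "\<lambda>_. 0\<^sub>v n" "\<lambda>_. 0\<^sub>v n" "\<lambda>_. 0\<^sub>v n" "0\<^sub>v m"]
    unfolding k_def \<Xi>_def by auto
  have "pos_def (- \<Xi>)" using Xi[OF i] by (simp add: neg_def_def \<Xi>_def)
  then obtain \<kappa> where \<kappa>: "0 < \<kappa>" "\<And>v. v \<in> carrier_vec k \<Longrightarrow> \<kappa> * (v \<bullet> v) \<le> bform (- \<Xi>) v v"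
    using pos_def_coercive[of "- \<Xi>" k] \<Xi> by auto
  have X': "(X i)\<^sup>T \<in> carrier_mat n n" and XA: "XAUC i \<in> carrier_mat n n"
    and XB: "XBUD i \<in> carrier_mat n m" and FH: "FH i \<in> carrier_mat n n"
    using X[OF i] U[OF i] F[OF i] dims dims_i[OF i] by (auto intro!: minus_carrier_mat)
  have "lmi_form i d h g Z x \<le> - \<kappa> * (d \<bullet> d)"
    if d: "d \<in> carrier_vec n" and h: "\<And>\<mu>. h \<mu> \<in> carrier_vec n" and g: "\<And>j. g j \<in> carrier_vec n"
      and Z: "\<And>j. Z j \<in> carrier_vec n" and x: "x \<in> carrier_vec m"
      and eq: "(X i)\<^sup>T *\<^sub>v d = XAUC i *\<^sub>v h 0 + XBUD i *\<^sub>v x + FH i *\<^sub>v (nsum i Z - vsum n (p i) (\<lambda>\<mu>. h (Suc \<mu>)))"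
    for d h g Z x
  proof -
    define \<psi> where "\<psi> = h 0 @\<^sub>v stack n (p i) (\<lambda>\<mu>. h (Suc \<mu>)) @\<^sub>v h (Suc (p i))
      @\<^sub>v stack n (p i) (\<lambda>\<mu>. g (nbr_list net i ! \<mu>)) @\<^sub>v stack n (p i) (\<lambda>\<mu>. Z (nbr_list net i ! \<mu>)) @\<^sub>v x @\<^sub>v vNil"
    define \<rho> where "\<rho> = (\<lambda>u. bform (XAUC i) u (h 0) + bform (XBUD i) u x + bform (FH i) u (nsum i Z)
      - bform (FH i) u (vsum n (p i) (\<lambda>\<mu>. h (Suc \<mu>))) - bform (X i)\<^sup>T u d)"
    have form: "\<Xi> \<in> carrier_mat (dim_vec (d @\<^sub>v \<psi>)) (dim_vec (d @\<^sub>v \<psi>)) \<and> bform \<Xi> (d @\<^sub>v \<psi>) (d @\<^sub>v \<psi>)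
        = lmi_form i d h g Z x + 2 * (\<rho> (h 0) + \<epsilon> i * \<rho> d + \<epsilon>' i * \<rho> (nsum i Z))"
      using Xi_bar_form[of i d h g Z x, OF i d h g Z x] unfolding \<Xi>_def \<psi>_def \<rho>_def .
    have "\<rho> u = 0" if u: "u \<in> carrier_vec n" for u
    proof -
      let ?s = "nsum i Z - vsum n (p i) (\<lambda>\<mu>. h (Suc \<mu>))"
      have s: "?s \<in> carrier_vec n" by (intro minus_carrier_vec) auto
      have "bform (X i)\<^sup>T u d = u \<bullet> ((X i)\<^sup>T *\<^sub>v d)"
        using X' u d by (intro scalar_mult_mat_vec[symmetric]) auto
      also have "\<dots> = u \<bullet> (XAUC i *\<^sub>v h 0) + u \<bullet> (XBUD i *\<^sub>v x) + u \<bullet> (FH i *\<^sub>v ?s)"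
      proof -
        have c: "XAUC i *\<^sub>v h 0 \<in> carrier_vec n" "XBUD i *\<^sub>v x \<in> carrier_vec n" "FH i *\<^sub>v ?s \<in> carrier_vec n"
          using XA XB FH h[of 0] x s by (auto intro!: mult_mat_vec_carrier)
        then show ?thesis unfolding eq
          by (simp add: scalar_prod_add_distrib[OF u] c)
      qed
      also have "\<dots> = bform (XAUC i) u (h 0) + bform (XBUD i) u x + bform (FH i) u ?s"
        using XA XB FH u h[of 0] x s by (simp only: scalar_mult_mat_vec carrier_matD)
      also have "bform (FH i) u ?s = bform (FH i) u (nsum i Z) - bform (FH i) u (vsum n (p i) (\<lambda>\<mu>. h (Suc \<mu>)))"
        by (intro bform_diff_right[OF FH]) auto
      finally show ?thesis by (simp add: \<rho>_def)
    qed
    then have zero: "\<rho> (h 0) = 0" "\<rho> d = 0" "\<rho> (nsum i Z) = 0" using h d by auto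
    have k: "dim_vec (d @\<^sub>v \<psi>) = k" using form \<Xi> by auto
    then have "\<kappa> * ((d @\<^sub>v \<psi>) \<bullet> (d @\<^sub>v \<psi>)) \<le> bform (- \<Xi>) (d @\<^sub>v \<psi>) (d @\<^sub>v \<psi>)"
      by (intro \<kappa>(2)) (metis carrier_vec_dim_vec)
    moreover have "(d @\<^sub>v \<psi>) \<bullet> (d @\<^sub>v \<psi>) = d \<bullet> d + \<psi> \<bullet> \<psi>"
      using d by (intro scalar_prod_append[of _ n _ "dim_vec \<psi>"]) auto
    moreover have "\<kappa> * (d \<bullet> d) \<le> \<kappa> * (d \<bullet> d + \<psi> \<bullet> \<psi>)"
      using \<kappa>(1) by (simp add: scalar_prod_self_nonneg)
    ultimately have "\<kappa> * (d \<bullet> d) \<le> - bform \<Xi> (d @\<^sub>v \<psi>) (d @\<^sub>v \<psi>)"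
      by (simp add: bform_uminus_mat)
    then show ?thesis using form zero by simp
  qed
  then show ?thesis using \<kappa>(1) unfolding lmi_margin_def by blast
qed

section \<open>Sums over edges, delays, and the indices of held samples\<close>

lemma sum_edges_swap:
  fixes f :: "nat \<Rightarrow> nat \<Rightarrow> real"
  shows "(\<Sum>i\<in>nodes. \<Sum>j\<in>V i. f i j) = (\<Sum>j\<in>nodes. \<Sum>i | i \<in> nodes \<and> j \<in> V i. f i j)"
proof -
  have "(\<Sum>i\<in>nodes. \<Sum>j\<in>V i. f i j) = (\<Sum>i\<in>nodes. \<Sum>j | j \<in> nodes \<and> j \<in> V i. f i j)"
    by (intro sum.cong refl) (use nbrs_nodes in blast)
  also have "\<dots> = (\<Sum>j\<in>nodes. \<Sum>i | i \<in> nodes \<and> j \<in> V i. f i j)"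
    by (rule sum.swap_restrict) auto
  finally show ?thesis .
qed

lemma card_out: "card {i. i \<in> nodes \<and> j \<in> V i} = q j"
proof -
  have "out_arcs (with_proj (graph net)) j = (\<lambda>i. (j, i)) ` {i. i \<in> nodes \<and> j \<in> V i}"
    using arcs_nodes by (auto simp: out_arcs_def nbrs_def with_proj_def)
  then have "q j = card ((\<lambda>i. (j, i)) ` {i. i \<in> nodes \<and> j \<in> V i})"
    by (simp add: out_deg_def out_degree_def)
  then show ?thesis by (simp add: card_image inj_on_def)
qed

lemma sum_edges_head: "(\<Sum>i\<in>nodes. \<Sum>j\<in>V i. f j) = (\<Sum>j\<in>nodes. real (q j) * f j)"
  unfolding sum_edges_swap by (simp only: sum_constant card_out)

text \<open>Clears the extended-real denominator. For out-degree 0 its inverse is infinite and no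
  bound on \<pi> results, but then the claim is just 0 < 2 \<alpha>.\<close>

lemma out_deg_bound:
  assumes "i \<in> nodes" shows "real (q i) * \<pi> i < 2 * \<alpha> i"
proof (cases "q i = 0")
  case False
  then have "inverse (ereal (real (q i))) = ereal (1 / real (q i))" by (simp add: inverse_eq_divide)
  then have "\<pi> i < 2 * \<alpha> i * (1 / real (q i))" using pi_bound[OF assms] by simp
  then show ?thesis using False by (simp add: field_simps)
qed (use const_pos[OF assms] in simp)

sublocale sampling "samp net"
  using wf by unfold_locales (auto simp: rr_network_wf_def)

lemma delay_ge:
  assumes "i \<in> nodes" "p i \<le> Suc k"
  shows "samp net (Suc k) - samp net (Suc k - p i) \<le> \<tau> i"
  unfolding delay_def using wf assms
  by (intro cSup_upper) (auto simp: rr_network_wf_def delay_set_def)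

lemma delay_nonneg: "i \<in> nodes \<Longrightarrow> 0 \<le> \<tau> i"
  using delay_ge[of i "p i"] s_le[of "Suc (p i) - p i" "Suc (p i)"] by auto

text \<open>During the first steps the subtraction truncates to index 0, outside the range over
  which the delay is a supremum. There the lag is at most \<open>samp net (p i)\<close>, which is
  itself one of the lags: the one at step p - 1.\<close>

lemma delay_ge_truncated:
  assumes i: "i \<in> nodes" and l: "Suc k - p i \<le> l" and p: "0 < p i"
  shows "samp net (Suc k) - samp net l \<le> \<tau> i"
proof (cases "p i \<le> Suc k")
  case True
  then show ?thesis using delay_ge[OF i True] s_le[OF l] by simp
next
  case False
  have "samp net (Suc (p i - 1)) - samp net (Suc (p i - 1) - p i) \<le> \<tau> i"
    using p by (intro delay_ge[OF i]) auto
  then have "samp net (p i) \<le> \<tau> i" using p s0 by simp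
  then show ?thesis using s_le[of "Suc k" "p i"] False s_nonneg[of l] by simp
qed

text \<open>Natural subtraction replaces a negative index by 0. For the errors this changes nothing,
  since all of them equal the initial state at every nonpositive time.\<close>

definition held_index :: "nat \<Rightarrow> nat \<Rightarrow> nat \<Rightarrow> nat" where
  "held_index i j k = Suc k - rr_pos net k i j"

lemma rr_order_simps [simp]:
  "set (rr_order net k i) = V i" "distinct (rr_order net k i)" "length (rr_order net k i) = p i"
  by (simp_all add: rr_order_def)

lemma rr_pos_bounds:
  assumes "j \<in> V i" shows "1 \<le> rr_pos net k i j" "rr_pos net k i j \<le> p i"
proof -
  have "length (takeWhile (\<lambda>y. y \<noteq> j) (rr_order net k i)) < length (rr_order net k i)"
    using assms length_takeWhile_le[of "\<lambda>y. y \<noteq> j" "rr_order net k i"]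
    by (metis le_neq_implies_less rr_order_simps(1) set_takeWhileD takeWhile_eq_take take_all_iff order_refl)
  then show "1 \<le> rr_pos net k i j" "rr_pos net k i j \<le> p i" by (auto simp: rr_pos_def)
qed

lemma rr_pos_Suc:
  assumes "j \<in> V i"
  shows "rr_pos net (Suc k) i j = (if rr_pos net k i j = p i then 1 else Suc (rr_pos net k i j))"
  using position_shift_perm[of "rr_order net k i" j] assms
  by (simp add: rr_pos_def rr_order_def[of _ "Suc k"] rr_order_def[symmetric])

lemma held_index_0: "held_index i j 0 = 0"
  by (simp add: held_index_def rr_pos_def)

text \<open>Step number and position normally grow together and cancel. When the position wraps
  around from p to 1, the held sample becomes the newest one.\<close>

lemma held_index_Suc:
  assumes "j \<in> V i"
  shows "held_index i j (Suc k) = held_index i j k \<or> held_index i j (Suc k) = Suc k"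
  using rr_pos_Suc[OF assms, of k] by (auto simp: held_index_def)

lemma held_index_delay:
  assumes "i \<in> nodes" "j \<in> V i"
  shows "samp net (Suc k) - samp net (held_index i j k) \<le> \<tau> i"
  using rr_pos_bounds[OF assms(2), of k] by (intro delay_ge_truncated[OF assms(1)]) (auto simp: held_index_def)

text \<open>The positions of the neighbours are a permutation of 1, ..., p at every step. So the
  samples of a node's own error in the coupling are simply its last p samples, whichever neighbour
  is compared with which; this is why they can enter the matrix inequality in order of time.\<close>

lemma sum_rr_pos:
  "(\<Sum>j\<in>V i. f (held_index i j k)) = (\<Sum>\<mu><p i. f (k - \<mu>))"
  using sum_position[of "rr_order net k i" "\<lambda>\<mu>. f (k - \<mu>)"] by (simp add: held_index_def rr_pos_def)

text \<open>The summand of node i in N times the form of the initial weight; the coefficient of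
  \<open>S i\<close> is the loss in \<open>delayed_state_energy\<close>.\<close>

definition initial_energy :: "nat \<Rightarrow> real vec \<Rightarrow> real" where
  "initial_energy i u = bform (Yi i) u u + (1 - exp (- 2 * \<alpha> i * \<tau> i)) / (2 * \<alpha> i) * bform (S i) u u"

text \<open>
  Admissible decay rates: the margin \<open>\<kappa> i\<close> has to pay for the exponential weights in Wirtinger's
  inequality. The rate \<open>0\<close> needs no margin.
\<close>

definition admissible :: "real \<Rightarrow> (nat \<Rightarrow> real) \<Rightarrow> bool" where
  "admissible \<beta> \<kappa> \<longleftrightarrow> 0 \<le> \<beta> \<and> (\<forall>i\<in>nodes. \<beta> \<le> \<alpha> i \<and> real (q i) * \<pi> i + 2 * \<beta> \<le> 2 * \<alpha> i \<and> lmi_margin i (\<kappa> i) \<and>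
     (\<forall>u\<in>carrier_vec n. (\<Sum>j | j \<in> nodes \<and> i \<in> V j. (exp (2 * \<beta> * \<tau> j) - 1) * (\<tau> j)\<^sup>2) * bform (W i) u u
        \<le> \<kappa> i * (u \<bullet> u)))"

lemma admissible_zero: "admissible 0 (\<lambda>_. 0)"
proof -
  have "lmi_margin i 0" if i: "i \<in> nodes" for i
  proof -
    obtain \<kappa> where \<kappa>: "0 < \<kappa>" "lmi_margin i \<kappa>" using ex_lmi_margin[OF i] by blast
    have "- \<kappa> * (u \<bullet> u) \<le> - 0 * (u \<bullet> u)" for u :: "real vec"
      using \<kappa>(1) by (simp add: scalar_prod_self_nonneg)
    then show ?thesis using \<kappa>(2) unfolding lmi_margin_def by (meson order_trans)
  qed
  then show ?thesis
    using const_pos out_deg_bound by (auto simp: admissible_def intro: less_imp_le)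
qed

end

section \<open>The energy inequality\<close>

text \<open>Multiplication of the error equation by the transpose of \<open>X i\<close> removes the
  gains, leaving the variables \<open>U\<close> and \<open>F\<close> in which the matrix inequality
  is linear. The half-open intervals make the equation hold at every t \<ge> 0 exactly once.\<close>

locale rr_trajectory = rr_observers +
  fixes x0 :: "real vec" and z d \<xi> :: "nat \<Rightarrow> real \<Rightarrow> real vec"
  assumes z: "\<And>i. i \<in> nodes \<Longrightarrow> weak_deriv n (z i) (d i)"
    and z_init: "\<And>i t. i \<in> nodes \<Longrightarrow> t \<le> 0 \<Longrightarrow> z i t = x0"
    and d_init: "\<And>i t. i \<in> nodes \<Longrightarrow> t < 0 \<Longrightarrow> d i t = 0\<^sub>v n"
    and \<xi>_carrier: "\<And>i t. i \<in> nodes \<Longrightarrow> 0 \<le> t \<Longrightarrow> \<xi> i t \<in> carrier_vec m"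
    and \<xi>_integrable: "\<And>i T. i \<in> nodes \<Longrightarrow> (\<lambda>t. \<xi> i t \<bullet> \<xi> i t) integrable_on {0..T}"
    and dynamics: "\<And>i k t. i \<in> nodes \<Longrightarrow> samp net k \<le> t \<Longrightarrow> t < samp net (Suc k) \<Longrightarrow>
      (X i)\<^sup>T *\<^sub>v d i t = XAUC i *\<^sub>v z i t + XBUD i *\<^sub>v \<xi> i t
        + FH i *\<^sub>v (nsum i (\<lambda>j. z j (samp net (held_index i j k)))
             - vsum n (p i) (\<lambda>\<mu>. z i (samp net (k - \<mu>))))"
begin

lemma z_carrier: "i \<in> nodes \<Longrightarrow> z i t \<in> carrier_vec n" "i \<in> nodes \<Longrightarrow> d i t \<in> carrier_vec n"
  using weak_deriv_carrier[OF z] by auto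

abbreviation "step \<equiv> step_index (samp net)"

definition held :: "nat \<Rightarrow> nat \<Rightarrow> real \<Rightarrow> real vec" where
  "held i j t = z j (samp net (held_index i j (step t)))"

definition window :: "nat \<Rightarrow> real \<Rightarrow> real" where
  "window i t = integral {t - \<tau> i..t} (\<lambda>s. bform (R i) (d i s) (d i s))"

text \<open>Times \<open>exp (2 * \<beta> * t)\<close>, this is the derivative of the weighted Y
  energy.\<close>

definition energy_rate :: "real \<Rightarrow> nat \<Rightarrow> real \<Rightarrow> real" where
  "energy_rate \<beta> i t = 2 * bform (Yi i) (d i t) (z i t) + 2 * \<beta> * bform (Yi i) (z i t) (z i t)"

definition state_term :: "nat \<Rightarrow> real \<Rightarrow> real" where
  "state_term i t = bform (S i) (z i t) (z i t)
     - exp (- 2 * \<alpha> i * \<tau> i) * bform (S i) (z i (t - \<tau> i)) (z i (t - \<tau> i))"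

definition rate_term :: "nat \<Rightarrow> real \<Rightarrow> real" where
  "rate_term i t = (\<tau> i)\<^sup>2 * bform (R i) (d i t) (d i t) - exp (- 2 * \<alpha> i * \<tau> i) * (\<tau> i * window i t)"

definition sampling_term :: "real \<Rightarrow> nat \<Rightarrow> nat \<Rightarrow> real \<Rightarrow> real" where
  "sampling_term \<beta> i j t = exp (2 * \<beta> * \<tau> i) * (\<tau> i)\<^sup>2 * bform (W j) (d j t) (d j t)
     - pi\<^sup>2 / 4 * bform (W j) (z j t - held i j t) (z j t - held i j t)"

definition disagreement :: "real \<Rightarrow> real" where
  "disagreement t = (\<Sum>i\<in>nodes. \<Sum>j\<in>V i. (z j t - z i t) \<bullet> (z j t - z i t))"

definition dist_power :: "real \<Rightarrow> real" where
  "dist_power t = (\<Sum>i\<in>nodes. \<xi> i t \<bullet> \<xi> i t)"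

lemma lmi_form_trajectory:
  assumes i: "i \<in> nodes" and t: "0 \<le> t"
    and \<kappa>: "lmi_margin i \<kappa>"
  shows "rate_term i t
     + delay_weight i * bform (W i) (d i t) (d i t) + \<kappa> * (d i t \<bullet> d i t)
     + 2 * bform (Yi i) (d i t) (z i t)
     + (real (p i + q i) / \<gamma>\<^sup>2 * (z i t \<bullet> z i t) - 2 / \<gamma>\<^sup>2 * (\<Sum>j\<in>V i. z i t \<bullet> z j t))
     + 2 * \<alpha> i * bform (Yi i) (z i t) (z i t)
     + state_term i t
     - (\<Sum>j\<in>V i. \<pi> j * bform (Yi j) (z j t) (z j t)
          + pi\<^sup>2 / 4 * bform (W j) (z j t - held i j t) (z j t - held i j t))
     \<le> \<xi> i t \<bullet> \<xi> i t"
proof -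
  define k where "k = step t"
  have k: "samp net k \<le> t" "t < samp net (Suc k)"
    unfolding k_def by (rule step_index_bounds[OF t])+
  define \<theta> where "\<theta> = (\<lambda>\<mu>. if \<mu> = 0 then t else if \<mu> \<le> p i then samp net (Suc k - \<mu>) else t - \<tau> i)"
  define h where "h = (\<lambda>\<mu>. z i (\<theta> \<mu>))"
  have \<theta>: "\<theta> (Suc \<mu>) \<le> \<theta> \<mu>" if \<mu>: "\<mu> < p i + 1" for \<mu>
  proof -
    consider "\<mu> = 0" "p i = 0" | "\<mu> = 0" "0 < p i" | "0 < \<mu>" "\<mu> < p i" | "0 < \<mu>" "\<mu> = p i"
      using \<mu> by linarith
    then show ?thesis
    proof cases
      case 1
      then show ?thesis using delay_nonneg[OF i] by (simp add: \<theta>_def)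
    next
      case 2
      then show ?thesis using k by (simp add: \<theta>_def)
    next
      case 3
      then show ?thesis using s_le[of "Suc k - Suc \<mu>" "Suc k - \<mu>"] by (simp add: \<theta>_def)
    next
      case 4
      \<comment> \<open>The delay bounds the age of the oldest sample at
        \<open>samp net (Suc k)\<close>, which lies beyond t; hence this sample is not older than
        \<open>t - \<tau> i\<close>.\<close>
      then show ?thesis
        using delay_ge_truncated[OF i order_refl, of k] k by (simp add: \<theta>_def)
    qed
  qed
  have h0: "h 0 = z i t" and hlast: "h (Suc (p i)) = z i (t - \<tau> i)" by (simp_all add: h_def \<theta>_def)
  have hmid: "vsum n (p i) (\<lambda>\<mu>. h (Suc \<mu>)) = vsum n (p i) (\<lambda>\<mu>. z i (samp net (k - \<mu>)))"
    unfolding vsum_def by (intro arg_cong2[of _ _ _ _ Matrix.vec] refl ext sum.cong) (auto simp: h_def \<theta>_def)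
  have heldk: "held i j t = z j (samp net (held_index i j k))" for j by (simp add: held_def k_def)
  text \<open>Only neighbours occur in the form; other indices are given a vector of the right dimension.\<close>
  let ?r = "\<lambda>f j. if j \<in> nodes then f j else 0\<^sub>v n"
  have restrict: "nsum i (?r f) = nsum i f" for f
    unfolding nsum_def by (intro arg_cong2[of _ _ _ _ Matrix.vec] refl ext sum.cong) (auto dest: nbr_node)
  have eq: "(X i)\<^sup>T *\<^sub>v d i t = XAUC i *\<^sub>v h 0 + XBUD i *\<^sub>v \<xi> i t
      + FH i *\<^sub>v (nsum i (?r (\<lambda>j. held i j t)) - vsum n (p i) (\<lambda>\<mu>. h (Suc \<mu>)))"
    unfolding restrict h0 hmid heldk by (rule dynamics[OF i k])
  have lmi: "lmi_form i (d i t) h (?r (\<lambda>j. z j t)) (?r (\<lambda>j. held i j t)) (\<xi> i t) \<le> - \<kappa> * (d i t \<bullet> d i t)"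
    using \<kappa>[unfolded lmi_margin_def, rule_format, OF z_carrier(2)[OF i] _ _ _ \<xi>_carrier[OF i t] eq] i
    by (simp add: held_def z_carrier h_def)
  have RG': "coupled_form (R i) (G i) (p i + 1) h \<le> \<tau> i * window i t"
    using reciprocally_convex_bound[of "R i" n "G i" "z i" "d i" "p i + 1" \<theta>] R[OF i] G[OF i] RG[OF i] z[OF i] \<theta>
    unfolding h_def window_def by (simp add: \<theta>_def)
  have RG_exp: "exp (- 2 * \<alpha> i * \<tau> i) * coupled_form (R i) (G i) (p i + 1) h \<le> exp (- 2 * \<alpha> i * \<tau> i) * (\<tau> i * window i t)"
    by (intro mult_left_mono RG') simp
  have s1: "(\<Sum>j\<in>V i. h 0 \<bullet> ?r (\<lambda>j. z j t) j) = (\<Sum>j\<in>V i. z i t \<bullet> z j t)"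
    unfolding h0 by (intro sum.cong refl) (auto dest: nbr_node)
  have s2: "(\<Sum>j\<in>V i. \<pi> j * bform (Yi j) (?r (\<lambda>j. z j t) j) (?r (\<lambda>j. z j t) j) + pi\<^sup>2 / 4 *
        bform (W j) (?r (\<lambda>j. z j t) j - ?r (\<lambda>j. held i j t) j) (?r (\<lambda>j. z j t) j - ?r (\<lambda>j. held i j t) j))
      = (\<Sum>j\<in>V i. \<pi> j * bform (Yi j) (z j t) (z j t)
          + pi\<^sup>2 / 4 * bform (W j) (z j t - held i j t) (z j t - held i j t))"
    by (intro sum.cong refl) (auto dest: nbr_node)
  show ?thesis using lmi RG_exp unfolding lmi_form_def state_term_def rate_term_def s1[unfolded h0] s2 h0 hlast by linarith
qed

text \<open>When the squares of the differences are expanded, the square of \<open>z i\<close>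
  occurs p times for the edges into i and q times for those out of i. This is the origin of the
  weight p + q in the matrix inequality.\<close>

lemma sum_consensus_terms:
  "(\<Sum>i\<in>nodes. real (p i + q i) / \<gamma>\<^sup>2 * (z i t \<bullet> z i t) - 2 / \<gamma>\<^sup>2 * (\<Sum>j\<in>V i. z i t \<bullet> z j t))
    = disagreement t / \<gamma>\<^sup>2"
proof -
  have "disagreement t = (\<Sum>i\<in>nodes. \<Sum>j\<in>V i. (z j t \<bullet> z j t) + ((z i t \<bullet> z i t) - 2 * (z i t \<bullet> z j t)))"
    unfolding disagreement_def
  proof (intro sum.cong refl)
    fix i j assume "i \<in> nodes" "j \<in> V i"
    then have c: "z i t \<in> carrier_vec n" "z j t \<in> carrier_vec n" using z_carrier by (auto dest: nbr_node)
    then show "(z j t - z i t) \<bullet> (z j t - z i t) = (z j t \<bullet> z j t) + ((z i t \<bullet> z i t) - 2 * (z i t \<bullet> z j t))"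
      using comm_scalar_prod[OF c]
      by (simp add: minus_scalar_prod_distrib[of _ n] scalar_prod_minus_distrib[of _ n])
  qed
  also have "\<dots> = (\<Sum>i\<in>nodes. \<Sum>j\<in>V i. z j t \<bullet> z j t)
      + (\<Sum>i\<in>nodes. \<Sum>j\<in>V i. (z i t \<bullet> z i t) - 2 * (z i t \<bullet> z j t))"
    by (simp only: sum.distrib)
  also have "(\<Sum>i\<in>nodes. \<Sum>j\<in>V i. z j t \<bullet> z j t) = (\<Sum>i\<in>nodes. real (q i) * (z i t \<bullet> z i t))"
    by (rule sum_edges_head)
  also have "(\<Sum>i\<in>nodes. \<Sum>j\<in>V i. (z i t \<bullet> z i t) - 2 * (z i t \<bullet> z j t))
      = (\<Sum>i\<in>nodes. real (p i) * (z i t \<bullet> z i t) - 2 * (\<Sum>j\<in>V i. z i t \<bullet> z j t))"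
    by (simp add: sum_subtractf in_deg_def sum_distrib_left)
  also have "(\<Sum>i\<in>nodes. real (q i) * (z i t \<bullet> z i t))
        + (\<Sum>i\<in>nodes. real (p i) * (z i t \<bullet> z i t) - 2 * (\<Sum>j\<in>V i. z i t \<bullet> z j t))
      = (\<Sum>i\<in>nodes. real (p i + q i) * (z i t \<bullet> z i t) - 2 * (\<Sum>j\<in>V i. z i t \<bullet> z j t))"
    unfolding sum.distrib[symmetric] by (intro sum.cong refl) (simp add: algebra_simps)
  finally have "disagreement t
      = (\<Sum>i\<in>nodes. real (p i + q i) * (z i t \<bullet> z i t) - 2 * (\<Sum>j\<in>V i. z i t \<bullet> z j t))" .
  then show ?thesis
    by (simp only: sum_divide_distrib diff_divide_distrib times_divide_eq_left)
qed

lemma pointwise_bound: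
  assumes adm: "admissible \<beta> \<kappa>" and t: "0 \<le> t"
  shows "(\<Sum>i\<in>nodes. energy_rate \<beta> i t + state_term i t + rate_term i t)
    + (\<Sum>i\<in>nodes. \<Sum>j\<in>V i. sampling_term \<beta> i j t) + disagreement t / \<gamma>\<^sup>2 \<le> dist_power t"
proof -
  let ?y = "\<lambda>i. bform (Yi i) (z i t) (z i t)" and ?w = "\<lambda>i. bform (W i) (d i t) (d i t)"
  let ?C = "\<lambda>i. real (p i + q i) / \<gamma>\<^sup>2 * (z i t \<bullet> z i t) - 2 / \<gamma>\<^sup>2 * (\<Sum>j\<in>V i. z i t \<bullet> z j t)"
  let ?D = "\<lambda>i. 2 * bform (Yi i) (d i t) (z i t)"
  let ?E = "\<lambda>i. delay_weight i * ?w i + \<kappa> i * (d i t \<bullet> d i t)"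
  let ?H = "\<lambda>i j. pi\<^sup>2 / 4 * bform (W j) (z j t - held i j t) (z j t - held i j t)"
  have "(\<Sum>i\<in>nodes. rate_term i t + ?E i + ?D i + ?C i + 2 * \<alpha> i * ?y i + state_term i t - (\<Sum>j\<in>V i. \<pi> j * ?y j + ?H i j)) \<le> dist_power t"
    unfolding dist_power_def
  proof (intro sum_mono)
    fix i assume i: "i \<in> nodes"
    have "lmi_margin i (\<kappa> i)" using adm i by (simp add: admissible_def)
    from lmi_form_trajectory[OF i t this] show "rate_term i t + ?E i + ?D i + ?C i + 2 * \<alpha> i * ?y i + state_term i t - (\<Sum>j\<in>V i. \<pi> j * ?y j + ?H i j) \<le> \<xi> i t \<bullet> \<xi> i t"
      by linarith
  qed
  then have main: "(\<Sum>i\<in>nodes. rate_term i t) + (\<Sum>i\<in>nodes. ?E i) + (\<Sum>i\<in>nodes. ?D i) + disagreement t / \<gamma>\<^sup>2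
      + (\<Sum>i\<in>nodes. 2 * \<alpha> i * ?y i) + (\<Sum>i\<in>nodes. state_term i t)
      - (\<Sum>j\<in>nodes. real (q j) * (\<pi> j * ?y j)) - (\<Sum>i\<in>nodes. \<Sum>j\<in>V i. ?H i j) \<le> dist_power t"
    unfolding sum_consensus_terms[symmetric] sum_edges_head[symmetric]
    by (simp only: sum.distrib sum_subtractf diff_diff_eq[symmetric])
  \<comment> \<open>The coupling terms, regrouped by the node that sends the data, and the growth of
    the weight are paid for by \<open>2 * \<alpha>\<close>.\<close>
  have y: "(\<Sum>i\<in>nodes. 2 * \<beta> * ?y i) + (\<Sum>j\<in>nodes. real (q j) * (\<pi> j * ?y j)) \<le> (\<Sum>i\<in>nodes. 2 * \<alpha> i * ?y i)"
    unfolding sum.distrib[symmetric]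
  proof (intro sum_mono)
    fix i assume i: "i \<in> nodes"
    have "0 \<le> ?y i" using i z_carrier[OF i] by (intro Yi_nonneg)
    moreover have "real (q i) * \<pi> i + 2 * \<beta> \<le> 2 * \<alpha> i" using adm i by (auto simp: admissible_def)
    ultimately have "(real (q i) * \<pi> i + 2 * \<beta>) * ?y i \<le> 2 * \<alpha> i * ?y i" by (rule mult_right_mono[rotated])
    then show "2 * \<beta> * ?y i + real (q i) * (\<pi> i * ?y i) \<le> 2 * \<alpha> i * ?y i" by (simp add: algebra_simps)
  qed
  \<comment> \<open>The factor \<open>exp (2 * \<beta> * \<tau>)\<close> is split into 1 and the
    rest: the 1 gives \<open>delay_weight\<close>, already contained in the matrix inequality, and
    the rest is covered by the margin \<kappa>.\<close>
  have e: "(\<Sum>i\<in>nodes. \<Sum>j\<in>V i. exp (2 * \<beta> * \<tau> i) * (\<tau> i)\<^sup>2 * ?w j) \<le> (\<Sum>i\<in>nodes. ?E i)"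
    unfolding sum_edges_swap
  proof (intro sum_mono)
    fix i assume i: "i \<in> nodes"
    have "(\<Sum>j | j \<in> nodes \<and> i \<in> V j. (exp (2 * \<beta> * \<tau> j) - 1) * (\<tau> j)\<^sup>2) * ?w i \<le> \<kappa> i * (d i t \<bullet> d i t)"
      using adm i z_carrier[OF i] by (auto simp: admissible_def)
    moreover have "(\<Sum>j | j \<in> nodes \<and> i \<in> V j. exp (2 * \<beta> * \<tau> j) * (\<tau> j)\<^sup>2 * ?w i)
      = delay_weight i * ?w i + (\<Sum>j | j \<in> nodes \<and> i \<in> V j. (exp (2 * \<beta> * \<tau> j) - 1) * (\<tau> j)\<^sup>2) * ?w i"
      unfolding delay_weight_def sum_distrib_right sum.distrib[symmetric]
      by (intro sum.cong refl) (simp add: algebra_simps)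
    ultimately show "(\<Sum>j | j \<in> nodes \<and> i \<in> V j. exp (2 * \<beta> * \<tau> j) * (\<tau> j)\<^sup>2 * ?w i) \<le> ?E i" by simp
  qed
  show ?thesis using main y e unfolding energy_rate_def sampling_term_def sum.distrib sum_subtractf by linarith
qed

lemma disagreement_nonneg: "0 \<le> disagreement t"
  unfolding disagreement_def by (intro sum_nonneg scalar_prod_self_nonneg)

lemma disagreement_continuous: "continuous_on A disagreement"
proof -
  have "continuous_on A (\<lambda>t. \<Sum>i\<in>nodes. \<Sum>j\<in>V i. \<Sum>c<n. (z j t $ c - z i t $ c) * (z j t $ c - z i t $ c))"
    using weak_deriv_continuous[OF z]
    by (intro continuous_intros) (auto dest: nbr_node)
  moreover have "(\<Sum>i\<in>nodes. \<Sum>j\<in>V i. \<Sum>c<n. (z j t $ c - z i t $ c) * (z j t $ c - z i t $ c)) = disagreement t" for t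
    unfolding disagreement_def
  proof (intro sum.cong refl)
    fix i j assume "i \<in> nodes" "j \<in> V i"
    then have "dim_vec (z i t) = n" "dim_vec (z j t) = n" using z_carrier by (auto dest: nbr_node)
    then show "(\<Sum>c<n. (z j t $ c - z i t $ c) * (z j t $ c - z i t $ c)) = (z j t - z i t) \<bullet> (z j t - z i t)"
      by (simp add: scalar_prod_def lessThan_atLeast0)
  qed
  ultimately show ?thesis by (simp cong: continuous_on_cong)
qed

lemma energy_bound:
  assumes adm: "admissible \<beta> \<kappa>" and T: "0 \<le> T"
  shows "exp (2 * \<beta> * T) * (\<Sum>i\<in>nodes. bform (Yi i) (z i T) (z i T))
      + integral {0..T} (\<lambda>t. exp (2 * \<beta> * t) * (disagreement t / \<gamma>\<^sup>2))
    \<le> (\<Sum>i\<in>nodes. initial_energy i x0)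
      + integral {0..T} (\<lambda>t. exp (2 * \<beta> * t) * dist_power t)"
proof -
  let ?w = "\<lambda>t. exp (2 * \<beta> * t)"
  let ?fA = "\<lambda>i t. ?w t * energy_rate \<beta> i t"
  let ?fB = "\<lambda>i t. ?w t * state_term i t"
  let ?fC = "\<lambda>i t. ?w t * rate_term i t"
  let ?fD = "\<lambda>i j t. ?w t * sampling_term \<beta> i j t"
  let ?fE = "\<lambda>t. ?w t * (disagreement t / \<gamma>\<^sup>2)"
  let ?fF = "\<lambda>t. ?w t * dist_power t"
  let ?c = "\<lambda>i. (1 - exp (- 2 * \<alpha> i * \<tau> i)) / (2 * \<alpha> i)"
  have \<beta>: "0 \<le> \<beta>" "\<And>i. i \<in> nodes \<Longrightarrow> \<beta> \<le> \<alpha> i" using adm by (auto simp: admissible_def)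
  have A: "(?fA i has_integral ?w T * bform (Yi i) (z i T) (z i T) - bform (Yi i) x0 x0) {0..T}"
    if i: "i \<in> nodes" for i
  proof -
    have sym: "bform (Yi i) (z i t) (d i t) = bform (Yi i) (d i t) (z i t)" for t
      using Yi(2)[OF i] by (intro bform_symmetric) (simp add: pos_def_def)
    have "ac_on 0 T ?w (\<lambda>t. 2 * \<beta> * ?w t)"
      by (intro ac_on_C1 T continuous_intros) (auto intro!: derivative_eq_intros)
    from ac_on_has_integral[OF ac_on_mult[OF this ac_on_bform[OF Yi(1)[OF i] z[OF i] T]] order_refl T order_refl]
    have "((\<lambda>t. 2 * \<beta> * ?w t * bform (Yi i) (z i t) (z i t)
        + ?w t * (bform (Yi i) (d i t) (z i t) + bform (Yi i) (z i t) (d i t)))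
      has_integral ?w T * bform (Yi i) (z i T) (z i T) - bform (Yi i) x0 x0) {0..T}"
      using z_init[OF i, of 0] by simp
    then show ?thesis
      by (rule has_integral_eq[rotated]) (simp add: energy_rate_def sym algebra_simps)
  qed
  have B: "\<exists>I. (?fB i has_integral I) {0..T} \<and> - (?c i) * bform (S i) x0 x0 \<le> I"
    if i: "i \<in> nodes" for i
    unfolding state_term_def using z_init[OF i] z_carrier[OF i] S[OF i] \<beta> i T const_pos[OF i] delay_nonneg[OF i]
    by (intro delayed_state_energy bform_continuous[OF _ z[OF i] z[OF i]] bform_pos_semidef[of _ n]) auto
  have C: "\<exists>I. (?fC i has_integral I) {0..T} \<and> 0 \<le> I" if i: "i \<in> nodes" for i
    unfolding rate_term_def window_def using d_init[OF i] z_carrier[OF i] R[OF i] \<beta> i T delay_nonneg[OF i]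
    by (intro delayed_derivative_energy bform_deriv_integrable[OF _ z[OF i]] bform_pos_semidef[of _ n])
      (auto simp: bform_zero_left)
  have D: "\<exists>I. (?fD i j has_integral I) {0..T} \<and> 0 \<le> I" if i: "i \<in> nodes" and j: "j \<in> V i" for i j
  proof -
    have jn: "j \<in> nodes" using j nbrs_nodes by blast
    have "held i j t = z j (samp net (held_index i j k))" if "samp net k \<le> t" "t < samp net (Suc k)" for k t
      unfolding held_def step_index_eq[OF that] ..
    then show ?thesis unfolding sampling_term_def
      by (rule held_sample_energy[OF W[OF jn, THEN conjunct1] W[OF jn, THEN conjunct2] z[OF jn]
            held_index_0 held_index_Suc[OF j] held_index_delay[OF i j] _ \<beta>(1) T])
  qed
  have integral_value: "(f has_integral integral {0..T} f) {0..T} \<and> b \<le> integral {0..T} f"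
    if "\<exists>I. (f has_integral I) {0..T} \<and> b \<le> I" for f :: "real \<Rightarrow> real" and b
    using that by (auto simp: has_integral_iff)
  define IB where "IB = (\<lambda>i. integral {0..T} (?fB i))"
  define IC where "IC = (\<lambda>i. integral {0..T} (?fC i))"
  define ID where "ID = (\<lambda>i j. integral {0..T} (?fD i j))"
  have IB: "(?fB i has_integral IB i) {0..T}" "- (?c i) * bform (S i) x0 x0 \<le> IB i" if "i \<in> nodes" for i
    using integral_value[OF B[OF that]] unfolding IB_def by blast+
  have IC: "(?fC i has_integral IC i) {0..T}" "0 \<le> IC i" if "i \<in> nodes" for i
    using integral_value[OF C[OF that]] unfolding IC_def by blast+
  have ID: "(?fD i j has_integral ID i j) {0..T}" "0 \<le> ID i j" if "i \<in> nodes" "j \<in> V i" for i j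
    using integral_value[OF D[OF that]] unfolding ID_def by blast+
  have E: "(?fE has_integral integral {0..T} ?fE) {0..T}"
    by (intro integrable_integral integrable_continuous_real continuous_intros disagreement_continuous)
      (use gamma_pos in auto)
  have F: "(?fF has_integral integral {0..T} ?fF) {0..T}"
  proof (rule integrable_integral)
    have "dist_power integrable_on {0..T}"
      unfolding dist_power_def using \<xi>_integrable by (intro integrable_sum) auto
    then have "dist_power absolutely_integrable_on {0..T}"
      by (rule nonnegative_absolutely_integrable_1)
        (auto simp: dist_power_def intro!: sum_nonneg scalar_prod_self_nonneg)
    then have "(\<lambda>t. dist_power t * ?w t) absolutely_integrable_on {0..T}"
      by (intro absolutely_integrable_mult_continuous continuous_intros)
    then show "?fF integrable_on {0..T}" by (simp add: absolutely_integrable_on_def mult.commute)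
  qed
  have total: "((\<lambda>t. (\<Sum>i\<in>nodes. ?fA i t) + (\<Sum>i\<in>nodes. ?fB i t) + (\<Sum>i\<in>nodes. ?fC i t)
       + (\<Sum>i\<in>nodes. \<Sum>j\<in>V i. ?fD i j t) + ?fE t) has_integral
     (\<Sum>i\<in>nodes. ?w T * bform (Yi i) (z i T) (z i T) - bform (Yi i) x0 x0) + (\<Sum>i\<in>nodes. IB i)
      + (\<Sum>i\<in>nodes. IC i) + (\<Sum>i\<in>nodes. \<Sum>j\<in>V i. ID i j) + integral {0..T} ?fE) {0..T}"
    by (intro has_integral_add has_integral_sum A IB(1) IC(1) ID(1) E) auto
  have "(\<Sum>i\<in>nodes. ?w T * bform (Yi i) (z i T) (z i T) - bform (Yi i) x0 x0) + (\<Sum>i\<in>nodes. IB i)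
      + (\<Sum>i\<in>nodes. IC i) + (\<Sum>i\<in>nodes. \<Sum>j\<in>V i. ID i j) + integral {0..T} ?fE \<le> integral {0..T} ?fF"
  proof (rule has_integral_le[OF total F])
    fix t assume t: "t \<in> {0..T}"
    have "?w t * ((\<Sum>i\<in>nodes. energy_rate \<beta> i t + state_term i t + rate_term i t)
    + (\<Sum>i\<in>nodes. \<Sum>j\<in>V i. sampling_term \<beta> i j t) + disagreement t / \<gamma>\<^sup>2) \<le> ?fF t"
      using pointwise_bound[OF adm, of t] t by (intro mult_left_mono) auto
    then show "(\<Sum>i\<in>nodes. ?fA i t) + (\<Sum>i\<in>nodes. ?fB i t) + (\<Sum>i\<in>nodes. ?fC i t)
       + (\<Sum>i\<in>nodes. \<Sum>j\<in>V i. ?fD i j t) + ?fE t \<le> ?fF t"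
      unfolding sum_distrib_left[symmetric] sum.distrib distrib_left by linarith
  qed
  moreover have "0 \<le> (\<Sum>i\<in>nodes. IC i)" "0 \<le> (\<Sum>i\<in>nodes. \<Sum>j\<in>V i. ID i j)"
    using IC(2) ID(2) by (auto intro!: sum_nonneg)
  moreover have "- (\<Sum>i\<in>nodes. ?c i * bform (S i) x0 x0) \<le> (\<Sum>i\<in>nodes. IB i)"
    unfolding sum_negf[symmetric] using IB(2) by (intro sum_mono) auto
  ultimately show ?thesis
    unfolding initial_energy_def sum.distrib sum_subtractf sum_distrib_left[symmetric] by linarith
qed

end

section \<open>Solutions of the error equations as trajectories\<close>

lemma finsum_vec_eq_vec:
  assumes "finite I" "\<And>j. j \<in> I \<Longrightarrow> f j \<in> carrier_vec k"
  shows "finsum_vec TYPE(real) k f I = vec k (\<lambda>c. \<Sum>j\<in>I. f j $ c)"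
proof (rule eq_vecI)
  have "finsum_vec TYPE(real) k f I \<in> carrier_vec k" using assms by (intro finsum_vec_closed) auto
  then show "dim_vec (finsum_vec TYPE(real) k f I) = dim_vec (vec k (\<lambda>c. \<Sum>j\<in>I. f j $ c))" by simp
  fix c assume "c < dim_vec (vec k (\<lambda>c. \<Sum>j\<in>I. f j $ c))"
  then show "finsum_vec TYPE(real) k f I $ c = vec k (\<lambda>c. \<Sum>j\<in>I. f j $ c) $ c"
    using assms by (simp add: index_finsum_vec Pi_def)
qed

lemma mult_mat_vec_index:
  assumes "M \<in> carrier_mat k l" "v \<in> carrier_vec l" "c < k"
  shows "(M *\<^sub>v v) $ c = (\<Sum>b<l. M $$ (c, b) * v $ b)"
  using assms by (auto simp: scalar_prod_def lessThan_atLeast0)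

text \<open>The right end point is exempt because there the derivative already follows the next
  sampling step.\<close>

lemma sq_int_spike:
  assumes "sq_int a b f" "\<And>t. a \<le> t \<Longrightarrow> t < b \<Longrightarrow> g t = f t" shows "sq_int a b g"
proof (rule sq_intI)
  have "f integrable_on {a..b}" using assms(1) by (simp add: sq_int_def absolutely_integrable_on_def)
  then show "g integrable_on {a..b}"
    by (rule integrable_spike[of _ _ "{b}"]) (use assms(2) in auto)
  have "(\<lambda>t. (f t)\<^sup>2) integrable_on {a..b}" using assms(1) by (simp add: sq_int_def)
  then show "(\<lambda>t. (g t)\<^sup>2) integrable_on {a..b}"
    by (rule integrable_spike[of _ _ "{b}"]) (use assms(2) in auto)
qed

context rr_observers begin

abbreviation "L i \<equiv> minv ((X i)\<^sup>T) * U i"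
abbreviation "K i \<equiv> minv ((X i)\<^sup>T) * F i"

lemma gains_carrier:
  assumes "i \<in> nodes"
  shows "minv ((X i)\<^sup>T) \<in> carrier_mat n n" "(X i)\<^sup>T * minv ((X i)\<^sup>T) = 1\<^sub>m n"
    "L i \<in> carrier_mat n (dim_y net i)" "K i \<in> carrier_mat n (dim_h net i)"
proof -
  have "(X i)\<^sup>T \<in> carrier_mat n n" "det ((X i)\<^sup>T) \<noteq> 0"
    using X[OF assms] det_transpose[of "X i" n] by auto
  from minv_inverts[OF this] show "minv ((X i)\<^sup>T) \<in> carrier_mat n n" "(X i)\<^sup>T * minv ((X i)\<^sup>T) = 1\<^sub>m n"
    by auto
  then show "L i \<in> carrier_mat n (dim_y net i)" "K i \<in> carrier_mat n (dim_h net i)"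
    using U[OF assms] F[OF assms] by auto
qed

text \<open>Undoes the change of variables from the gains to \<open>F\<close> and
  \<open>U\<close>.\<close>

lemma X_mult_gain:
  assumes i: "i \<in> nodes" and M: "M \<in> carrier_mat n k" and Q: "Q \<in> carrier_mat k l"
  shows "(X i)\<^sup>T * (minv ((X i)\<^sup>T) * M * Q) = M * Q"
proof -
  note g = gains_carrier(1,2)[OF i]
  have XT: "(X i)\<^sup>T \<in> carrier_mat n n" using X[OF i] by auto
  have "(X i)\<^sup>T * (minv ((X i)\<^sup>T) * M * Q) = (X i)\<^sup>T * (minv ((X i)\<^sup>T) * (M * Q))"
    using assoc_mult_mat[OF g(1) M Q] by simp
  also have "\<dots> = (X i)\<^sup>T * minv ((X i)\<^sup>T) * (M * Q)"
    using M Q by (intro assoc_mult_mat[OF XT g(1), symmetric]) auto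
  also have "\<dots> = M * Q" unfolding g(2) using M Q by (intro left_mult_one_mat) auto
  finally show ?thesis .
qed

text \<open>The sum of the sampled differences, with the node's own samples listed in order of time
  as in the matrix inequality.\<close>

definition coupling :: "(nat \<Rightarrow> real \<Rightarrow> real vec) \<Rightarrow> nat \<Rightarrow> nat \<Rightarrow> real vec" where
  "coupling e i k = nsum i (\<lambda>j. e j (samp net (held_index i j k))) - vsum n (p i) (\<lambda>\<mu>. e i (samp net (k - \<mu>)))"

lemma coupling_carrier [simp]: "coupling e i k \<in> carrier_vec n"
  unfolding coupling_def by (intro minus_carrier_vec) auto

text \<open>Where \<open>sampled_diff\<close> returns 0 because of a negative index, the truncated
  index gives the difference of two equal initial states.\<close>

lemma sampled_diff_held:
  assumes "j \<in> V i" "e j 0 = x0" "e i 0 = x0" "x0 \<in> carrier_vec n"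
  shows "sampled_diff net k i e j = e j (samp net (held_index i j k)) - e i (samp net (held_index i j k))"
  using assms by (simp add: sampled_diff_def held_index_def s0 Let_def)

lemma finsum_sampled_diff:
  assumes i: "i \<in> nodes" and e: "\<And>j t. j \<in> nodes \<Longrightarrow> e j t \<in> carrier_vec n"
    and init: "\<And>j. j \<in> nodes \<Longrightarrow> e j 0 = x0"
  shows "finsum_vec TYPE(real) n (sampled_diff net k i e) (set (rr_order net k i)) = coupling e i k"
proof -
  have x0: "x0 \<in> carrier_vec n" using e[OF i, of 0] init[OF i] by simp
  have sd: "sampled_diff net k i e j = e j (samp net (held_index i j k)) - e i (samp net (held_index i j k))"
    if "j \<in> V i" for j
    using sampled_diff_held[OF that] init nbr_node[OF that] i x0 by auto
  have "finsum_vec TYPE(real) n (sampled_diff net k i e) (set (rr_order net k i))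
      = vec n (\<lambda>c. \<Sum>j\<in>V i. sampled_diff net k i e j $ c)"
    using e i nbr_node by (subst finsum_vec_eq_vec) (auto simp: sd)
  also have "\<dots> = coupling e i k"
  proof (rule eq_vecI)
    fix c assume "c < dim_vec (coupling e i k)"
    then have c: "c < n" using carrier_vecD[OF coupling_carrier] by metis
    have "(\<Sum>j\<in>V i. sampled_diff net k i e j $ c)
        = (\<Sum>j\<in>V i. e j (samp net (held_index i j k)) $ c - e i (samp net (held_index i j k)) $ c)"
      using c carrier_vecD[OF e[OF i]] by (intro sum.cong refl) (simp add: sd)
    also have "\<dots> = (\<Sum>j\<in>V i. e j (samp net (held_index i j k)) $ c) - (\<Sum>\<mu><p i. e i (samp net (k - \<mu>)) $ c)"
      unfolding sum_subtractf sum_rr_pos[of "\<lambda>l. e i (samp net l) $ c"] ..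
    finally show "vec n (\<lambda>c. \<Sum>j\<in>V i. sampled_diff net k i e j $ c) $ c = coupling e i k $ c"
      using c by (simp add: coupling_def nsum_def vsum_def)
  qed (simp add: carrier_vecD[OF coupling_carrier])
  finally show ?thesis .
qed

lemma error_solution_trajectory:
  assumes sol: "error_solution net L K x0 \<xi> e" and x0: "x0 \<in> carrier_vec n"
    and \<xi>: "\<And>i t. i \<in> nodes \<Longrightarrow> 0 \<le> t \<Longrightarrow> \<xi> i t \<in> carrier_vec m"
    and \<xi>_sq: "\<And>i b T. i \<in> nodes \<Longrightarrow> b < m \<Longrightarrow> sq_int 0 T (\<lambda>t. \<xi> i t $ b)"
  shows "\<exists>d. rr_trajectory net \<gamma> Y X F U S R W G \<alpha> \<pi> \<epsilon> \<epsilon>' x0 e d \<xi>"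
proof -
  let ?A = "\<lambda>i. plantA net - L i * outC net i" and ?B = "\<lambda>i. distB net - L i * distD net i"
    and ?K = "\<lambda>i. K i * obsH net i"
  define rhs where "rhs = (\<lambda>i k t. ?A i *\<^sub>v e i t + ?B i *\<^sub>v \<xi> i t + ?K i *\<^sub>v coupling e i k)"
  \<comment> \<open>The right-hand side itself, with the step number read off from the time, serves
    as derivative; the dynamics then hold at every t \<ge> 0 by definition. Before 0 the error is
    constant.\<close>
  define d where "d = (\<lambda>i t. if t < 0 then 0\<^sub>v n else rhs i (step_index (samp net) t) t)"
  have e: "e i t \<in> carrier_vec n" and init: "t \<le> 0 \<Longrightarrow> e i t = x0" if "i \<in> nodes" for i t
    using sol that by (auto simp: error_solution_def)
  have ABK: "?A i \<in> carrier_mat n n" "?B i \<in> carrier_mat n m" "?K i \<in> carrier_mat n n" if i: "i \<in> nodes" for i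
    using dims dims_i[OF i] gains_carrier[OF i] by (auto intro!: minus_carrier_mat)
  have rhs_carrier: "rhs i k t \<in> carrier_vec n" if "i \<in> nodes" for i k t
    using mult_mat_vec_carrier[OF ABK(3)[OF that] coupling_carrier]
    unfolding rhs_def by (intro carrier_vecI) (simp only: index_add_vec(2) carrier_vecD)
  have ode: "((\<lambda>s. rhs i k s $ c) has_integral e i t $ c - e i (samp net k) $ c) {samp net k..t}"
    if "i \<in> nodes" "c < n" "t \<in> {samp net k..samp net (Suc k)}" for i c k t
  proof -
    have fs: "finsum_vec TYPE(real) n (sampled_diff net k i e) (set (rr_order net k i)) = coupling e i k"
      using that(1) e init by (intro finsum_sampled_diff) auto
    show ?thesis
      using sol that unfolding rhs_def fs[symmetric] error_solution_def ode_on_def Suc_eq_plus1 by blast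
  qed
  have d_rhs: "d i t = rhs i k t" if "samp net k \<le> t" "t < samp net (Suc k)" for i k t
    using that s_nonneg[of k] step_index_eq[OF that] by (simp add: d_def)
  have d_carrier: "d i t \<in> carrier_vec n" if "i \<in> nodes" for i t
    using rhs_carrier[OF that] by (simp add: d_def)
  have rhs_sq: "sq_int (samp net k) (samp net (Suc k)) (\<lambda>t. rhs i k t $ c)" if i: "i \<in> nodes" and c: "c < n" for i c k
  proof -
    \<comment> \<open>Continuity is not assumed of a solution; it comes from its being an indefinite
      integral. The right-hand side is then a continuous part, a square integrable disturbance and a
      constant.\<close>
    have cont: "continuous_on {samp net k..samp net (Suc k)} (\<lambda>t. e i t $ b)" if "b < n" for b
      by (rule has_integral_continuous[OF ode[OF i that]])
    have "sq_int (samp net k) (samp net (Suc k)) (\<lambda>t. (\<Sum>b<n. ?A i $$ (c, b) * e i t $ b)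
        + (\<Sum>b<m. ?B i $$ (c, b) * \<xi> i t $ b) + (?K i *\<^sub>v coupling e i k) $ c)"
      using cont \<xi>_sq[OF i] s_nonneg[of k]
      by (intro sq_int_add sq_int_sum sq_int_cmult sq_int_continuous[of _ _ "\<lambda>_. _ $ c"])
        (auto intro: sq_int_continuous sq_int_subset[of 0 "samp net (Suc k)"])
    then show ?thesis
    proof (rule sq_int_spike)
      fix t assume "samp net k \<le> t"
      then have t: "0 \<le> t" using s_nonneg[of k] by simp
      have K: "?K i *\<^sub>v coupling e i k \<in> carrier_vec n"
        using ABK(3)[OF i] by (intro mult_mat_vec_carrier[of _ n n]) auto
      show "rhs i k t $ c = (\<Sum>b<n. ?A i $$ (c, b) * e i t $ b)
        + (\<Sum>b<m. ?B i $$ (c, b) * \<xi> i t $ b) + (?K i *\<^sub>v coupling e i k) $ c"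
        unfolding rhs_def mult_mat_vec_index[OF ABK(1)[OF i] e[OF i] c, symmetric]
          mult_mat_vec_index[OF ABK(2)[OF i] \<xi>[OF i t] c, symmetric]
        using K ABK[OF i] c carrier_vecD[OF K] by (simp del: index_mult_mat_vec)
    qed
  qed
  have d_pos: "((\<lambda>s. d i s $ c) has_integral e i t $ c - e i 0 $ c) {0..t}"
    if i: "i \<in> nodes" and c: "c < n" and t: "0 \<le> t" for i c t
  proof (rule has_integral_if_sampled[OF _ t])
    fix k t assume t: "t \<in> {samp net k..samp net (Suc k)}"
    show "((\<lambda>s. d i s $ c) has_integral e i t $ c - e i (samp net k) $ c) {samp net k..t}"
      by (rule has_integral_spike[OF _ _ ode[OF i c t], of "{samp net (Suc k)}"]) (use t d_rhs in auto)
  qed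
  have d_neg: "((\<lambda>s. d i s $ c) has_integral e i b $ c - e i a $ c) {a..b}"
    if "i \<in> nodes" "c < n" "a \<le> b" "b \<le> 0" for i c a b
  proof -
    \<comment> \<open>At 0 itself \<open>d\<close> is already the right-hand side, so that point is
      exempted.\<close>
    have "((\<lambda>s. d i s $ c) has_integral 0) {a..b}"
      by (rule has_integral_spike[OF _ _ has_integral_0, of "{0}"]) (use that in \<open>auto simp: d_def\<close>)
    then show ?thesis using init that by simp
  qed
  have d_int: "((\<lambda>s. d i s $ c) has_integral e i b $ c - e i a $ c) {a..b}"
    if ic: "i \<in> nodes" "c < n" and ab: "a \<le> b" for i c a b
  proof -
    consider "b \<le> 0" | "a < 0" "0 < b" | "0 \<le> a" by linarith
    then show ?thesis
    proof cases
      case 1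
      then show ?thesis using d_neg[OF ic ab] by simp
    next
      case 2
      then have "((\<lambda>s. d i s $ c) has_integral (e i 0 $ c - e i a $ c) + (e i b $ c - e i 0 $ c)) {a..b}"
        by (intro has_integral_combine[of a 0 b] d_neg[OF ic] d_pos[OF ic]) auto
      then show ?thesis by simp
    next
      case 3
      then show ?thesis using has_integral_diff_interval[OF d_pos[OF ic] d_pos[OF ic] _ ab] ab by simp
    qed
  qed
  have d_sq: "sq_int a b (\<lambda>t. d i t $ c)" if ic: "i \<in> nodes" "c < n" and ab: "a \<le> b" for i c a b
  proof (rule sq_intI)
    show "(\<lambda>t. d i t $ c) integrable_on {a..b}" using d_int[OF ic ab] by blast
    have pos: "(\<lambda>t. (d i t $ c)\<^sup>2) integrable_on {0..b}" for b
    proof (rule integrable_on_if_sampled[OF _ order_refl])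
      fix k
      have "sq_int (samp net k) (samp net (Suc k)) (\<lambda>t. d i t $ c)"
        by (rule sq_int_spike[OF rhs_sq[OF ic]]) (simp add: d_rhs)
      then show "(\<lambda>t. (d i t $ c)\<^sup>2) integrable_on {samp net k..samp net (Suc k)}" by (simp add: sq_int_def)
    qed
    have neg: "(\<lambda>t. (d i t $ c)\<^sup>2) integrable_on {a..0}" for a
      by (rule integrable_spike[of "\<lambda>_. 0" _ "{0}"]) (use ic in \<open>auto simp: d_def\<close>)
    have "(\<lambda>t. (d i t $ c)\<^sup>2) integrable_on {- \<bar>a\<bar>..\<bar>b\<bar>}"
      by (rule Henstock_Kurzweil_Integration.integrable_combine[OF _ _ neg pos]) auto
    then show "(\<lambda>t. (d i t $ c)\<^sup>2) integrable_on {a..b}" by (rule integrable_on_subinterval) auto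
  qed
  have "rr_trajectory net \<gamma> Y X F U S R W G \<alpha> \<pi> \<epsilon> \<epsilon>' x0 e d \<xi>"
  proof unfold_locales
    fix i assume i: "i \<in> nodes"
    show "weak_deriv n (e i) (d i)"
      unfolding weak_deriv_def ac_on_def
      using e[OF i] d_carrier[OF i] d_sq[OF i] d_int[OF i] by (auto simp: sq_int_def)
    show "e i t = x0" if "t \<le> 0" for t using init[OF i that] .
    show "d i t = 0\<^sub>v n" if "t < 0" for t using that by (simp add: d_def)
    show "\<xi> i t \<in> carrier_vec m" if "0 \<le> t" for t using \<xi>[OF i that] .
    show "(\<lambda>t. \<xi> i t \<bullet> \<xi> i t) integrable_on {0..T}" for T
    proof -
      have sum: "(\<lambda>t. \<Sum>b<m. (\<xi> i t $ b)\<^sup>2) integrable_on {0..T}"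
        using \<xi>_sq[OF i] by (intro integrable_sum) (auto simp: sq_int_def)
      have "\<xi> i t \<bullet> \<xi> i t = (\<Sum>b<m. (\<xi> i t $ b)\<^sup>2)" if "0 \<le> t" for t
        using carrier_vecD[OF \<xi>[OF i that]] by (simp add: scalar_prod_def power2_eq_square lessThan_atLeast0)
      then show ?thesis by (intro integrable_eq[OF sum]) simp
    qed
    fix k t assume t: "samp net k \<le> t" "t < samp net (Suc k)"
    have t0: "0 \<le> t" using t s_nonneg[of k] by simp
    have XT: "(X i)\<^sup>T \<in> carrier_mat n n" using X[OF i] by auto
    have LC: "L i * outC net i \<in> carrier_mat n n" and LD: "L i * distD net i \<in> carrier_mat n m"
      using gains_carrier(3)[OF i] dims_i[OF i] by auto
    have XA: "(X i)\<^sup>T * ?A i = XAUC i"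
      unfolding mult_minus_distrib_mat[OF XT dims(1) LC] X_mult_gain[OF i U[OF i] dims_i(1)[OF i]] ..
    have XB: "(X i)\<^sup>T * ?B i = XBUD i"
      unfolding mult_minus_distrib_mat[OF XT dims(3) LD] X_mult_gain[OF i U[OF i] dims_i(5)[OF i]] ..
    have XK: "(X i)\<^sup>T * ?K i = FH i"
      by (rule X_mult_gain[OF i F[OF i] dims_i(2)[OF i]])
    have c: "?A i *\<^sub>v e i t \<in> carrier_vec n" "?B i *\<^sub>v \<xi> i t \<in> carrier_vec n" "?K i *\<^sub>v coupling e i k \<in> carrier_vec n"
      using ABK[OF i] e[OF i] \<xi>[OF i t0] by (auto intro!: mult_mat_vec_carrier)
    have "(X i)\<^sup>T *\<^sub>v d i t = (X i)\<^sup>T *\<^sub>v (?A i *\<^sub>v e i t) + (X i)\<^sup>T *\<^sub>v (?B i *\<^sub>v \<xi> i t)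
        + (X i)\<^sup>T *\<^sub>v (?K i *\<^sub>v coupling e i k)"
      unfolding d_rhs[OF t] rhs_def mult_add_distrib_mat_vec[OF XT add_carrier_vec[OF c(1,2)] c(3)]
        mult_add_distrib_mat_vec[OF XT c(1,2)] ..
    also have "\<dots> = XAUC i *\<^sub>v e i t + XBUD i *\<^sub>v \<xi> i t + FH i *\<^sub>v coupling e i k"
      unfolding XA[symmetric] XB[symmetric] XK[symmetric] assoc_mult_mat_vec[OF XT ABK(1)[OF i] e[OF i]]
        assoc_mult_mat_vec[OF XT ABK(2)[OF i] \<xi>[OF i t0]] assoc_mult_mat_vec[OF XT ABK(3)[OF i] coupling_carrier] ..
    finally show "(X i)\<^sup>T *\<^sub>v d i t = XAUC i *\<^sub>v e i t + XBUD i *\<^sub>v \<xi> i t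
        + FH i *\<^sub>v (nsum i (\<lambda>j. e j (samp net (held_index i j k))) - vsum n (p i) (\<lambda>\<mu>. e i (samp net (k - \<mu>))))"
      unfolding coupling_def .
  qed
  then show ?thesis by blast
qed

end

lemma bform_upper_bound:
  assumes "M \<in> carrier_mat k k"
  shows "\<exists>c\<ge>0. \<forall>u\<in>carrier_vec k. bform M u u \<le> c * (u \<bullet> u)"
proof (intro exI conjI ballI)
  let ?c = "\<Sum>a<k. \<Sum>b<k. \<bar>M $$ (a, b)\<bar>"
  show "0 \<le> ?c" by (intro sum_nonneg) auto
  fix u :: "real vec" assume u: "u \<in> carrier_vec k"
  have sq: "(u $ a)\<^sup>2 \<le> u \<bullet> u" if "a < k" for a
    using member_le_sum[of a "{..<k}" "\<lambda>a. (u $ a)\<^sup>2"] that u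
    by (simp add: scalar_prod_def power2_eq_square lessThan_atLeast0)
  have "bform M u u = (\<Sum>a<k. \<Sum>b<k. M $$ (a, b) * u $ a * u $ b)" using assms by (simp add: bform_def)
  also have "\<dots> \<le> (\<Sum>a<k. \<Sum>b<k. \<bar>M $$ (a, b)\<bar> * (u \<bullet> u))"
  proof (intro sum_mono)
    fix a b assume ab: "a \<in> {..<k}" "b \<in> {..<k}"
    have "2 * (\<bar>u $ a\<bar> * \<bar>u $ b\<bar>) \<le> (u $ a)\<^sup>2 + (u $ b)\<^sup>2"
      using zero_le_power2[of "\<bar>u $ a\<bar> - \<bar>u $ b\<bar>"] unfolding power2_diff power2_abs by linarith
    then have "\<bar>u $ a * u $ b\<bar> \<le> u \<bullet> u" using sq[of a] sq[of b] ab by (simp add: abs_mult)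
    then have "\<bar>M $$ (a, b)\<bar> * \<bar>u $ a * u $ b\<bar> \<le> \<bar>M $$ (a, b)\<bar> * (u \<bullet> u)"
      by (intro mult_left_mono) auto
    then show "M $$ (a, b) * u $ a * u $ b \<le> \<bar>M $$ (a, b)\<bar> * (u \<bullet> u)"
      using abs_ge_self[of "M $$ (a, b) * (u $ a * u $ b)"] unfolding abs_mult[of "M $$ (a, b)"] mult.assoc
      by linarith
  qed
  also have "\<dots> = ?c * (u \<bullet> u)" by (simp add: sum_distrib_right)
  finally show "bform M u u \<le> ?c * (u \<bullet> u)" .
qed

lemma vnorm_nonneg: "0 \<le> vnorm v"
  by (simp add: vnorm_def scalar_prod_def sum_nonneg)

lemma vnorm_power2: "(vnorm v)\<^sup>2 = v \<bullet> v"
  by (simp add: vnorm_def scalar_prod_def sum_nonneg)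

lemma scalar_prod_self_append: "(u @\<^sub>v v) \<bullet> (u @\<^sub>v v) = u \<bullet> u + v \<bullet> (v :: real vec)"
  by (rule scalar_prod_append[of _ "dim_vec u" _ "dim_vec v"]) auto

lemma hcat_mult_append:
  assumes "M \<in> carrier_mat k a" "Q \<in> carrier_mat k b" "u \<in> carrier_vec a" "v \<in> carrier_vec b"
  shows "hcat M Q *\<^sub>v (u @\<^sub>v v) = M *\<^sub>v u + Q *\<^sub>v v"
proof -
  have "four_block_mat M Q (0\<^sub>m 0 a) (0\<^sub>m 0 b) *\<^sub>v (u @\<^sub>v v)
      = (M *\<^sub>v u + Q *\<^sub>v v) @\<^sub>v (0\<^sub>m 0 a *\<^sub>v u + 0\<^sub>m 0 b *\<^sub>v v)"
    using assms by (intro four_block_mat_mult_vec) auto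
  also have "\<dots> = M *\<^sub>v u + Q *\<^sub>v v" using assms by (intro eq_vecI) auto
  finally show ?thesis using assms by (simp add: hcat_def)
qed

lemma L2_signal_sq_int:
  assumes z: "L2_signal k z" and b: "b < k"
  shows "sq_int 0 T (\<lambda>t. z t $ b)"
proof -
  have carrier: "\<And>t. 0 \<le> t \<Longrightarrow> z t \<in> carrier_vec k"
    and meas: "(\<lambda>t. indicator {0..} t * z t $ b) \<in> borel_measurable lebesgue"
    and int: "(\<lambda>t. (vnorm (z t))\<^sup>2) absolutely_integrable_on {0..}"
    using z b by (auto simp: L2_signal_def set_borel_measurable_def)
  have "(\<lambda>t. indicator {0..} t * z t $ b) \<in> borel_measurable (lebesgue_on {0..T})"
    using meas by (rule measurable_restrict_space1)
  then have m: "(\<lambda>t. z t $ b) \<in> borel_measurable (lebesgue_on {0..T})"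
    by (rule measurable_cong[THEN iffD1, rotated]) (auto simp: indicator_def)
  have n: "(\<lambda>t. (vnorm (z t))\<^sup>2) integrable_on {0..T}"
    using int by (intro integrable_on_subinterval[of _ "{0..}"]) (auto simp: absolutely_integrable_on_def)
  have sq: "(z t $ b)\<^sup>2 \<le> (vnorm (z t))\<^sup>2" if "0 \<le> t" for t
    using member_le_sum[of b "{..<k}" "\<lambda>a. (z t $ a)\<^sup>2"] b carrier[OF that] unfolding vnorm_power2
    by (simp add: scalar_prod_def power2_eq_square lessThan_atLeast0)
  show ?thesis
  proof (rule sq_intI)
    show "(\<lambda>t. (z t $ b)\<^sup>2) integrable_on {0..T}"
      by (rule measurable_bounded_by_integrable_imp_integrable[OF _ n])
        (use m sq in \<open>auto intro: borel_measurable_power\<close>)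
    show "(\<lambda>t. z t $ b) integrable_on {0..T}"
    proof (rule measurable_bounded_by_integrable_imp_integrable[OF m])
      show "(\<lambda>t. 1 + (vnorm (z t))\<^sup>2) integrable_on {0..T}" using n by (intro integrable_add) auto
      fix t assume "t \<in> {0..T}"
      then have "(z t $ b)\<^sup>2 \<le> (vnorm (z t))\<^sup>2" using sq by simp
      then show "norm (z t $ b) \<le> 1 + (vnorm (z t))\<^sup>2"
        using zero_le_power2[of "\<bar>z t $ b\<bar> - 1"] unfolding power2_diff power2_abs by simp
    qed auto
  qed
qed

text \<open>Monotone convergence over the intervals {0..k} carries bounds on finite horizons to the
  extended-valued cost, whose finiteness is thereby part of the conclusion.\<close>

lemma nn_integral_atLeast_le:
  fixes f :: "real \<Rightarrow> real"
  assumes cont: "continuous_on UNIV f" and nonneg: "\<And>t. 0 \<le> f t"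
    and bound: "\<And>T. 0 \<le> T \<Longrightarrow> integral {0..T} f \<le> B"
  shows "(\<integral>\<^sup>+t\<in>{0..}. ennreal (f t) \<partial>lebesgue) \<le> ennreal B"
proof -
  let ?g = "\<lambda>k t. ennreal (f t) * indicator {0..real k} t"
  have fm: "f \<in> borel_measurable lebesgue"
    using borel_measurable_continuous_onI[OF cont] by (intro measurable_completion) simp
  have sup: "ennreal (f t) * indicator {0..} t = (SUP k. ?g k t)" for t
  proof (cases "0 \<le> t")
    case True
    obtain k where k: "t \<le> real k" using real_arch_simple by blast
    have "(SUP k. ?g k t) = ennreal (f t)"
    proof (rule antisym)
      show "(SUP k. ?g k t) \<le> ennreal (f t)" by (intro SUP_least) (auto simp: indicator_def)
      show "ennreal (f t) \<le> (SUP k. ?g k t)" using True k by (intro SUP_upper2[of k]) auto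
    qed
    then show ?thesis using True by simp
  qed (simp add: indicator_def)
  have "(\<integral>\<^sup>+t\<in>{0..}. ennreal (f t) \<partial>lebesgue) = (\<integral>\<^sup>+t. (SUP k. ?g k t) \<partial>lebesgue)"
    by (simp only: sup)
  also have "\<dots> = (SUP k. \<integral>\<^sup>+t. ?g k t \<partial>lebesgue)"
  proof (rule nn_integral_monotone_convergence_SUP)
    show "incseq ?g" by (auto simp: incseq_def le_fun_def indicator_def)
    show "?g k \<in> borel_measurable lebesgue" for k
      using fm by (intro borel_measurable_times_ennreal borel_measurable_indicator
          measurable_compose[OF _ measurable_ennreal]) auto
  qed
  also have "\<dots> \<le> ennreal B"
  proof (rule SUP_least)
    fix k :: nat
    have "(f has_integral integral {0..real k} f) {0..real k}"
      by (intro integrable_integral integrable_continuous_real continuous_on_subset[OF cont]) auto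
    then have "(\<integral>\<^sup>+t. ?g k t \<partial>lebesgue) = ennreal (integral {0..real k} f)"
      unfolding nn_integral_completion using nonneg by (intro nn_integral_has_integral_lebesgue') auto
    then show "(\<integral>\<^sup>+t. ?g k t \<partial>lebesgue) \<le> ennreal B"
      using bound[of "real k"] by (simp add: ennreal_leI)
  qed
  finally show ?thesis .
qed

section \<open>Stability and performance\<close>

context rr_observers begin

lemma num_nodes_pos: "0 < num_nodes net"
proof -
  have "verts (with_proj (graph net)) \<noteq> {}"
    using wf unfolding rr_network_wf_def
    by (auto simp: Digraph_Component.connected_def strongly_connected_def)
  then show ?thesis using wf by (auto simp: rr_network_wf_def)
qed

abbreviation "P \<equiv> initial_weight net \<alpha> Y S"

lemma initial_energy_pos:
  assumes "i \<in> nodes" "u \<in> carrier_vec n" "u \<noteq> 0\<^sub>v n" shows "0 < initial_energy i u"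
proof -
  have "0 \<le> (1 - exp (- 2 * \<alpha> i * \<tau> i)) / (2 * \<alpha> i) * bform (S i) u u"
    using const_pos[OF assms(1)] delay_nonneg[OF assms(1)] S[OF assms(1)] assms(2)
    by (intro mult_nonneg_nonneg divide_nonneg_nonneg bform_pos_semidef[of "S i" n u]) auto
  moreover have "0 < bform (Yi i) u u" using Yi[OF assms(1)] assms by (intro bform_pos_def) auto
  ultimately show ?thesis by (simp only: initial_energy_def)
qed

lemma P_carrier: "P \<in> carrier_mat n n"
  by (simp add: initial_weight_def)

lemma bform_P:
  assumes "u \<in> carrier_vec n"
  shows "bform P u u = 1 / real (num_nodes net) * (\<Sum>i\<in>nodes. initial_energy i u)"
proof -
  let ?Q = "\<lambda>i. Yi i + ((1 - exp (- 2 * \<alpha> i * \<tau> i)) / (2 * \<alpha> i)) \<cdot>\<^sub>m S i"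
  have "bform P u u = (\<Sum>a<n. \<Sum>b<n. 1 / real (num_nodes net) * (\<Sum>i\<in>nodes. ?Q i $$ (a, b) * u $ a * u $ b))"
    by (simp add: bform_def initial_weight_def sum_distrib_right mult.assoc del: index_add_mat)
  also have "\<dots> = 1 / real (num_nodes net) * (\<Sum>a<n. \<Sum>b<n. \<Sum>i\<in>nodes. ?Q i $$ (a, b) * u $ a * u $ b)"
    by (simp only: sum_distrib_left)
  also have "(\<Sum>a<n. \<Sum>b<n. \<Sum>i\<in>nodes. ?Q i $$ (a, b) * u $ a * u $ b)
      = (\<Sum>a<n. \<Sum>i\<in>nodes. \<Sum>b<n. ?Q i $$ (a, b) * u $ a * u $ b)"
    by (intro sum.cong refl sum.swap)
  also have "\<dots> = (\<Sum>i\<in>nodes. \<Sum>a<n. \<Sum>b<n. ?Q i $$ (a, b) * u $ a * u $ b)" by (rule sum.swap)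
  also have "\<dots> = (\<Sum>i\<in>nodes. initial_energy i u)"
  proof (intro sum.cong refl)
    fix i assume i: "i \<in> nodes"
    have c: "((1 - exp (- 2 * \<alpha> i * \<tau> i)) / (2 * \<alpha> i)) \<cdot>\<^sub>m S i \<in> carrier_mat n n" using S[OF i] by auto
    have Q: "?Q i \<in> carrier_mat n n" using c by auto
    have "(\<Sum>a<n. \<Sum>b<n. ?Q i $$ (a, b) * u $ a * u $ b) = bform (?Q i) u u"
      unfolding bform_def carrier_matD[OF Q] ..
    also have "\<dots> = initial_energy i u"
      unfolding bform_add_mat[OF Yi(1)[OF i] c] bform_smult_mat initial_energy_def ..
    finally show "(\<Sum>a<n. \<Sum>b<n. ?Q i $$ (a, b) * u $ a * u $ b) = initial_energy i u" .
  qed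
  finally show ?thesis .
qed

lemma pos_def_P: "pos_def P"
  unfolding pos_def_def
proof (intro conjI ballI impI)
  let ?Q = "\<lambda>i. Yi i + ((1 - exp (- 2 * \<alpha> i * \<tau> i)) / (2 * \<alpha> i)) \<cdot>\<^sub>m S i"
  have entry: "?Q i $$ (b, a) = ?Q i $$ (a, b)" if "i \<in> nodes" "a < n" "b < n" for i a b
  proof -
    have "(Yi i)\<^sup>T $$ (a, b) = Yi i $$ (a, b)" "(S i)\<^sup>T $$ (a, b) = S i $$ (a, b)"
      using Yi[OF that(1)] S[OF that(1)] by (auto simp: pos_def_def pos_semidef_def)
    then show ?thesis using that Yi(1)[OF that(1)] S[OF that(1)] by auto
  qed
  show "P\<^sup>T = P"
  proof (rule eq_matI)
    fix a b assume "a < dim_row P" "b < dim_col P"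
    then have ab: "a < n" "b < n" using P_carrier by auto
    have "(\<Sum>i\<in>nodes. ?Q i $$ (b, a)) = (\<Sum>i\<in>nodes. ?Q i $$ (a, b))"
      by (intro sum.cong refl entry ab)
    then show "P\<^sup>T $$ (a, b) = P $$ (a, b)"
      using ab by (simp add: initial_weight_def del: index_add_mat index_smult_mat)
  qed (use P_carrier in auto)
  fix u :: "real vec" assume u: "u \<in> carrier_vec (dim_row P)" "u \<noteq> 0\<^sub>v (dim_row P)"
  then have u': "u \<in> carrier_vec n" "u \<noteq> 0\<^sub>v n" using P_carrier by auto
  have "0 < (\<Sum>i\<in>nodes. initial_energy i u)"
    using num_nodes_pos initial_energy_pos[OF _ u'] by (intro sum_pos) auto
  then have "0 < bform P u u" unfolding bform_P[OF u'(1)] using num_nodes_pos by simp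
  then show "0 < u \<bullet> (P *\<^sub>v u)" using scalar_mult_mat_vec[of u P u] u' P_carrier by simp
qed

end

context rr_observers begin

text \<open>At \<beta> = 0 all conditions hold strictly, and they depend continuously on \<beta>; as
  there are finitely many nodes, they persist on a common right neighbourhood of 0. The margins
  \<kappa> do not depend on \<beta> and are fixed beforehand.\<close>

lemma ex_admissible_pos: "\<exists>\<beta>>0. \<exists>\<kappa>. admissible \<beta> \<kappa>"
proof -
  have "\<exists>\<kappa>. \<forall>i\<in>nodes. 0 < \<kappa> i \<and> lmi_margin i (\<kappa> i)"
    using ex_lmi_margin by (intro bchoice) auto
  then obtain \<kappa> where \<kappa>: "\<And>i. i \<in> nodes \<Longrightarrow> 0 < \<kappa> i" "\<And>i. i \<in> nodes \<Longrightarrow> lmi_margin i (\<kappa> i)" by blast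
  have "\<exists>\<omega>. \<forall>i\<in>nodes. 0 \<le> \<omega> i \<and> (\<forall>u\<in>carrier_vec n. bform (W i) u u \<le> \<omega> i * (u \<bullet> u))"
    using bform_upper_bound W by (intro bchoice) blast
  then obtain \<omega> where \<omega>: "\<And>i. i \<in> nodes \<Longrightarrow> 0 \<le> \<omega> i"
    "\<And>i u. i \<in> nodes \<Longrightarrow> u \<in> carrier_vec n \<Longrightarrow> bform (W i) u u \<le> \<omega> i * (u \<bullet> u)" by blast
  let ?c = "\<lambda>i \<beta>. \<Sum>j | j \<in> nodes \<and> i \<in> V j. (exp (2 * \<beta> * \<tau> j) - 1) * (\<tau> j)\<^sup>2"
  have ev: "eventually (\<lambda>\<beta>. \<beta> < \<alpha> i \<and> real (q i) * \<pi> i + 2 * \<beta> < 2 * \<alpha> i \<and> ?c i \<beta> * \<omega> i < \<kappa> i) (at_right 0)"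
    if i: "i \<in> nodes" for i
  proof (intro eventually_conj)
    have "((\<lambda>\<beta>::real. \<beta>) \<longlongrightarrow> 0) (at_right 0)" by (rule tendsto_ident_at)
    then show "eventually (\<lambda>\<beta>. \<beta> < \<alpha> i) (at_right 0)"
      by (rule order_tendstoD(2)) (use const_pos[OF i] in auto)
    have "((\<lambda>\<beta>. real (q i) * \<pi> i + 2 * \<beta>) \<longlongrightarrow> real (q i) * \<pi> i + 2 * 0) (at_right 0)"
      by (intro tendsto_intros)
    then show "eventually (\<lambda>\<beta>. real (q i) * \<pi> i + 2 * \<beta> < 2 * \<alpha> i) (at_right 0)"
      by (rule order_tendstoD(2)) (use out_deg_bound[OF i] in auto)
    have "((\<lambda>\<beta>. ?c i \<beta> * \<omega> i) \<longlongrightarrow> ?c i 0 * \<omega> i) (at_right 0)" by (intro tendsto_intros)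
    then show "eventually (\<lambda>\<beta>. ?c i \<beta> * \<omega> i < \<kappa> i) (at_right 0)"
      by (rule order_tendstoD(2)) (use \<kappa>(1)[OF i] in simp)
  qed
  have "eventually (\<lambda>\<beta>. 0 < \<beta> \<and> (\<forall>i\<in>nodes. \<beta> < \<alpha> i \<and> real (q i) * \<pi> i + 2 * \<beta> < 2 * \<alpha> i \<and> ?c i \<beta> * \<omega> i < \<kappa> i)) (at_right 0)"
    by (intro eventually_conj eventually_ball_finite ballI ev eventually_at_right_less) auto
  then obtain \<beta> where \<beta>: "0 < \<beta>"
    "\<And>i. i \<in> nodes \<Longrightarrow> \<beta> < \<alpha> i \<and> real (q i) * \<pi> i + 2 * \<beta> < 2 * \<alpha> i \<and> ?c i \<beta> * \<omega> i < \<kappa> i"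
    using eventually_happens'[OF trivial_limit_at_right_real] by blast
  have "?c i \<beta> * bform (W i) u u \<le> \<kappa> i * (u \<bullet> u)" if i: "i \<in> nodes" and u: "u \<in> carrier_vec n" for i u
  proof -
    have c: "0 \<le> ?c i \<beta>"
      using \<beta>(1) delay_nonneg by (intro sum_nonneg mult_nonneg_nonneg) auto
    have "?c i \<beta> * bform (W i) u u \<le> ?c i \<beta> * (\<omega> i * (u \<bullet> u))"
      using \<omega>(2)[OF i u] c by (rule mult_left_mono)
    also have "\<dots> = (?c i \<beta> * \<omega> i) * (u \<bullet> u)" by (simp only: mult.assoc)
    also have "\<dots> \<le> \<kappa> i * (u \<bullet> u)"
      using \<beta>(2)[OF i] by (intro mult_right_mono) (auto intro: scalar_prod_self_nonneg)
    finally show ?thesis .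
  qed
  then have "admissible \<beta> \<kappa>"
    using \<beta> \<kappa>(2) unfolding admissible_def by (auto intro: less_imp_le)
  then show ?thesis using \<beta>(1) by blast
qed

lemma errors_exp_stable: "errors_exp_stable net L K"
proof -
  obtain \<beta> \<kappa> where \<beta>: "0 < \<beta>" and adm: "admissible \<beta> \<kappa>" using ex_admissible_pos by blast
  have "\<exists>l. \<forall>i\<in>nodes. 0 < l i \<and> (\<forall>u\<in>carrier_vec n. l i * (u \<bullet> u) \<le> bform (Yi i) u u)"
    using pos_def_coercive Yi by (intro bchoice) blast
  then obtain l where l: "\<And>i. i \<in> nodes \<Longrightarrow> 0 < l i"
    "\<And>i u. i \<in> nodes \<Longrightarrow> u \<in> carrier_vec n \<Longrightarrow> l i * (u \<bullet> u) \<le> bform (Yi i) u u" by blast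
  obtain c where c: "0 \<le> c" "\<And>u. u \<in> carrier_vec n \<Longrightarrow> bform P u u \<le> c * (u \<bullet> u)"
    using bform_upper_bound[OF P_carrier] by blast
  define C where "C = real (num_nodes net) * c"
  have C: "0 \<le> C" using c by (simp add: C_def)
  have C_bound: "(\<Sum>i\<in>nodes. initial_energy i u) \<le> C * (u \<bullet> u)" if "u \<in> carrier_vec n" for u
    using c(2)[OF that] num_nodes_pos unfolding bform_P[OF that] C_def by (simp add: field_simps)
  \<comment> \<open>The sum dominates the constant of every single node; the summand 1 keeps
    \<open>M\<close> positive even when \<open>C\<close> is 0.\<close>
  define M where "M = 1 + (\<Sum>i\<in>nodes. sqrt (C / l i))"
  have M: "0 < M" "\<And>i. i \<in> nodes \<Longrightarrow> sqrt (C / l i) \<le> M"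
  proof -
    have nn: "0 \<le> sqrt (C / l i)" if "i \<in> nodes" for i using C l(1)[OF that] by simp
    show "0 < M" unfolding M_def using nn by (intro add_pos_nonneg sum_nonneg) auto
    show "sqrt (C / l i) \<le> M" if "i \<in> nodes" for i
      using member_le_sum[of i nodes "\<lambda>i. sqrt (C / l i)"] nn that unfolding M_def by simp
  qed
  have "vnorm (e i t) \<le> M * exp (- \<beta> * t) * vnorm x0"
    if x0: "x0 \<in> carrier_vec n" and e: "error_solution net L K x0 (\<lambda>i t. 0\<^sub>v m) e"
      and i: "i \<in> nodes" and t: "0 \<le> t" for x0 e i t
  proof -
    have "sq_int 0 T (\<lambda>t. (0\<^sub>v m :: real vec) $ b)" if "b < m" for b T
      using that by (intro sq_int_continuous) auto
    then obtain d where "rr_trajectory net \<gamma> Y X F U S R W G \<alpha> \<pi> \<epsilon> \<epsilon>' x0 e d (\<lambda>i t. 0\<^sub>v m)"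
      using error_solution_trajectory[OF e x0] by auto
    then interpret T: rr_trajectory net \<gamma> Y X F U S R W G \<alpha> \<pi> \<epsilon> \<epsilon>' x0 e d "\<lambda>i t. 0\<^sub>v m" .
    have pow: "T.dist_power s = 0" for s by (simp add: T.dist_power_def)
    have "0 \<le> integral {0..t} (\<lambda>s. exp (2 * \<beta> * s) * (T.disagreement s / \<gamma>\<^sup>2))"
      by (intro integral_nonneg integrable_continuous_real continuous_intros T.disagreement_continuous)
        (use gamma_pos T.disagreement_nonneg in auto)
    then have "exp (2 * \<beta> * t) * (\<Sum>i\<in>nodes. bform (Yi i) (e i t) (e i t)) \<le> (\<Sum>i\<in>nodes. initial_energy i x0)"
      using T.energy_bound[OF adm t] by (simp add: pow)
    also have "\<dots> \<le> C * (x0 \<bullet> x0)" by (rule C_bound[OF x0])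
    finally have bound: "exp (2 * \<beta> * t) * (\<Sum>i\<in>nodes. bform (Yi i) (e i t) (e i t)) \<le> C * (x0 \<bullet> x0)" .
    have "l i * (e i t \<bullet> e i t) \<le> bform (Yi i) (e i t) (e i t)" by (rule l(2)[OF i T.z_carrier(1)[OF i]])
    also have "\<dots> \<le> (\<Sum>i\<in>nodes. bform (Yi i) (e i t) (e i t))"
      using i by (intro member_le_sum Yi_nonneg T.z_carrier) auto
    finally have "exp (2 * \<beta> * t) * (l i * (e i t \<bullet> e i t)) \<le> C * (x0 \<bullet> x0)"
      using bound by (meson exp_ge_zero mult_left_mono order_trans)
    then have "(vnorm (e i t))\<^sup>2 \<le> C / l i * exp (- (2 * \<beta> * t)) * (x0 \<bullet> x0)"
      using l(1)[OF i] by (simp add: vnorm_power2 exp_minus field_simps)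
    also have "\<dots> = (sqrt (C / l i) * exp (- \<beta> * t) * vnorm x0)\<^sup>2"
      using C l(1)[OF i] by (simp add: power_mult_distrib vnorm_power2 exp_double[symmetric] algebra_simps)
    finally have "vnorm (e i t) \<le> sqrt (C / l i) * exp (- \<beta> * t) * vnorm x0"
      by (rule power2_le_imp_le) (use C l(1)[OF i] vnorm_nonneg in simp)
    also have "\<dots> \<le> M * exp (- \<beta> * t) * vnorm x0"
      using M(2)[OF i] vnorm_nonneg by (intro mult_right_mono) auto
    finally show ?thesis .
  qed
  then show ?thesis unfolding errors_exp_stable_def using M(1) \<beta> by blast
qed

text \<open>The plant state enters both sums at the same p sample indices, by
  \<open>sum_rr_pos\<close>, and cancels.\<close>

lemma coupling_error:
  assumes i: "i \<in> nodes" and x: "\<And>t. x t \<in> carrier_vec n" and xh: "\<And>j t. j \<in> nodes \<Longrightarrow> xh j t \<in> carrier_vec n"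
  shows "coupling (\<lambda>j t. x t - xh j t) i k = - coupling xh i k"
proof (rule eq_vecI)
  fix c assume "c < dim_vec (- coupling xh i k)"
  then have c: "c < n" by (simp add: carrier_vecD[OF coupling_carrier])
  have 1: "(\<Sum>j\<in>V i. (x (samp net (held_index i j k)) - xh j (samp net (held_index i j k))) $ c)
     = (\<Sum>j\<in>V i. x (samp net (held_index i j k)) $ c) - (\<Sum>j\<in>V i. xh j (samp net (held_index i j k)) $ c)"
    unfolding sum_subtractf[symmetric]
    using c carrier_vecD[OF xh[OF nbr_node]] by (intro sum.cong refl) simp
  have 2: "(\<Sum>\<mu><p i. (x (samp net (k - \<mu>)) - xh i (samp net (k - \<mu>))) $ c)
     = (\<Sum>\<mu><p i. x (samp net (k - \<mu>)) $ c) - (\<Sum>\<mu><p i. xh i (samp net (k - \<mu>)) $ c)"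
    unfolding sum_subtractf[symmetric]
    using c carrier_vecD[OF xh[OF i]] by (intro sum.cong refl) simp
  show "coupling (\<lambda>j t. x t - xh j t) i k $ c = (- coupling xh i k) $ c"
    using c 1 2 sum_rr_pos[of "\<lambda>l. x (samp net l) $ c" i k]
    by (simp add: coupling_def nsum_def vsum_def)
qed (simp add: carrier_vecD[OF coupling_carrier])

lemma finsum_output_diff:
  assumes i: "i \<in> nodes" and e: "\<And>j t. j \<in> nodes \<Longrightarrow> e j t \<in> carrier_vec n"
    and init: "\<And>j. j \<in> nodes \<Longrightarrow> e j 0 = x0"
  shows "finsum_vec TYPE(real) (dim_h net i) (\<lambda>j. obsH net i *\<^sub>v sampled_diff net k i e j) (set (rr_order net k i))
    = obsH net i *\<^sub>v coupling e i k"
proof -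
  note H = dims_i(2)[OF i]
  have x0: "x0 \<in> carrier_vec n" using e[OF i, of 0] init[OF i] by simp
  have sd: "sampled_diff net k i e j \<in> carrier_vec n" if "j \<in> V i" for j
    using sampled_diff_held[OF that, of e x0] init nbr_node[OF that] i x0 e by auto
  have "coupling e i k = vec n (\<lambda>c. \<Sum>j\<in>V i. sampled_diff net k i e j $ c)"
    using finsum_sampled_diff[of i e x0 k] finsum_vec_eq_vec[of "V i" "sampled_diff net k i e" n] i e init sd by auto
  then have coup: "coupling e i k $ b = (\<Sum>j\<in>V i. sampled_diff net k i e j $ b)" if "b < n" for b
    using that by simp
  show ?thesis
  proof (rule eq_vecI)
    fix c assume "c < dim_vec (obsH net i *\<^sub>v coupling e i k)"
    then have c: "c < dim_h net i" using H by simp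
    have "(\<Sum>j\<in>V i. (obsH net i *\<^sub>v sampled_diff net k i e j) $ c)
        = (\<Sum>j\<in>V i. \<Sum>b<n. obsH net i $$ (c, b) * sampled_diff net k i e j $ b)"
      using sd by (intro sum.cong refl mult_mat_vec_index[OF H _ c])
    also have "\<dots> = (\<Sum>b<n. \<Sum>j\<in>V i. obsH net i $$ (c, b) * sampled_diff net k i e j $ b)" by (rule sum.swap)
    also have "\<dots> = (\<Sum>b<n. obsH net i $$ (c, b) * coupling e i k $ b)"
      by (intro sum.cong refl) (simp add: coup sum_distrib_left)
    also have "\<dots> = (obsH net i *\<^sub>v coupling e i k) $ c"
      by (rule mult_mat_vec_index[OF H coupling_carrier c, symmetric])
    finally show "finsum_vec TYPE(real) (dim_h net i) (\<lambda>j. obsH net i *\<^sub>v sampled_diff net k i e j)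
       (set (rr_order net k i)) $ c = (obsH net i *\<^sub>v coupling e i k) $ c"
      using H sd c by (subst finsum_vec_eq_vec) (auto intro!: mult_mat_vec_carrier)
  qed (use H sd in \<open>subst finsum_vec_eq_vec, auto intro!: mult_mat_vec_carrier\<close>)
qed

lemma error_rhs:
  assumes i: "i \<in> nodes" and a: "a \<in> carrier_vec n" and b: "b \<in> carrier_vec n"
    and w: "w \<in> carrier_vec (dim_w net)" and v: "v \<in> carrier_vec (dim_v net)" and y: "y \<in> carrier_vec n"
  shows "plantA net *\<^sub>v a + plantB2 net *\<^sub>v w -
      (plantA net *\<^sub>v b + L i *\<^sub>v (outC net i *\<^sub>v a + outD2 net i *\<^sub>v w + outDbar net i *\<^sub>v v - outC net i *\<^sub>v b)
        + K i *\<^sub>v (obsH net i *\<^sub>v y))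
    = (plantA net - L i * outC net i) *\<^sub>v (a - b) + (distB net - L i * distD net i) *\<^sub>v (w @\<^sub>v v)
        + (K i * obsH net i) *\<^sub>v (- y)"
proof -
  note Lc = gains_carrier(3)[OF i] and Kc = gains_carrier(4)[OF i] and D = dims_i[OF i]
  let ?A = "plantA net" and ?C = "outC net i" and ?D = "outD2 net i" and ?E = "outDbar net i"
  have wv: "w @\<^sub>v v \<in> carrier_vec m" using w v by simp
  have LC: "L i * ?C \<in> carrier_mat n n" and LD: "L i * distD net i \<in> carrier_mat n m"
    and KH: "K i * obsH net i \<in> carrier_mat n n"
    using Lc Kc D by auto
  have oc: "?C *\<^sub>v a \<in> carrier_vec (dim_y net i)" "?C *\<^sub>v b \<in> carrier_vec (dim_y net i)"
    "?D *\<^sub>v w \<in> carrier_vec (dim_y net i)" "?E *\<^sub>v v \<in> carrier_vec (dim_y net i)"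
    using D a b w v by (auto intro!: mult_mat_vec_carrier)
  have Bw: "distB net *\<^sub>v (w @\<^sub>v v) = plantB2 net *\<^sub>v w"
    unfolding distB_def hcat_mult_append[OF dims(2) zero_carrier_mat w v]
    using dims(2) w v by (intro eq_vecI) auto
  have Dw: "distD net i *\<^sub>v (w @\<^sub>v v) = ?D *\<^sub>v w + ?E *\<^sub>v v"
    unfolding distD_def by (rule hcat_mult_append[OF D(3,4) w v])
  have r1: "(?A - L i * ?C) *\<^sub>v (a - b)
      = (?A *\<^sub>v a - L i *\<^sub>v (?C *\<^sub>v a)) - (?A *\<^sub>v b - L i *\<^sub>v (?C *\<^sub>v b))"
    unfolding mult_minus_distrib_mat_vec[OF minus_carrier_mat[OF LC] a b]
      minus_mult_distrib_mat_vec[OF dims(1) LC a] minus_mult_distrib_mat_vec[OF dims(1) LC b]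
      assoc_mult_mat_vec[OF Lc D(1) a] assoc_mult_mat_vec[OF Lc D(1) b] ..
  have r2: "(distB net - L i * distD net i) *\<^sub>v (w @\<^sub>v v)
      = plantB2 net *\<^sub>v w - (L i *\<^sub>v (?D *\<^sub>v w) + L i *\<^sub>v (?E *\<^sub>v v))"
    unfolding minus_mult_distrib_mat_vec[OF dims(3) LD wv] assoc_mult_mat_vec[OF Lc D(5) wv] Bw Dw
      mult_add_distrib_mat_vec[OF Lc oc(3,4)] ..
  have r3: "(K i * obsH net i) *\<^sub>v (- y) = - (K i *\<^sub>v (obsH net i *\<^sub>v y))"
    unfolding assoc_mult_mat_vec[OF Kc D(2) y, symmetric] using KH y by (intro eq_vecI) (auto simp: scalar_prod_def sum_negf)
  have r4: "L i *\<^sub>v (?C *\<^sub>v a + ?D *\<^sub>v w + ?E *\<^sub>v v - ?C *\<^sub>v b)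
      = L i *\<^sub>v (?C *\<^sub>v a) + L i *\<^sub>v (?D *\<^sub>v w) + L i *\<^sub>v (?E *\<^sub>v v) - L i *\<^sub>v (?C *\<^sub>v b)"
    unfolding mult_minus_distrib_mat_vec[OF Lc add_carrier_vec[OF add_carrier_vec[OF oc(1,3)] oc(4)] oc(2)]
      mult_add_distrib_mat_vec[OF Lc add_carrier_vec[OF oc(1,3)] oc(4)] mult_add_distrib_mat_vec[OF Lc oc(1,3)] ..
  have c: "?A *\<^sub>v a \<in> carrier_vec n" "?A *\<^sub>v b \<in> carrier_vec n" "plantB2 net *\<^sub>v w \<in> carrier_vec n"
    "L i *\<^sub>v (?C *\<^sub>v a) \<in> carrier_vec n" "L i *\<^sub>v (?C *\<^sub>v b) \<in> carrier_vec n" "L i *\<^sub>v (?D *\<^sub>v w) \<in> carrier_vec n"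
    "L i *\<^sub>v (?E *\<^sub>v v) \<in> carrier_vec n" "K i *\<^sub>v (obsH net i *\<^sub>v y) \<in> carrier_vec n"
    using dims a b w v y Lc Kc D oc by (auto intro!: mult_mat_vec_carrier)
  \<comment> \<open>Regrouping of vectors, stated for arbitrary vectors so that it can be checked
    entry by entry.\<close>
  have alg: "(u1 + u2) - ((u3 + (u4 + u5 + u6 - u7)) + u8) = (((u1 - u4) - (u3 - u7)) + (u2 - (u5 + u6))) + - u8"
    if "u1 \<in> carrier_vec n" "u2 \<in> carrier_vec n" "u3 \<in> carrier_vec n" "u4 \<in> carrier_vec n" "u5 \<in> carrier_vec n"
      "u6 \<in> carrier_vec n" "u7 \<in> carrier_vec n" "u8 \<in> carrier_vec n" for u1 u2 u3 u4 u5 u6 u7 u8 :: "real vec"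
    using that by (intro eq_vecI) auto
  show ?thesis unfolding r1 r2 r3 r4 by (rule alg[OF c(1,3,2,4,6,7,5,8)])
qed

lemma observer_error_solution:
  assumes plant: "plant_solution net x0 w x" and obs: "observer_solution net L K (measurement net w v x) xh"
    and w: "\<And>t. 0 \<le> t \<Longrightarrow> w t \<in> carrier_vec (dim_w net)"
    and v: "\<And>i t. i \<in> nodes \<Longrightarrow> 0 \<le> t \<Longrightarrow> v i t \<in> carrier_vec (dim_v net)"
  shows "error_solution net L K x0 (node_dist w v) (\<lambda>i t. x t - xh i t)"
  unfolding error_solution_def ode_on_def
proof (intro ballI conjI allI impI)
  have x: "x t \<in> carrier_vec n" "t \<le> 0 \<Longrightarrow> x t = x0" for t using plant by (auto simp: plant_solution_def)
  have xh: "xh i t \<in> carrier_vec n" "t \<le> 0 \<Longrightarrow> xh i t = 0\<^sub>v n" if "i \<in> nodes" for i t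
    using obs that by (auto simp: observer_solution_def)
  fix i assume i: "i \<in> nodes"
  show e: "x t - xh i t \<in> carrier_vec n" for t using x xh(1)[OF i] by auto
  show e0: "x t - xh i t = x0" if "t \<le> 0" for t
    using x(2)[OF that] xh(2)[OF i that] x(1)[of t] by simp
  fix k t c assume t: "t \<in> {samp net k..samp net (k + 1)}" and c: "c < n"
  \<comment> \<open>The plant equation is integrated from 0, the observers from each sampling time;
    both are brought to the same interval.\<close>
  have P: "((\<lambda>s. (plantA net *\<^sub>v x s + plantB2 net *\<^sub>v w s) $ c) has_integral x t $ c - x (samp net k) $ c) {samp net k..t}"
  proof (rule has_integral_diff_interval)
    show "((\<lambda>s. (plantA net *\<^sub>v x s + plantB2 net *\<^sub>v w s) $ c) has_integral x (samp net k) $ c - x 0 $ c) {0..samp net k}"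
      "((\<lambda>s. (plantA net *\<^sub>v x s + plantB2 net *\<^sub>v w s) $ c) has_integral x t $ c - x 0 $ c) {0..t}"
      using plant c t s_nonneg[of k] by (auto simp: plant_solution_def ode_on_def)
  qed (use t s_nonneg[of k] in auto)
  have fo: "finsum_vec TYPE(real) (dim_h net i) (\<lambda>j. obsH net i *\<^sub>v sampled_diff net k i xh j) (set (rr_order net k i))
      = obsH net i *\<^sub>v coupling xh i k"
    using i xh by (intro finsum_output_diff) auto
  have fe: "finsum_vec TYPE(real) n (sampled_diff net k i (\<lambda>i t. x t - xh i t)) (set (rr_order net k i)) = - coupling xh i k"
  proof -
    have "x 0 - xh j 0 = x0" if "j \<in> nodes" for j using x(2)[of 0] xh(2)[OF that, of 0] x(1)[of 0] by simp
    then have "finsum_vec TYPE(real) n (sampled_diff net k i (\<lambda>i t. x t - xh i t)) (set (rr_order net k i))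
        = coupling (\<lambda>i t. x t - xh i t) i k"
      using x(1) xh(1) by (intro finsum_sampled_diff[of i _ x0] i) auto
    also have "\<dots> = - coupling xh i k" by (intro coupling_error i x(1) xh(1))
    finally show ?thesis .
  qed
  let ?obs = "\<lambda>s. plantA net *\<^sub>v xh i s + L i *\<^sub>v (measurement net w v x i s - outC net i *\<^sub>v xh i s)
      + K i *\<^sub>v (obsH net i *\<^sub>v coupling xh i k)"
  have O: "((\<lambda>s. ?obs s $ c) has_integral xh i t $ c - xh i (samp net k) $ c) {samp net k..t}"
    using obs i t c unfolding observer_solution_def ode_on_def fo[symmetric] by blast
  let ?err = "\<lambda>s. (plantA net - L i * outC net i) *\<^sub>v (x s - xh i s)
      + (distB net - L i * distD net i) *\<^sub>v node_dist w v i s + (K i * obsH net i) *\<^sub>v (- coupling xh i k)"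
  have "((\<lambda>s. ?err s $ c) has_integral (x t $ c - x (samp net k) $ c) - (xh i t $ c - xh i (samp net k) $ c)) {samp net k..t}"
  proof (rule has_integral_eq[OF _ has_integral_diff[OF P O]])
    fix s assume "s \<in> {samp net k..t}"
    then have s: "0 \<le> s" using s_nonneg[of k] by auto
    have eq: "plantA net *\<^sub>v x s + plantB2 net *\<^sub>v w s - ?obs s = ?err s"
      unfolding measurement_def node_dist_def
      by (rule error_rhs[OF i x(1) xh(1)[OF i] w[OF s] v[OF i s] coupling_carrier])
    have "?obs s \<in> carrier_vec n"
      using gains_carrier(4)[OF i] by (intro carrier_vecI) (simp add: carrier_matD[OF gains_carrier(4)[OF i]] del: index_mult_mat)
    then show "(plantA net *\<^sub>v x s + plantB2 net *\<^sub>v w s) $ c - ?obs s $ c = ?err s $ c"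
      unfolding eq[symmetric] using c by (simp only: index_minus_vec(1) carrier_vecD)
  qed
  moreover have "(x t $ c - x (samp net k) $ c) - (xh i t $ c - xh i (samp net k) $ c)
      = (x t - xh i t) $ c - (x (samp net k) - xh i (samp net k)) $ c"
    using c carrier_vecD[OF xh(1)[OF i]] by simp
  ultimately show "((\<lambda>s. ((plantA net - L i * outC net i) *\<^sub>v (x s - xh i s)
      + (distB net - L i * distD net i) *\<^sub>v node_dist w v i s
      + (K i * obsH net i) *\<^sub>v finsum_vec TYPE(real) n
          (sampled_diff net k i (\<lambda>i t. x t - xh i t)) (set (rr_order net k i))) $ c)
     has_integral (x t - xh i t) $ c - (x (samp net k) - xh i (samp net k)) $ c) {samp net k..t}"
    unfolding fe by simp
qed

lemma vnorm_stacked: "(vnorm (stacked_dist net w v t))\<^sup>2 = (\<Sum>i\<in>nodes. node_dist w v i t \<bullet> node_dist w v i t)"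
proof -
  have "(foldr (\<lambda>i u. f i @\<^sub>v u) ks vNil) \<bullet> (foldr (\<lambda>i u. f i @\<^sub>v u) ks vNil) = (\<Sum>i\<leftarrow>ks. f i \<bullet> f i)" for f :: "nat \<Rightarrow> real vec" and ks
    by (induction ks) (auto simp: scalar_prod_self_append scalar_prod_def[of vNil])
  moreover have "(\<Sum>i\<leftarrow>[1..<Suc (num_nodes net)]. f i) = (\<Sum>i\<in>nodes. f i)" for f :: "nat \<Rightarrow> real"
    by (simp only: interv_sum_list_conv_sum_set_nat set_upt) (simp add: atLeastLessThanSuc_atLeastAtMost)
  ultimately show ?thesis by (simp only: vnorm_power2 stacked_dist_def)
qed

lemma integral_dist_le_signal_norm:
  assumes w: "L2_signal (dim_w net) w" and v: "\<And>i. i \<in> nodes \<Longrightarrow> L2_signal (dim_v net) (v i)" and T: "0 \<le> T"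
  shows "integral {0..T} (\<lambda>t. \<Sum>i\<in>nodes. node_dist w v i t \<bullet> node_dist w v i t) \<le> (signal_norm (stacked_dist net w v))\<^sup>2"
proof -
  let ?f = "\<lambda>t. \<Sum>i\<in>nodes. node_dist w v i t \<bullet> node_dist w v i t"
  have "(\<lambda>t. \<Sum>i\<in>nodes. (vnorm (w t))\<^sup>2 + (vnorm (v i t))\<^sup>2) absolutely_integrable_on {0..}"
    using w v by (intro absolutely_integrable_sum set_integral_add) (auto simp: L2_signal_def)
  then have f: "?f absolutely_integrable_on {0..}"
    by (simp add: node_dist_def scalar_prod_self_append vnorm_power2)
  have nonneg: "0 \<le> ?f t" for t by (intro sum_nonneg scalar_prod_self_nonneg)
  have int: "?f integrable_on {0..}" using f by (simp add: absolutely_integrable_on_def)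
  have "integral {0..T} ?f \<le> integral {0..} ?f"
    using int nonneg by (intro integral_subset_le) (auto intro: integrable_on_subinterval)
  also have "\<dots> = (LINT t:{0..}|lebesgue. ?f t)"
    using set_lebesgue_integral_eq_integral(2)[OF f] by simp
  also have "\<dots> = (signal_norm (stacked_dist net w v))\<^sup>2"
    using integral_nonneg[OF int] nonneg set_lebesgue_integral_eq_integral(2)[OF f]
    by (simp add: signal_norm_def vnorm_stacked)
  finally show ?thesis .
qed

text \<open>The energy inequality is taken at rate 0 with zero margins: only then is the disturbance
  integral unweighted and hence bounded by the signal norm. The final Y energy is nonnegative and
  dropped.\<close>

lemma performance_bound: "performance_bound net L K \<gamma> P"
  unfolding performance_bound_def
proof (rule Sup_least, clarify)
  let ?N = "real (num_nodes net)"
  fix x0 w v x xh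
  assume x0: "x0 \<in> carrier_vec n" and w: "L2_signal (dim_w net) w"
    and v: "\<forall>i\<in>nodes. L2_signal (dim_v net) (v i)"
    and nz: "x0 \<noteq> 0\<^sub>v n \<or> signal_norm (stacked_dist net w v) \<noteq> 0"
    and plant: "plant_solution net x0 w x" and obs: "observer_solution net L K (measurement net w v x) xh"
  define s where "s = (signal_norm (stacked_dist net w v))\<^sup>2"
  define D where "D = x0 \<bullet> (P *\<^sub>v x0) + 1 / ?N * s"
  have N: "0 < ?N" using num_nodes_pos by simp
  have P: "x0 \<bullet> (P *\<^sub>v x0) = bform P x0 x0"
    using scalar_mult_mat_vec[of x0 P x0] x0 P_carrier by simp
  \<comment> \<open>A nonzero denominator is what the division of extended reals below asks for;
    either the initial state or the disturbance provides it.\<close>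
  have D: "0 < D"
  proof (cases "x0 = 0\<^sub>v n")
    case True
    then have "0 < s" using nz by (simp add: s_def)
    moreover have "bform P x0 x0 = 0" using True bform_zero_left[OF P_carrier] by simp
    ultimately show ?thesis using N by (simp add: D_def P)
  next
    case False
    then have "0 < bform P x0 x0" using bform_pos_def[OF pos_def_P P_carrier x0] by simp
    moreover have "0 \<le> s" by (simp add: s_def)
    ultimately show ?thesis using N by (simp add: D_def P add_pos_nonneg)
  qed
  let ?e = "\<lambda>i t. x t - xh i t" and ?\<xi> = "node_dist w v"
  have wc: "\<And>t. 0 \<le> t \<Longrightarrow> w t \<in> carrier_vec (dim_w net)"
    and vc: "\<And>i t. i \<in> nodes \<Longrightarrow> 0 \<le> t \<Longrightarrow> v i t \<in> carrier_vec (dim_v net)"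
    using w v by (auto simp: L2_signal_def)
  have "error_solution net L K x0 ?\<xi> ?e" by (rule observer_error_solution[OF plant obs wc vc])
  moreover have "?\<xi> i t \<in> carrier_vec m" if "i \<in> nodes" "0 \<le> t" for i t
    using wc[OF that(2)] vc[OF that] by (simp add: node_dist_def)
  moreover have "sq_int 0 T (\<lambda>t. ?\<xi> i t $ b)" if i: "i \<in> nodes" and b: "b < m" for i b T
  proof (cases "b < dim_w net")
    case True
    show ?thesis
      by (rule sq_int_spike[OF L2_signal_sq_int[OF w True]])
        (simp add: node_dist_def True carrier_vecD[OF wc] trans_less_add1)
  next
    case False
    then have b': "b - dim_w net < dim_v net" using b by simp
    show ?thesis
      by (rule sq_int_spike[OF L2_signal_sq_int[OF v[rule_format, OF i] b']])
        (use False b in \<open>simp add: node_dist_def carrier_vecD[OF wc] carrier_vecD[OF vc[OF i]]\<close>)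
  qed
  ultimately obtain d where "rr_trajectory net \<gamma> Y X F U S R W G \<alpha> \<pi> \<epsilon> \<epsilon>' x0 ?e d ?\<xi>"
    using error_solution_trajectory[OF _ x0] by blast
  then interpret T: rr_trajectory net \<gamma> Y X F U S R W G \<alpha> \<pi> \<epsilon> \<epsilon>' x0 ?e d ?\<xi> .
  have xc: "x t \<in> carrier_vec n" and xhc: "i \<in> nodes \<Longrightarrow> xh i t \<in> carrier_vec n" for i t
    using plant obs by (auto simp: plant_solution_def observer_solution_def)
  \<comment> \<open>The plant state cancels in differences, so the cost measures the disagreement of
    the errors as well.\<close>
  have dis: "(\<Sum>i\<in>nodes. \<Sum>j\<in>V i. (vnorm (xh j t - xh i t))\<^sup>2) = T.disagreement t" for t
    unfolding T.disagreement_def vnorm_power2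
  proof (intro sum.cong refl)
    fix i j assume "i \<in> nodes" "j \<in> V i"
    then have "dim_vec (xh i t) = n" "dim_vec (xh j t) = n" "dim_vec (x t) = n"
      using xhc xc by (auto dest: nbr_node)
    then show "(xh j t - xh i t) \<bullet> (xh j t - xh i t) = (x t - xh j t - (x t - xh i t)) \<bullet> (x t - xh j t - (x t - xh i t))"
      by (auto simp: scalar_prod_def algebra_simps intro!: sum.cong)
  qed
  have "integral {0..T} T.disagreement \<le> ?N * (\<gamma>\<^sup>2 * D)" if T: "0 \<le> T" for T
  proof -
    have "0 \<le> (\<Sum>i\<in>nodes. bform (Yi i) (?e i T) (?e i T))"
      by (intro sum_nonneg Yi_nonneg T.z_carrier)
    moreover have "integral {0..T} T.dist_power \<le> s"
      using integral_dist_le_signal_norm[OF w v[rule_format] T] unfolding T.dist_power_def s_def .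
    moreover have "(\<Sum>i\<in>nodes. initial_energy i x0) = ?N * bform P x0 x0"
      unfolding bform_P[OF x0] using N by simp
    moreover have "?N * D = ?N * bform P x0 x0 + s" unfolding D_def P using N by (simp add: field_simps)
    moreover have "(\<Sum>i\<in>nodes. bform (Yi i) (?e i T) (?e i T)) + integral {0..T} T.disagreement / \<gamma>\<^sup>2
        \<le> (\<Sum>i\<in>nodes. initial_energy i x0) + integral {0..T} T.dist_power"
      using T.energy_bound[OF admissible_zero T] by simp
    ultimately have "integral {0..T} T.disagreement / \<gamma>\<^sup>2 \<le> ?N * D" by linarith
    then show ?thesis using gamma_pos by (simp add: divide_le_eq mult_ac)
  qed
  then have "(\<integral>\<^sup>+t\<in>{0..}. ennreal (T.disagreement t) \<partial>lebesgue) \<le> ennreal (?N * (\<gamma>\<^sup>2 * D))"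
    by (intro nn_integral_atLeast_le T.disagreement_continuous T.disagreement_nonneg)
  then have "cost net xh \<le> ennreal (1 / ?N) * ennreal (?N * (\<gamma>\<^sup>2 * D))"
    unfolding cost_def dis by (rule mult_left_mono) simp
  also have "\<dots> = ennreal D * ennreal (\<gamma>\<^sup>2)"
    using N D by (simp add: ennreal_mult[symmetric] mult_ac)
  finally have "cost net xh / ennreal D \<le> ennreal (\<gamma>\<^sup>2)"
    using D by (intro divide_le_posI_ennreal) auto
  then show "cost net xh / ennreal (x0 \<bullet> (P *\<^sub>v x0) + 1 / ?N * (signal_norm (stacked_dist net w v))\<^sup>2) \<le> ennreal (\<gamma>\<^sup>2)"
    unfolding D_def s_def .
qed

end

theorem theorem2:
  fixes net :: rr_network and \<gamma> :: real
    and Y X F U S R W G :: "nat \<Rightarrow> real mat"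
    and \<alpha> \<pi> \<epsilon> \<epsilon>' :: "nat \<Rightarrow> real"
  defines "n \<equiv> dim_x net" and "N \<equiv> num_nodes net"
  defines "K \<equiv> \<lambda>i. minv ((X i)\<^sup>T) * F i"
    and "L \<equiv> \<lambda>i. minv ((X i)\<^sup>T) * U i"
    and "P \<equiv> initial_weight net \<alpha> Y S"
  assumes "rr_network_wf net" and "0 < \<gamma>"
    and "\<And>i. i \<in> {1..N} \<Longrightarrow> Y i \<in> carrier_mat n n \<and> pos_def (Y i)"
    and "\<And>i. i \<in> {1..N} \<Longrightarrow> X i \<in> carrier_mat n n \<and> det (X i) \<noteq> 0"
    and "\<And>i. i \<in> {1..N} \<Longrightarrow> F i \<in> carrier_mat n (dim_h net i)"
    and "\<And>i. i \<in> {1..N} \<Longrightarrow> U i \<in> carrier_mat n (dim_y net i)"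
    and "\<And>i. i \<in> {1..N} \<Longrightarrow> S i \<in> carrier_mat n n \<and> pos_semidef (S i)"
    and "\<And>i. i \<in> {1..N} \<Longrightarrow> R i \<in> carrier_mat n n \<and> pos_semidef (R i)"
    and "\<And>i. i \<in> {1..N} \<Longrightarrow> W i \<in> carrier_mat n n \<and> pos_semidef (W i)"
    and "\<And>i. i \<in> {1..N} \<Longrightarrow> G i \<in> carrier_mat n n"
    and "\<And>i. i \<in> {1..N} \<Longrightarrow> 0 < \<alpha> i \<and> 0 < \<epsilon> i \<and> 0 < \<epsilon>' i"
    and "\<And>i. i \<in> {1..N} \<Longrightarrow>
           0 \<le> \<pi> i \<and> ereal (\<pi> i) < ereal (2 * \<alpha> i) * inverse (ereal (real (out_deg net i)))"
    and "\<And>i. i \<in> {1..N} \<Longrightarrow> pos_semidef (four_block_mat (R i) (G i) (G i)\<^sup>T (R i))"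
    and "\<And>i. i \<in> {1..N} \<Longrightarrow> neg_def (Xi_bar net \<gamma> \<alpha> \<pi> \<epsilon> \<epsilon>' Y X F U S R W G i)"
  shows "solves_estimation_problem net L K \<gamma> \<and>
         P \<in> carrier_mat n n \<and> pos_def P \<and> performance_bound net L K \<gamma> P"
proof -
  interpret rr_observers net \<gamma> Y X F U S R W G \<alpha> \<pi> \<epsilon> \<epsilon>'
    using assms(6-) unfolding n_def N_def by unfold_locales
  show ?thesis
    using errors_exp_stable performance_bound P_carrier pos_def_P
    unfolding solves_estimation_problem_def K_def L_def P_def n_def by blast
qed

end
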